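(* Let $M\subset\mathbb{C}^n$ be a pseudoconvex real hypersurface and $p\in M$ a point of Levi rank $q$. Then the cubic tensor $\tau^3_p$ (and therefore its restriction $\tau^{31}_p$ to $\mathbb{C}K_p\times K^{10}_p\times\overline{K^{10}_p}$) vanishes identically. Equivalently, whenever $M$ is written near $p$ in the cubic normal form described in the context, that normal form satisfies $$\phi^{21}(z,\bar z_3)=\sum_{jkl}c_{jkl}\,z_{2j}z_{2k}\bar z_{3l},\qquad\phi^{111}(z_3,\bar z_3,u)=0.$$
   Context: Everything is $C^\infty$. $T=TM$; $H\subset T$ is the complex tangent bundle; $Q=T/H$; $\mathbb{C}T,\mathbb{C}H,\mathbb{C}Q$ are complexifications; $\mathbb{C}H=H^{10}\oplus\overline{H^{10}}$ is the decomposition into $(1,0)$ and $(0,1)$ vectors. "$L\in V$" means $L$ is a local section of $V$ near $p$. A contact form is a real $1$-form on $M$ vanishing on $H$; it pairs with $\mathbb{C}Q$ via $\langle\theta,\cdot\rangle$. The Levi form is the bilinear map $\tau^2_p\colon H^{10}_p\times\overline{H^{10}_p}\to\mathbb{C}Q_p$ with $\langle\theta_p,\tau^2_p(L^2_p,L^1_p)\rangle=i\langle\theta,[L^2,L^1]\rangle_p$ for all contact forms $\theta$; the Levi rank is its rank. Levi kernel: $K^{10}_p=\{v\in H^{10}_p:\tau^2_p(v,\bar u)=0\ \forall u\in H^{10}_p\}$, $\mathbb{C}K_p=K^{10}_p\oplus\overline{K^{10}_p}$. $M$ is pseudoconvex if (locally) there is a nowhere zero contact form $\theta$ with $\langle\theta_x,\tau^2_x(v,\bar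 v)\rangle\ge0$ for all $x$ and $v\in H^{10}_x$. $\tau^3_p\colon\mathbb{C}T_p\times K^{10}_p\times\overline{K^{10}_p}\to\mathbb{C}Q_p$ is the tensor given by $\langle\theta_p,\tau^3_p(L^3_p,L^2_p,L^1_p)\rangle=i(L^3\langle\theta,[L^2,L^1]\rangle)_p$ for contact forms $\theta$, $L^3\in\mathbb{C}T$, $L^2,\overline{L^1}\in H^{10}$ with $L^2_p,\overline{L^1_p}\in K^{10}_p$. Cubic normal form: local holomorphic coordinates $(w,z_2,z_3)\in\mathbb{C}\times\mathbb{C}^q\times\mathbb{C}^{n-q-1}$ vanishing at $p$ in which $M$ is $w+\bar w=\phi(z,\bar z,i(w-\bar w))$ with $\phi(z,\bar z,u)=\sum_j\pm|z_{2j}|^2+2\,\mathrm{Re}\,\phi^{21}(z,\bar z_3)+\phi^{111}(z_3,\bar z_3,u)+O(4)$, where $\phi^{21}$ is a linear combination of monomials $z_{2j}z_{2k}\bar z_{3l}$, $z_{2j}z_{3k}\bar z_{3l}$, $z_{3j}z_{3k}\bar z_{3l}$, and $\phi^{111}=\sum_j\varepsilon_j|z_{3j}|^2u$ with $\varepsilon_j\in\{-1,0,1\}$. (Such coordinates always exist.) *)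

theory Defs
  imports
    "HOL-Analysis.Analysis"
    "HOL-Library.Landau_Symbols"
    "HOL-Library.Function_Algebras"
begin

section \<open>Smooth maps\<close>

primrec Ck_on ::
  "nat \<Rightarrow> 'a::real_normed_vector set \<Rightarrow> ('a \<Rightarrow> 'b::real_normed_vector) \<Rightarrow> bool" where
  "Ck_on 0 S f \<longleftrightarrow> continuous_on S f"
| "Ck_on (Suc k) S f \<longleftrightarrow>
     (\<forall>x\<in>S. f differentiable (at x)) \<and>
     (\<forall>v. Ck_on k S (\<lambda>x. frechet_derivative f (at x) v))"

text \<open>Only used for open sets in finite-dimensional spaces.\<close>

definition smooth_on ::
  "'a::real_normed_vector set \<Rightarrow> ('a \<Rightarrow> 'b::real_normed_vector) \<Rightarrow> bool" where
  "smooth_on S f \<longleftrightarrow> (\<forall>k. Ck_on k S f)"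


section \<open>Complexified vectors\<close>

text \<open>
  An element \<open>(X, Y)\<close> of \<open>cvec\<close> is the vector \<open>X + i Y\<close> in the complexification of the
  real vector space underlying \<open>\<complex>\<^sup>n\<close>.  The scalar multiplication \<open>cscale\<close> of
  the complexification must not be confused with the complex structure \<open>J\<close> of \<open>\<complex>\<^sup>n\<close>,
  whose complex linear extension is \<open>cJ\<close>.
\<close>

type_synonym 'n cvec = "(complex ^ 'n) \<times> (complex ^ 'n)"

definition cscale :: "complex \<Rightarrow> ('n::finite) cvec \<Rightarrow> 'n cvec" where
  "cscale c Z = (Re c *\<^sub>R fst Z - Im c *\<^sub>R snd Z, Re c *\<^sub>R snd Z + Im c *\<^sub>R fst Z)"

definition cconj :: "('n::finite) cvec \<Rightarrow> 'n cvec" where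
  "cconj Z = (fst Z, - snd Z)"

definition cJ :: "('n::finite) cvec \<Rightarrow> 'n cvec" where
  "cJ Z = (\<i> *s fst Z, \<i> *s snd Z)"

text \<open>Real one-forms are maps into the dual space; they are paired complex linearly.\<close>

definition cpair :: "((complex ^ 'n::finite) \<Rightarrow>\<^sub>L real) \<Rightarrow> 'n cvec \<Rightarrow> complex" where
  "cpair \<omega> Z = Complex (blinfun_apply \<omega> (fst Z)) (blinfun_apply \<omega> (snd Z))"

text \<open>Derivative of a complex function, respectively of a complexified vector field, at \<open>x\<close>
  along a complexified vector.\<close>

definition cderiv :: "('n::finite) cvec \<Rightarrow> (complex ^ 'n \<Rightarrow> complex) \<Rightarrow> complex ^ 'n \<Rightarrow> complex" where
  "cderiv Z f x =
     frechet_derivative f (at x) (fst Z) + \<i> * frechet_derivative f (at x) (snd Z)"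

definition cderiv_field ::
  "('n::finite) cvec \<Rightarrow> (complex ^ 'n \<Rightarrow> 'n cvec) \<Rightarrow> complex ^ 'n \<Rightarrow> 'n cvec" where
  "cderiv_field Z L x =
     frechet_derivative L (at x) (fst Z) + cscale \<i> (frechet_derivative L (at x) (snd Z))"

definition bracket ::
  "(complex ^ 'n \<Rightarrow> ('n::finite) cvec) \<Rightarrow> (complex ^ 'n \<Rightarrow> 'n cvec) \<Rightarrow> complex ^ 'n \<Rightarrow> 'n cvec" where
  "bracket L L' x = cderiv_field (L x) L' x - cderiv_field (L' x) L x"


section \<open>Real hypersurfaces\<close>

definition defining_function ::
  "(complex ^ 'n::finite) set \<Rightarrow> (complex ^ 'n) set \<Rightarrow> (complex ^ 'n \<Rightarrow> real) \<Rightarrow> bool" where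
  "defining_function M U r \<longleftrightarrow>
     open U \<and> smooth_on U r \<and> M \<inter> U = {x \<in> U. r x = 0} \<and>
     (\<forall>x \<in> M \<inter> U. frechet_derivative r (at x) \<noteq> (\<lambda>v. 0))"

definition real_hypersurface :: "(complex ^ 'n::finite) set \<Rightarrow> bool" where
  "real_hypersurface M \<longleftrightarrow> (\<forall>p\<in>M. \<exists>U r. p \<in> U \<and> defining_function M U r)"

definition tangent_space :: "(complex ^ 'n::finite) set \<Rightarrow> complex ^ 'n \<Rightarrow> (complex ^ 'n) set" where
  "tangent_space M p =
     {v. \<exists>U r. p \<in> U \<and> defining_function M U r \<and> frechet_derivative r (at p) v = 0}"

definition complex_tangent_space ::
  "(complex ^ 'n::finite) set \<Rightarrow> complex ^ 'n \<Rightarrow> (complex ^ 'n) set" where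
  "complex_tangent_space M p = {v \<in> tangent_space M p. \<i> *s v \<in> tangent_space M p}"

definition CT :: "(complex ^ 'n::finite) set \<Rightarrow> complex ^ 'n \<Rightarrow> 'n cvec set" where
  "CT M p = tangent_space M p \<times> tangent_space M p"

definition CH :: "(complex ^ 'n::finite) set \<Rightarrow> complex ^ 'n \<Rightarrow> 'n cvec set" where
  "CH M p = complex_tangent_space M p \<times> complex_tangent_space M p"

text \<open>The fibre of \<open>\<complex>Q = \<complex>T / \<complex>H\<close>, consisting of cosets; its zero is \<open>CH M p\<close>.\<close>

definition CQ :: "(complex ^ 'n::finite) set \<Rightarrow> complex ^ 'n \<Rightarrow> 'n cvec set set" where
  "CQ M p = CT M p // {(Z, Z'). Z \<in> CT M p \<and> Z' \<in> CT M p \<and> Z - Z' \<in> CH M p}"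

abbreviation CQ_zero :: "(complex ^ 'n::finite) set \<Rightarrow> complex ^ 'n \<Rightarrow> 'n cvec set" where
  "CQ_zero M p \<equiv> CH M p"

definition H10 :: "(complex ^ 'n::finite) set \<Rightarrow> complex ^ 'n \<Rightarrow> 'n cvec set" where
  "H10 M p = {Z \<in> CH M p. cJ Z = cscale \<i> Z}"

definition H01 :: "(complex ^ 'n::finite) set \<Rightarrow> complex ^ 'n \<Rightarrow> 'n cvec set" where
  "H01 M p = cconj ` H10 M p"

text \<open>Sections and forms on \<open>M\<close> near \<open>p\<close> are represented by smooth extensions to a
  neighbourhood of \<open>p\<close> in \<open>\<complex>\<^sup>n\<close>.\<close>

definition local_section ::
  "(complex ^ 'n::finite) set \<Rightarrow> (complex ^ 'n \<Rightarrow> 'n cvec set) \<Rightarrow> complex ^ 'n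
     \<Rightarrow> (complex ^ 'n \<Rightarrow> 'n cvec) \<Rightarrow> bool" where
  "local_section M V p L \<longleftrightarrow>
     (\<exists>U. open U \<and> p \<in> U \<and> smooth_on U L \<and> (\<forall>x \<in> M \<inter> U. L x \<in> V x))"

definition contact_form_on ::
  "(complex ^ 'n::finite) set \<Rightarrow> (complex ^ 'n) set \<Rightarrow> (complex ^ 'n \<Rightarrow> (complex ^ 'n) \<Rightarrow>\<^sub>L real) \<Rightarrow> bool" where
  "contact_form_on M U \<theta> \<longleftrightarrow>
     open U \<and> smooth_on U \<theta> \<and>
     (\<forall>x \<in> M \<inter> U. \<forall>X \<in> complex_tangent_space M x. blinfun_apply (\<theta> x) X = 0)"

definition local_contact_form ::
  "(complex ^ 'n::finite) set \<Rightarrow> complex ^ 'n \<Rightarrow> (complex ^ 'n \<Rightarrow> (complex ^ 'n) \<Rightarrow>\<^sub>L real) \<Rightarrow> bool" where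
  "local_contact_form M p \<theta> \<longleftrightarrow> (\<exists>U. p \<in> U \<and> contact_form_on M U \<theta>)"

text \<open>Pairing of a covector vanishing on \<open>CH M p\<close> with a coset: the common value on its
  representatives.\<close>

definition qpair :: "((complex ^ 'n::finite) \<Rightarrow>\<^sub>L real) \<Rightarrow> 'n cvec set \<Rightarrow> complex" where
  "qpair \<omega> c = the_elem (cpair \<omega> ` c)"


section \<open>The Levi form and the cubic tensor\<close>

definition levi_form ::
  "(complex ^ 'n::finite) set \<Rightarrow> complex ^ 'n \<Rightarrow> 'n cvec \<Rightarrow> 'n cvec \<Rightarrow> 'n cvec set" where
  "levi_form M p v2 v1 =
     (THE c. c \<in> CQ M p \<and>
        (\<forall>L2 L1 \<theta>.
           local_section M (H10 M) p L2 \<and> L2 p = v2 \<and>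
           local_section M (H01 M) p L1 \<and> L1 p = v1 \<and>
           local_contact_form M p \<theta> \<longrightarrow>
           qpair (\<theta> p) c = \<i> * cpair (\<theta> p) (bracket L2 L1 p)))"

text \<open>
  The Levi rank is the dimension of the image of the complex linear map
  \<open>H10 M p \<rightarrow> Hom(H01 M p, CQ M p)\<close> induced by the Levi form.  As \<open>CQ M p\<close> is a line,
  contact forms identify the elements of the target with functions on \<open>H01 M p\<close>
  (extended by zero); running over all contact forms only rescales the image.
\<close>

definition levi_rank :: "(complex ^ 'n::finite) set \<Rightarrow> complex ^ 'n \<Rightarrow> nat" where
  "levi_rank M p =
     vector_space.dim (\<lambda>(a::complex) (f :: 'n cvec \<Rightarrow> complex) u. a * f u)
       {(\<lambda>u. if u \<in> H01 M p then qpair (\<theta> p) (levi_form M p v u) else 0) | v \<theta>.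
          v \<in> H10 M p \<and> local_contact_form M p \<theta>}"

definition K10 :: "(complex ^ 'n::finite) set \<Rightarrow> complex ^ 'n \<Rightarrow> 'n cvec set" where
  "K10 M p = {v \<in> H10 M p. \<forall>u \<in> H10 M p. levi_form M p v (cconj u) = CQ_zero M p}"

definition K01 :: "(complex ^ 'n::finite) set \<Rightarrow> complex ^ 'n \<Rightarrow> 'n cvec set" where
  "K01 M p = cconj ` K10 M p"

definition CK :: "(complex ^ 'n::finite) set \<Rightarrow> complex ^ 'n \<Rightarrow> 'n cvec set" where
  "CK M p = {v + u | v u. v \<in> K10 M p \<and> u \<in> K01 M p}"

definition pseudoconvex :: "(complex ^ 'n::finite) set \<Rightarrow> bool" where
  "pseudoconvex M \<longleftrightarrow>
     (\<forall>p\<in>M. \<exists>U \<theta>. p \<in> U \<and> contact_form_on M U \<theta> \<and>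
        (\<forall>x \<in> M \<inter> U. \<exists>X \<in> tangent_space M x. blinfun_apply (\<theta> x) X \<noteq> 0) \<and>
        (\<forall>x \<in> M \<inter> U. \<forall>v \<in> H10 M x. qpair (\<theta> x) (levi_form M x v (cconj v)) \<in> \<real>\<^sub>\<ge>\<^sub>0))"

text \<open>For \<open>v3 \<in> CT M p\<close>, \<open>v2 \<in> K10 M p\<close>, \<open>v1 \<in> K01 M p\<close>.\<close>

definition cubic_tensor ::
  "(complex ^ 'n::finite) set \<Rightarrow> complex ^ 'n \<Rightarrow> 'n cvec \<Rightarrow> 'n cvec \<Rightarrow> 'n cvec \<Rightarrow> 'n cvec set" where
  "cubic_tensor M p v3 v2 v1 =
     (THE c. c \<in> CQ M p \<and>
        (\<forall>L3 L2 L1 \<theta>.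
           local_section M (CT M) p L3 \<and> L3 p = v3 \<and>
           local_section M (H10 M) p L2 \<and> L2 p = v2 \<and>
           local_section M (H01 M) p L1 \<and> L1 p = v1 \<and>
           local_contact_form M p \<theta> \<longrightarrow>
           qpair (\<theta> p) c = \<i> * cderiv (L3 p) (\<lambda>x. cpair (\<theta> x) (bracket L2 L1 x)) p))"


section \<open>Cubic normal form\<close>

definition holomorphic_map_on ::
  "(complex ^ 'n::finite) set \<Rightarrow> (complex ^ 'n \<Rightarrow> complex ^ 'n) \<Rightarrow> bool" where
  "holomorphic_map_on U F \<longleftrightarrow>
     open U \<and> (\<forall>x\<in>U. \<exists>D. (F has_derivative D) (at x) \<and> (\<forall>a v. D (a *s v) = a *s D v))"

definition holomorphic_chart ::
  "(complex ^ 'n::finite) set \<Rightarrow> (complex ^ 'n \<Rightarrow> complex ^ 'n) \<Rightarrow> bool" where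
  "holomorphic_chart U F \<longleftrightarrow>
     holomorphic_map_on U F \<and> inj_on F U \<and> holomorphic_map_on (F ` U) (the_inv_into U F)"

text \<open>
  The coordinate with index \<open>k0\<close> is \<open>w\<close>; those with index in \<open>I2\<close> form \<open>z\<^sub>2\<close> and those with
  index in \<open>- insert k0 I2\<close> form \<open>z\<^sub>3\<close>.  The vector \<open>z = (z\<^sub>2, z\<^sub>3)\<close> is represented
  with a dummy zero in position \<open>k0\<close>, and only such arguments \<open>z\<close> of the function \<open>\<phi>\<close> matter.
\<close>

definition zpart :: "'n \<Rightarrow> complex ^ 'n::finite \<Rightarrow> complex ^ 'n" where
  "zpart k0 \<zeta> = (\<chi> j. if j = k0 then 0 else \<zeta> $ j)"

definition graph_in_chart ::
  "(complex ^ 'n::finite) set \<Rightarrow> (complex ^ 'n) set \<Rightarrow> (complex ^ 'n \<Rightarrow> complex ^ 'n) \<Rightarrow> 'n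
     \<Rightarrow> ((complex ^ 'n) \<times> real \<Rightarrow> real) \<Rightarrow> bool" where
  "graph_in_chart M U F k0 \<phi> \<longleftrightarrow>
     (\<exists>N. open N \<and> 0 \<in> N \<and> smooth_on N \<phi> \<and>
        (\<forall>\<zeta> \<in> F ` U. (zpart k0 \<zeta>, Re (\<i> * (\<zeta> $ k0 - cnj (\<zeta> $ k0)))) \<in> N)) \<and>
     F ` (M \<inter> U) =
       {\<zeta> \<in> F ` U. \<zeta> $ k0 + cnj (\<zeta> $ k0) =
          of_real (\<phi> (zpart k0 \<zeta>, Re (\<i> * (\<zeta> $ k0 - cnj (\<zeta> $ k0)))))}"

definition is_phi21 :: "'n set \<Rightarrow> 'n set \<Rightarrow> (complex ^ 'n::finite \<Rightarrow> complex) \<Rightarrow> bool" where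
  "is_phi21 I2 I3 \<phi>21 \<longleftrightarrow>
     (\<exists>a b c. \<forall>z. \<phi>21 z =
        (\<Sum>j\<in>I2. \<Sum>k\<in>I2. \<Sum>l\<in>I3. a j k l * z $ j * z $ k * cnj (z $ l)) +
        (\<Sum>j\<in>I2. \<Sum>k\<in>I3. \<Sum>l\<in>I3. b j k l * z $ j * z $ k * cnj (z $ l)) +
        (\<Sum>j\<in>I3. \<Sum>k\<in>I3. \<Sum>l\<in>I3. c j k l * z $ j * z $ k * cnj (z $ l)))"

definition is_phi111 :: "'n set \<Rightarrow> (complex ^ 'n::finite \<Rightarrow> real \<Rightarrow> real) \<Rightarrow> bool" where
  "is_phi111 I3 \<phi>111 \<longleftrightarrow>
     (\<exists>\<epsilon>. (\<forall>j\<in>I3. \<epsilon> j \<in> {-1, 0, 1}) \<and>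
        (\<forall>z u. \<phi>111 z u = (\<Sum>j\<in>I3. \<epsilon> j * (cmod (z $ j))\<^sup>2 * u)))"

text \<open>The error term is of order four in all variables \<open>z, u\<close> jointly, unweighted.\<close>

definition cubic_normal_form ::
  "(complex ^ 'n::finite) set \<Rightarrow> complex ^ 'n \<Rightarrow> nat
     \<Rightarrow> (complex ^ 'n) set \<Rightarrow> (complex ^ 'n \<Rightarrow> complex ^ 'n) \<Rightarrow> 'n \<Rightarrow> 'n set
     \<Rightarrow> ((complex ^ 'n) \<times> real \<Rightarrow> real)
     \<Rightarrow> (complex ^ 'n \<Rightarrow> complex) \<Rightarrow> (complex ^ 'n \<Rightarrow> real \<Rightarrow> real) \<Rightarrow> bool" where
  "cubic_normal_form M p q U F k0 I2 \<phi> \<phi>21 \<phi>111 \<longleftrightarrow>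
     p \<in> U \<and> holomorphic_chart U F \<and> F p = 0 \<and>
     k0 \<notin> I2 \<and> card I2 = q \<and>
     graph_in_chart M U F k0 \<phi> \<and>
     is_phi21 I2 (- insert k0 I2) \<phi>21 \<and> is_phi111 (- insert k0 I2) \<phi>111 \<and>
     (\<exists>\<sigma>. (\<forall>j\<in>I2. \<sigma> j \<in> {-1, 1}) \<and>
        (\<lambda>(z, u). \<phi> (z, u) -
            ((\<Sum>j\<in>I2. \<sigma> j * (cmod (z $ j))\<^sup>2) + 2 * Re (\<phi>21 z) + \<phi>111 z u))
          \<in> O[at 0 within {(z, u). z $ k0 = 0}](\<lambda>x. norm x ^ 4))"

end

theory Submission
  imports Defs "HOL-Complex_Analysis.Cauchy_Integral_Formula"
begin

text \<open>
  Everything rests on one elementary remark. Let \<open>r\<close> define \<open>M\<close> near \<open>p\<close>, and write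
  \<open>lev r x a b\<close> for the real part of the complex Hessian of \<open>r\<close> (four times
  \<open>Re (\<Sum> r\<^sub>j\<^sub>k a\<^sub>j cnj b\<^sub>k)\<close> with the mixed derivatives of \<open>r\<close>). Pseudoconvexity says that, up to
  a fixed sign, \<open>lev r x a a \<ge> 0\<close> for \<open>x \<in> M\<close> near \<open>p\<close> and \<open>a\<close> in the complex tangent space at
  \<open>x\<close> (\<open>pseudoconvex_lev\<close>). If \<open>A\<close> is a field of complex tangent vectors and \<open>A p\<close> lies in the
  Levi kernel, then \<open>x \<mapsto> lev r x (A x) (A x)\<close> has, up to this sign, a minimum on \<open>M\<close> at \<open>p\<close>, so its
  derivative along every tangent vector of \<open>M\<close> is zero (\<open>lev_critical\<close>); polarization gives
  the same for \<open>lev r x (A x) (B x)\<close>.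

  For the tensor, the bracket of a \<open>(1,0)\<close> section with a \<open>(0,1)\<close> section has to be expressed
  by \<open>lev\<close>. If \<open>d\<^sup>cr = dr \<circ> J\<close>, then the values of \<open>d\<^sup>cr\<close> on the bracket are, up to constants, those
  of \<open>lev r\<close> on the values of the sections (\<open>bracket_levi\<close>), because differentiating
  \<open>dr (J B) = 0\<close> along \<open>M\<close> trades derivatives of \<open>B\<close> for second derivatives of \<open>r\<close>. Every contact form is a multiple of \<open>d\<^sup>cr\<close>
  on the tangent spaces (\<open>contact_proportional\<close>). Hence the Levi form is well defined
  (\<open>levi_form_eq_bracket\<close>), its kernel is contained in that of \<open>lev r p\<close> (\<open>K10_lev\<close>), and on \<open>M\<close>
  the function differentiated in the definition of the cubic tensor is a smooth multiple of a function
  that vanishes at \<open>p\<close> together with its tangential derivatives (\<open>cubic_critical\<close>).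

  For the normal form, the function \<open>\<rho> = \<phi> - (w + cnj w)\<close> of the holomorphic coordinates,
  composed with the chart, defines \<open>M\<close>. The complex Hessian transforms as a tensor under a
  holomorphic map, since the second derivative of the map is complex bilinear
  (\<open>lev_compose_holomorphic\<close>). So the derivative of \<open>lev \<rho> y a a\<close> at the origin vanishes in
  all tangential directions whenever \<open>a\<close> has only \<open>z\<^sub>3\<close> components (\<open>chart_levi_critical\<close>). This
  derivative only sees the cubic part of \<open>\<rho>\<close>, and its values in the directions \<open>z\<^sub>2\<close>, \<open>z\<^sub>3\<close>
  and \<open>u\<close> give, respectively, the \<open>z\<^sub>2 z\<^sub>3 cnj z\<^sub>3\<close> terms, the \<open>z\<^sub>3 z\<^sub>3 cnj z\<^sub>3\<close> terms and
  \<open>\<phi>\<^sup>1\<^sup>1\<^sup>1\<close>.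

  Two analytic facts are built along the way: charts, which are only assumed to be complex
  differentiable, are smooth (by Cauchy's formula on complex lines), and the third order
  jet of a function at the origin can be read off from an expansion with an error of fourth
  order (by iterated differences).
\<close>

section \<open>Calculus of \<open>C\<^sup>k\<close> maps\<close>

abbreviation dd :: "('a::real_normed_vector \<Rightarrow> 'b::real_normed_vector) \<Rightarrow> 'a \<Rightarrow> 'a \<Rightarrow> 'b" where
  "dd f x \<equiv> frechet_derivative f (at x)"

lemma dd_eqI: "(f has_derivative f') (at x) \<Longrightarrow> dd f x = f'"
  by (metis frechet_derivative_at)

lemma dd_has_derivative: "f differentiable (at x) \<Longrightarrow> (f has_derivative dd f x) (at x)"
  by (simp add: frechet_derivative_works[symmetric])

lemma linear_dd: "f differentiable (at x) \<Longrightarrow> linear (dd f x)"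
  by (rule linear_frechet_derivative)

text \<open>
  Expansion in the Euclidean basis reduces a map that is linear in one argument to finitely
  many maps without that argument.
\<close>

lemma linear_expand:
  fixes f :: "'a::euclidean_space \<Rightarrow> 'b::real_vector"
  assumes "linear f"
  shows "f v = (\<Sum>b\<in>Basis. (v \<bullet> b) *\<^sub>R f b)"
proof -
  have "f v = f (\<Sum>b\<in>Basis. (v \<bullet> b) *\<^sub>R b)"
    by (simp only: euclidean_representation)
  then show ?thesis
    by (simp only: linear_sum[OF assms] linear_scale[OF assms])
qed

lemma Ck_on_cong:
  assumes "open S" and "\<And>x. x \<in> S \<Longrightarrow> f x = g x"
  shows "Ck_on k S f \<longleftrightarrow> Ck_on k S g"
proof -
  have imp: "Ck_on k S f" if "Ck_on k S g" "\<And>x. x \<in> S \<Longrightarrow> f x = g x"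
    for f g :: "'a \<Rightarrow> 'b"
    using that
  proof (induction k arbitrary: f g)
    case 0
    then show ?case
      unfolding Ck_on.simps by (metis continuous_on_cong)
  next
    case (Suc k)
    have d: "(f has_derivative dd g x) (at x)" if "x \<in> S" for x
    proof (rule has_derivative_transform_within_open[OF _ assms(1) that])
      show "(g has_derivative dd g x) (at x)"
        using Suc.prems(1) that by (intro dd_has_derivative) simp
      show "g y = f y" if "y \<in> S" for y
        using Suc.prems(2)[OF that] by (rule sym)
    qed
    have "Ck_on k S (\<lambda>x. dd g x v)" for v
      using Suc.prems(1) by simp
    then have "Ck_on k S (\<lambda>x. dd f x v)" for v
      by (rule Suc.IH) (simp add: dd_eqI[OF d])
    moreover have "f differentiable (at x)" if "x \<in> S" for x
      using d[OF that] unfolding differentiable_def by blast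
    ultimately show ?case
      by simp
  qed
  show ?thesis
    using imp[of f g] imp[of g f] assms(2) by auto
qed

lemma Ck_on_SucI:
  assumes "open S" and "\<And>x. x \<in> S \<Longrightarrow> (f has_derivative f' x) (at x)"
    and "\<And>v. Ck_on k S (\<lambda>x. f' x v)"
  shows "Ck_on (Suc k) S f"
proof -
  have "Ck_on k S (\<lambda>x. dd f x v)" for v
    using assms(3)[of v] by (subst Ck_on_cong[OF assms(1)]) (auto simp: dd_eqI[OF assms(2)])
  moreover have "f differentiable (at x)" if "x \<in> S" for x
    using assms(2)[OF that] unfolding differentiable_def by blast
  ultimately show ?thesis
    by simp
qed

lemma Ck_on_Suc_imp: "Ck_on (Suc k) S f \<Longrightarrow> Ck_on k S f"
proof (induction k arbitrary: f)
  case 0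
  then show ?case
    by (simp add: continuous_at_imp_continuous_on differentiable_imp_continuous_within)
next
  case (Suc k)
  show ?case
    unfolding Ck_on.simps(2)
    using Suc.prems Suc.IH unfolding Ck_on.simps(2)[of "Suc k"] by blast
qed

lemma Ck_on_mono: "j \<le> k \<Longrightarrow> Ck_on k S f \<Longrightarrow> Ck_on j S f"
  by (induction rule: dec_induct) (auto dest: Ck_on_Suc_imp simp del: Ck_on.simps)

lemma Ck_on_subset: "Ck_on k S f \<Longrightarrow> S' \<subseteq> S \<Longrightarrow> Ck_on k S' f"
  by (induction k arbitrary: f) (auto intro: continuous_on_subset)

lemma Ck_on_const: "open S \<Longrightarrow> Ck_on k S (\<lambda>x. c)"
  by (induction k arbitrary: c) (auto simp: continuous_on_const)

lemma Ck_on_linear: 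
  assumes "open S" "bounded_linear h" shows "Ck_on k S h"
proof (cases k)
  case 0
  then show ?thesis using assms by (simp add: linear_continuous_on)
next
  case (Suc j)
  show ?thesis
    unfolding Suc using assms
    by (intro Ck_on_SucI[of S h "\<lambda>_. h" j] bounded_linear_imp_has_derivative Ck_on_const)
qed

lemma Ck_on_linear_comp:
  assumes "open S" "bounded_linear h" "Ck_on k S f" 
  shows "Ck_on k S (\<lambda>x. h (f x))"
  using assms(3)
proof (induction k arbitrary: f)
  case 0
  then show ?case using assms(2)
    by (auto intro: bounded_linear.continuous_on)
next
  case (Suc k)
  show ?case
  proof (rule Ck_on_SucI[OF assms(1)])
    show "((\<lambda>x. h (f x)) has_derivative (\<lambda>v. h (dd f x v))) (at x)" if "x \<in> S" for x
      using Suc.prems that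
      by (intro bounded_linear.has_derivative[OF assms(2)]) (auto simp: dd_has_derivative)
    show "Ck_on k S (\<lambda>x. h (dd f x v))" for v
      using Suc by auto
  qed
qed

lemma Ck_on_add:
  assumes "open S" "Ck_on k S f" "Ck_on k S g" 
  shows "Ck_on k S (\<lambda>x. f x + g x)"
  using assms(2,3)
proof (induction k arbitrary: f g)
  case 0
  then show ?case by (auto intro: continuous_on_add)
next
  case (Suc k)
  show ?case
  proof (rule Ck_on_SucI[OF assms(1)])
    show "((\<lambda>x. f x + g x) has_derivative (\<lambda>v. dd f x v + dd g x v)) (at x)" if "x \<in> S" for x
      using Suc.prems that by (intro has_derivative_add) (auto simp: dd_has_derivative)
    show "Ck_on k S (\<lambda>x. dd f x v + dd g x v)" for v
      using Suc by auto
  qed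
qed

lemma Ck_on_sum:
  assumes "open S" "\<And>i. i \<in> I \<Longrightarrow> Ck_on k S (f i)"
  shows "Ck_on k S (\<lambda>x. \<Sum>i\<in>I. f i x)"
  using assms(2)
  by (induction I rule: infinite_finite_induct) (auto simp: Ck_on_const Ck_on_add assms(1))

lemma (in bounded_bilinear) Ck_on_prod:
  assumes "open S" "Ck_on k S f" "Ck_on k S g" 
  shows "Ck_on k S (\<lambda>x. prod (f x) (g x))"
  using assms(2,3)
proof (induction k arbitrary: f g)
  case 0
  then show ?case by (auto intro: continuous_on)
next
  case (Suc k)
  show ?case
  proof (rule Ck_on_SucI[OF assms(1)])
    show "((\<lambda>x. prod (f x) (g x)) has_derivative (\<lambda>v. prod (f x) (dd g x v) + prod (dd f x v) (g x))) (at x)"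
      if "x \<in> S" for x
      using Suc.prems that by (intro FDERIV) (auto simp: dd_has_derivative)
    have fg: "Ck_on k S f" "Ck_on k S g"
      using Suc.prems by (auto intro: Ck_on_Suc_imp simp del: Ck_on.simps)
    show "Ck_on k S (\<lambda>x. prod (f x) (dd g x v) + prod (dd f x v) (g x))" for v
      using Suc.prems fg Suc.IH by (intro Ck_on_add assms(1)) auto
  qed
qed

lemmas Ck_on_mult = bounded_bilinear.Ck_on_prod[OF bounded_bilinear_mult]
lemmas Ck_on_scaleR = bounded_bilinear.Ck_on_prod[OF bounded_bilinear_scaleR]

lemma Ck_on_inverse:
  fixes f :: "'a::real_normed_vector \<Rightarrow> 'b::real_normed_field"
  assumes "open S" "Ck_on k S f" "\<And>x. x \<in> S \<Longrightarrow> f x \<noteq> 0"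
  shows "Ck_on k S (\<lambda>x. inverse (f x))"
  using assms(2)
proof (induction k)
  case 0
  then show ?case using assms(3) by (auto intro: continuous_on_inverse)
next
  case (Suc k)
  show ?case
  proof (rule Ck_on_SucI[OF assms(1)])
    show "((\<lambda>x. inverse (f x)) has_derivative (\<lambda>v. (-1) * (inverse (f x) * dd f x v * inverse (f x)))) (at x)"
      if "x \<in> S" for x
      using Deriv.has_derivative_inverse[of f x "dd f x" UNIV] assms(3)[OF that] Suc.prems that
      by (simp add: dd_has_derivative)
    have inv: "Ck_on k S (\<lambda>x. inverse (f x))"
      by (rule Suc.IH[OF Ck_on_Suc_imp[OF Suc.prems]])
    show "Ck_on k S (\<lambda>x. (-1) * (inverse (f x) * dd f x v * inverse (f x)))" for v
      using Suc.prems inv by (intro Ck_on_mult assms(1) Ck_on_const) auto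
  qed
qed

text \<open>
  The outer derivative is expanded in the Euclidean basis, so that the chain rule becomes a
  sum of products of maps with one derivative less.
\<close>

lemma Ck_on_compose:
  fixes g :: "'a::real_normed_vector \<Rightarrow> 'b::euclidean_space"
    and f :: "'b \<Rightarrow> 'c::real_normed_vector"
  assumes "open S" "open T" "Ck_on k T f" "Ck_on k S g" "\<And>x. x \<in> S \<Longrightarrow> g x \<in> T"
  shows "Ck_on k S (\<lambda>x. f (g x))"
  using assms(3,4)
proof (induction k arbitrary: f)
  case 0
  then show ?case using assms(5) by (auto intro: continuous_on_compose2)
next
  case (Suc k)
  have g: "Ck_on k S g"
    by (rule Ck_on_Suc_imp[OF Suc.prems(2)])
  show ?case
  proof (rule Ck_on_SucI[OF assms(1)])
    fix x assume x: "x \<in> S"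
    have df: "(f has_derivative dd f (g x)) (at (g x))" and dg: "(g has_derivative dd g x) (at x)"
      using Suc.prems x assms(5) by (auto simp: dd_has_derivative)
    have eq: "dd f (g x) w = (\<Sum>b\<in>Basis. (w \<bullet> b) *\<^sub>R dd f (g x) b)" for w
      by (rule linear_expand[OF has_derivative_linear[OF df]])
    have "((\<lambda>x. f (g x)) has_derivative (\<lambda>v. dd f (g x) (dd g x v))) (at x)"
      using diff_chain_at[OF dg df] by (simp add: o_def)
    then show "((\<lambda>x. f (g x)) has_derivative
        (\<lambda>v. \<Sum>b\<in>Basis. (dd g x v \<bullet> b) *\<^sub>R dd f (g x) b)) (at x)"
      by (subst (asm) eq)
  next
    fix v
    have "Ck_on k S (\<lambda>x. dd f (g x) b)" for b
      using Suc.prems g by (intro Suc.IH) auto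
    then show "Ck_on k S (\<lambda>x. \<Sum>b\<in>Basis. (dd g x v \<bullet> b) *\<^sub>R dd f (g x) b)"
      using Suc.prems
      by (intro Ck_on_sum Ck_on_scaleR assms(1) Ck_on_linear_comp[OF _ bounded_linear_inner_left]) auto
  qed
qed

lemma smooth_onD: "smooth_on S f \<Longrightarrow> Ck_on k S f"
  by (simp add: smooth_on_def)

lemma smooth_on_dd: "smooth_on S f \<Longrightarrow> smooth_on S (\<lambda>x. dd f x v)"
  unfolding smooth_on_def by (metis Ck_on.simps(2))

lemma smooth_on_differentiable: "smooth_on S f \<Longrightarrow> x \<in> S \<Longrightarrow> f differentiable (at x)"
  using smooth_onD[of S f 1] by simp

lemma smooth_on_continuous: "smooth_on S f \<Longrightarrow> continuous_on S f"
  using smooth_onD[of S f 0] by simp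

lemma smooth_on_subset: "smooth_on S f \<Longrightarrow> S' \<subseteq> S \<Longrightarrow> smooth_on S' f"
  unfolding smooth_on_def by (metis Ck_on_subset)

text \<open>
  The product rule for \<open>\<Lambda> y (W y)\<close>. Differentiability of \<open>\<Lambda>\<close> enters only through the single
  values \<open>\<Lambda> y v\<close>, which is how the derivatives of a smooth function are given.
\<close>

lemma has_derivative_linear_family:
  fixes \<Lambda> :: "'a::real_normed_vector \<Rightarrow> 'b::euclidean_space \<Rightarrow> 'c::real_normed_vector"
  assumes "open S" "x \<in> S" and lin: "\<And>y. y \<in> S \<Longrightarrow> linear (\<Lambda> y)"
    and "\<And>v. (\<lambda>y. \<Lambda> y v) differentiable (at x)"
    and W: "(W has_derivative W') (at x)"
  shows "((\<lambda>y. \<Lambda> y (W y)) has_derivative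
           (\<lambda>h. dd (\<lambda>y. \<Lambda> y (W x)) x h + \<Lambda> x (W' h))) (at x)"
proof -
  define d where "d v h = dd (\<lambda>y. \<Lambda> y v) x h" for v h
  have D: "((\<lambda>y. \<Lambda> y v) has_derivative d v) (at x)" for v
    using assms(4) unfolding d_def by (intro dd_has_derivative)
  have expand: "\<Lambda> y v = (\<Sum>b\<in>Basis. (v \<bullet> b) *\<^sub>R \<Lambda> y b)" if "y \<in> S" for y v
    by (rule linear_expand[OF lin[OF that]])
  have "((\<lambda>y. \<Sum>b\<in>Basis. (W x \<bullet> b) *\<^sub>R \<Lambda> y b) has_derivative (\<lambda>h. \<Sum>b\<in>Basis. (W x \<bullet> b) *\<^sub>R d b h)) (at x)"
    by (auto intro!: derivative_eq_intros D)
  then have "((\<lambda>y. \<Lambda> y (W x)) has_derivative (\<lambda>h. \<Sum>b\<in>Basis. (W x \<bullet> b) *\<^sub>R d b h)) (at x)"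
    by (rule has_derivative_transform_within_open[OF _ assms(1,2)]) (simp add: expand[symmetric])
  then have dW: "d (W x) = (\<lambda>h. \<Sum>b\<in>Basis. (W x \<bullet> b) *\<^sub>R d b h)"
    using D has_derivative_unique by blast
  have "((\<lambda>y. \<Sum>b\<in>Basis. (W y \<bullet> b) *\<^sub>R \<Lambda> y b) has_derivative
     (\<lambda>h. \<Sum>b\<in>Basis. (W x \<bullet> b) *\<^sub>R d b h + (W' h \<bullet> b) *\<^sub>R \<Lambda> x b)) (at x)"
    by (intro has_derivative_sum has_derivative_scaleR has_derivative_inner_left W D)
  then have "((\<lambda>y. \<Lambda> y (W y)) has_derivative
     (\<lambda>h. \<Sum>b\<in>Basis. (W x \<bullet> b) *\<^sub>R d b h + (W' h \<bullet> b) *\<^sub>R \<Lambda> x b)) (at x)"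
    by (rule has_derivative_transform_within_open[OF _ assms(1,2)]) (simp add: expand[symmetric])
  moreover have "(\<Sum>b\<in>Basis. (W x \<bullet> b) *\<^sub>R d b h + (W' h \<bullet> b) *\<^sub>R \<Lambda> x b) = d (W x) h + \<Lambda> x (W' h)" for h
    unfolding dW expand[OF assms(2), of "W' h"] by (simp add: sum.distrib)
  ultimately show ?thesis by (simp add: d_def)
qed

section \<open>Holomorphic maps are smooth\<close>

definition cdiff_on :: "(complex ^ 'n::finite) set \<Rightarrow> (complex ^ 'n \<Rightarrow> complex) \<Rightarrow> bool" where
  "cdiff_on U f \<longleftrightarrow>
     (\<forall>x\<in>U. f differentiable (at x) \<and> (\<forall>a v. dd f x (a *s v) = a * dd f x v))"

lemma bounded_linear_smult_left: "bounded_linear (\<lambda>s. s *s (v :: complex ^ 'n::finite))"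
proof -
  have "linear (\<lambda>s. s *s v)"
    by (rule linearI) (simp_all add: vec_eq_iff distrib_right)
  then show ?thesis
    by (simp add: linear_conv_bounded_linear)
qed

lemma cdiff_onD:
  assumes "cdiff_on U f" "x \<in> U"
  shows "f differentiable (at x)" and "dd f x (a *s v) = a * dd f x v"
  using assms unfolding cdiff_on_def by blast+

lemma cdiff_on_continuous: "cdiff_on U f \<Longrightarrow> continuous_on U f"
  by (intro continuous_at_imp_continuous_on ballI differentiable_imp_continuous_within cdiff_onD(1))

lemma cdiff_on_line:
  assumes "cdiff_on U f" "x + s *s v \<in> U"
  shows "((\<lambda>s. f (x + s *s v)) has_field_derivative dd f (x + s *s v) v) (at s)"
proof -
  have "((\<lambda>s. x + s *s v) has_derivative (\<lambda>h. h *s v)) (at s)"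
    using has_derivative_add[OF has_derivative_const bounded_linear_imp_has_derivative[OF bounded_linear_smult_left[of v]]]
    by simp
  then have "((\<lambda>s. f (x + s *s v)) has_derivative (\<lambda>h. dd f (x + s *s v) (h *s v))) (at s)"
    using diff_chain_at[of "\<lambda>s. x + s *s v" "\<lambda>h. h *s v" s f "dd f (x + s *s v)"] assms
    by (simp add: o_def dd_has_derivative cdiff_on_def)
  moreover have "(\<lambda>h. dd f (x + s *s v) (h *s v)) = (*) (dd f (x + s *s v) v)"
    using assms by (simp add: cdiff_on_def fun_eq_iff mult.commute)
  ultimately show ?thesis
    by (simp add: has_field_derivative_def)
qed

text \<open>
  Cauchy's formula for the derivative of \<open>f\<close> restricted to the complex line through \<open>x\<close> in the
  direction \<open>v\<close>. The circle is written out as an integral over \<open>[0, 1]\<close>; the integrand depends on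
  \<open>x\<close> only through a value of \<open>f\<close>, so regularity of \<open>f\<close> passes to its derivative.
\<close>

lemma cdiff_on_Cauchy:
  assumes U: "open U" "cdiff_on U f" and "0 < R"
    and sub: "\<And>s. norm s \<le> R \<Longrightarrow> x + s *s v \<in> U"
  shows "((\<lambda>t. f (x + (R * cis (2 * pi * t)) *s v) * (cis (- (2 * pi * t)) / R)) has_integral dd f x v) {0..1}"
proof -
  let ?h = "\<lambda>s. f (x + s *s v)"
  define W where "W = (\<lambda>s. x + s *s v) -` U"
  have "open W"
    unfolding W_def
    by (intro open_vimage U(1) continuous_intros linear_continuous_on bounded_linear_smult_left)
  have hol: "?h holomorphic_on W"
    unfolding holomorphic_on_open[OF \<open>open W\<close>]
    using cdiff_on_line[OF U(2)] by (metis W_def vimageD)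
  have cb: "cball 0 R \<subseteq> W"
    using sub by (auto simp: W_def)
  have c: "continuous_on (cball 0 R) ?h"
    by (rule continuous_on_subset[OF holomorphic_on_imp_continuous_on[OF hol] cb])
  have h: "?h holomorphic_on ball 0 R"
    using cb ball_subset_cball by (intro holomorphic_on_subset[OF hol]) blast
  have w: "(0::complex) \<in> ball 0 R" using \<open>0 < R\<close> by simp
  let ?I = "contour_integral (circlepath 0 R) (\<lambda>u. ?h u / (u - 0)\<^sup>2)"
  have ci: "((\<lambda>u. ?h u / (u - 0)\<^sup>2) has_contour_integral ?I) (circlepath 0 R)"
    by (rule has_contour_integral_integral[OF Cauchy_derivative_integral_circlepath(1)[OF c h w]])
  have "(?h has_field_derivative (1 / (2 * of_real pi * \<i>) * ?I)) (at 0)"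
    by (rule Cauchy_derivative_integral_circlepath(2)[OF c h w])
  moreover have "(?h has_field_derivative dd f x v) (at 0)"
    using cdiff_on_line[OF U(2), of x 0 v] sub[of 0] \<open>0 < R\<close> by simp
  ultimately have I: "dd f x v = 1 / (2 * of_real pi * \<i>) * ?I"
    by (rule DERIV_unique[symmetric])
  have "((\<lambda>t. ?h (circlepath 0 R t) / (circlepath 0 R t - 0)\<^sup>2 *
        vector_derivative (circlepath 0 R) (at t within {0..1})) has_integral ?I) {0..1}"
    using ci by (simp add: has_contour_integral_def)
  then have "((\<lambda>t. 1 / (2 * of_real pi * \<i>) * (?h (circlepath 0 R t) / (circlepath 0 R t - 0)\<^sup>2 *
        vector_derivative (circlepath 0 R) (at t within {0..1}))) has_integral dd f x v) {0..1}"
    unfolding I by (rule has_integral_mult_right)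
  moreover have "1 / (2 * of_real pi * \<i>) * (?h (circlepath 0 R t) / (circlepath 0 R t - 0)\<^sup>2 *
        vector_derivative (circlepath 0 R) (at t within {0..1})) =
      f (x + (R * cis (2 * pi * t)) *s v) * (cis (- (2 * pi * t)) / R)" if "t \<in> {0..1}" for t
  proof -
    have e: "exp (2 * of_real pi * \<i> * of_real t) = cis (2 * pi * t)"
      by (simp add: cis_conv_exp mult_ac)
    have p: "circlepath 0 R t = R * cis (2 * pi * t)"
      by (simp add: circlepath e)
    have d: "vector_derivative (circlepath 0 R) (at t within {0..1}) = 2 * pi * \<i> * R * cis (2 * pi * t)"
      using that by (simp add: vector_derivative_circlepath01 e)
    have i: "cis (- (2 * pi * t)) = 1 / cis (2 * pi * t)"
      by (simp add: divide_inverse)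
    show ?thesis
      unfolding p d i using \<open>0 < R\<close> cis_neq_zero[of "2 * pi * t"]
      by (simp add: field_simps power2_eq_square)
  qed
  ultimately show ?thesis
    by (rule has_integral_eq[rotated])
qed

text \<open>
  Cauchy's formula is used twice: it shows that \<open>dd f x w\<close> is continuous in \<open>x\<close>, and this
  continuity permits differentiation under the integral sign in the formula for \<open>dd f x v\<close>. The
  derivative is then an integral of complex linear maps.
\<close>

lemma cdiff_on_dd:
  assumes U: "open U" "cdiff_on U f"
  shows "cdiff_on U (\<lambda>x. dd f x v)"
proof -
  note fcont = cdiff_on_continuous[OF U(2)]
  have ball: "\<exists>\<delta>>0. \<exists>R>0. \<forall>y\<in>ball x \<delta>. \<forall>s. norm s \<le> R \<longrightarrow> y + s *s w \<in> U" if x: "x \<in> U" for x w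
  proof -
    obtain e where e: "0 < e" "ball x e \<subseteq> U" using U(1) x open_contains_ball by blast
    obtain K where K: "0 < K" "\<And>s. norm (s *s w) \<le> norm s * K"
      using bounded_linear.pos_bounded[OF bounded_linear_smult_left[of w]] by blast
    have "y + s *s w \<in> U" if "y \<in> ball x (e / 2)" "norm s \<le> e / (4 * K)" for y s
    proof -
      have "norm (s *s w) \<le> e / (4 * K) * K"
        using K(2)[of s] mult_right_mono[OF that(2), of K] K(1) by linarith
      then have "norm (s *s w) < e / 2"
        using K(1) e(1) by simp
      then have "dist x (y + s *s w) < e"
        using that(1) dist_triangle[of x "y + s *s w" y] by (simp add: dist_norm)
      then show ?thesis using e(2) by auto
    qed
    then show ?thesis
      using e(1) K(1) by (intro exI[of _ "e/2"] conjI exI[of _ "e / (4 * K)"]) auto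
  qed
  have cc: "continuous_on A (\<lambda>z. g z * (cis (- (2 * pi * h z)) / R))" if "continuous_on A g" "continuous_on A h"
    for g :: "'z::topological_space \<Rightarrow> complex" and h and R :: complex and A
    unfolding divide_inverse using that by (intro continuous_intros) auto
  have cp: "continuous_on A (\<lambda>z. y z + (R * cis (2 * pi * h z)) *s w)"
    if "continuous_on A y" "continuous_on A h"
    for y :: "'z::topological_space \<Rightarrow> complex ^ 'a" and h and R :: real and A w
  proof -
    have "continuous_on A (\<lambda>z. R * cis (2 * pi * h z))"
      using that by (intro continuous_intros) auto
    then show ?thesis
      by (intro continuous_on_add that bounded_linear.continuous_on[OF bounded_linear_smult_left])
  qed
  have dcont: "continuous_on U (\<lambda>x. dd f x w)" for w
  proof (rule continuous_at_imp_continuous_on, rule ballI)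
    fix x assume "x \<in> U"
    then obtain \<delta> R where dR: "0 < \<delta>" "0 < R" "\<forall>y\<in>ball x \<delta>. \<forall>s. norm s \<le> R \<longrightarrow> y + s *s w \<in> U"
      using ball[of x w] by blast
    have "continuous_on (ball x \<delta> \<times> cbox 0 1)
      (\<lambda>(y, t). f (y + (R * cis (2 * pi * t)) *s w) * (cis (- (2 * pi * t)) / R))"
      unfolding split_beta
      using dR
      by (intro cc continuous_on_compose2[OF fcont cp]) (auto intro!: continuous_intros simp: norm_mult)
    then have "continuous_on (ball x \<delta>)
      (\<lambda>y. integral (cbox 0 1) (\<lambda>t. f (y + (R * cis (2 * pi * t)) *s w) * (cis (- (2 * pi * t)) / R)))"
      by (rule integral_continuous_on_param)
    moreover have "integral (cbox 0 1) (\<lambda>t. f (y + (R * cis (2 * pi * t)) *s w) * (cis (- (2 * pi * t)) / R)) = dd f y w"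
      if "y \<in> ball x \<delta>" for y
      unfolding cbox_interval
      by (rule integral_unique[OF cdiff_on_Cauchy[OF U dR(2)]]) (use dR(3) that in blast)
    ultimately have "continuous_on (ball x \<delta>) (\<lambda>y. dd f y w)"
      by (rule continuous_on_eq)
    then show "isCont (\<lambda>x. dd f x w) x"
      using dR(1) by (simp add: continuous_on_eq_continuous_at)
  qed
  define f' where "f' x = Blinfun (dd f x)" for x
  have f': "blinfun_apply (f' x) = dd f x" if "x \<in> U" for x
    unfolding f'_def using U(2) that has_derivative_bounded_linear[OF dd_has_derivative[of f x]]
    by (simp add: cdiff_on_def bounded_linear_Blinfun_apply)
  have f'cont: "continuous_on U f'"
    using dcont by (intro continuous_on_blinfun_componentwise) (simp add: f' cong: continuous_on_cong)
  have ex: "(\<exists>D. ((\<lambda>x. dd f x v) has_derivative D) (at x) \<and> (\<forall>a w. D (a *s w) = a * D w))" if x: "x \<in> U" for x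
  proof -
    obtain \<delta> R where dR: "0 < \<delta>" "0 < R" "\<forall>y\<in>ball x \<delta>. \<forall>s. norm s \<le> R \<longrightarrow> y + s *s v \<in> U"
      using ball[OF x, of v] by blast
    define q where "q y t = y + (R * cis (2 * pi * t)) *s v" for y t
    have qU: "q y t \<in> U" if "y \<in> ball x \<delta>" for y t
      using dR(2,3) that by (auto simp: q_def norm_mult)
    define F where "F y t = f (q y t) * (cis (- (2 * pi * t)) / R)" for y t
    define F' where "F' y t = blinfun_mult_left (cis (- (2 * pi * t)) / R) o\<^sub>L f' (q y t)" for y t
    have F'a: "blinfun_apply (F' y t) w = dd f (q y t) w * (cis (- (2 * pi * t)) / R)" if "y \<in> ball x \<delta>" for y t w
      by (simp add: F'_def f'[OF qU[OF that]])
    have F: "integral (cbox 0 1) (F y) = dd f y v" if "y \<in> ball x \<delta>" for y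
      unfolding cbox_interval F_def q_def
      by (rule integral_unique[OF cdiff_on_Cauchy[OF U dR(2)]]) (use dR(3) that in blast)
    have "((\<lambda>y. integral (cbox 0 1) (F y)) has_derivative integral (cbox 0 1) (F' x)) (at x within ball x \<delta>)"
    proof (rule leibniz_rule)
      show "((\<lambda>y. F y t) has_derivative blinfun_apply (F' y t)) (at y within ball x \<delta>)"
        if "y \<in> ball x \<delta>" for y t
      proof -
        have "((\<lambda>y. q y t) has_derivative (\<lambda>h. h)) (at y)"
          by (auto simp: q_def intro!: derivative_eq_intros)
        moreover have "(f has_derivative dd f (q y t)) (at (q y t))"
          using U(2) qU[OF that] by (simp add: cdiff_on_def dd_has_derivative)
        ultimately have "((\<lambda>y. f (q y t)) has_derivative dd f (q y t)) (at y)"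
          using diff_chain_at[of "\<lambda>y. q y t" "\<lambda>h. h" y f "dd f (q y t)"] by (simp add: o_def)
        then have "((\<lambda>y. F y t) has_derivative (\<lambda>h. dd f (q y t) h * (cis (- (2 * pi * t)) / R))) (at y)"
          unfolding F_def by (rule has_derivative_mult_left)
        moreover have "blinfun_apply (F' y t) = (\<lambda>h. dd f (q y t) h * (cis (- (2 * pi * t)) / R))"
          using F'a[OF that] by (simp add: fun_eq_iff)
        ultimately show ?thesis
          by (simp add: has_derivative_at_withinI)
      qed
      show "F y integrable_on cbox 0 1" if "y \<in> ball x \<delta>" for y
        unfolding cbox_interval F_def q_def
        by (rule has_integral_integrable[OF cdiff_on_Cauchy[OF U dR(2)]]) (use dR(3) that in blast)
      have qc: "continuous_on (ball x \<delta> \<times> cbox 0 (1::real)) (\<lambda>z. q (fst z) (snd z))"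
        unfolding q_def by (intro cp continuous_intros)
      have "continuous_on (ball x \<delta> \<times> cbox 0 1) (\<lambda>z. f' (q (fst z) (snd z)))"
        by (rule continuous_on_compose2[OF f'cont qc]) (auto intro!: qU)
      moreover have "continuous_on (ball x \<delta> \<times> cbox 0 1) (\<lambda>z. cis (- (2 * pi * snd z)) / complex_of_real R)"
        using cc[of _ "\<lambda>_. 1" snd "complex_of_real R"] by (simp add: continuous_on_snd)
      ultimately show "continuous_on (ball x \<delta> \<times> cbox 0 1) (\<lambda>(y, t). F' y t)"
        unfolding split_beta F'_def
        by (intro bounded_bilinear.continuous_on[OF bounded_bilinear_blinfun_compose]
            bounded_linear.continuous_on[OF bounded_linear_blinfun_mult_left])
      show "x \<in> ball x \<delta>" using dR(1) by simp
    qed auto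
    then have D: "((\<lambda>y. integral (cbox 0 1) (F y)) has_derivative integral (cbox 0 1) (F' x)) (at x)"
      using dR(1) by (simp add: at_within_open[of x "ball x \<delta>"])
    have xb: "x \<in> ball x \<delta>" using dR(1) by simp
    have "((\<lambda>y. dd f y v) has_derivative integral (cbox 0 1) (F' x)) (at x)"
      by (rule has_derivative_transform_within_open[OF D _ xb]) (simp_all only: F open_ball)
    moreover have "blinfun_apply (integral (cbox 0 1) (F' x)) (a *s w) = a * blinfun_apply (integral (cbox 0 1) (F' x)) w" for a w
    proof -
      have "continuous_on (cbox 0 1) (F' x)"
      proof -
        have "continuous_on (cbox 0 1) (\<lambda>t. f' (q x t))"
          by (rule continuous_on_compose2[OF f'cont]) (use qU[OF xb] in \<open>auto simp: q_def intro!: cp continuous_on_id continuous_on_const\<close>)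
        moreover have "continuous_on (cbox 0 1) (\<lambda>t. cis (- (2 * pi * t)) / complex_of_real R)"
          using cc[of _ "\<lambda>_. 1" "\<lambda>t. t" "complex_of_real R"] by (simp add: continuous_on_id)
        ultimately show ?thesis
          unfolding F'_def 
          by (intro bounded_bilinear.continuous_on[OF bounded_bilinear_blinfun_compose]
              bounded_linear.continuous_on[OF bounded_linear_blinfun_mult_left])
      qed
      then have "F' x integrable_on cbox 0 1"
        by (rule integrable_continuous)
      then have "blinfun_apply (integral (cbox 0 1) (F' x)) w = integral (cbox 0 1) (\<lambda>t. blinfun_apply (F' x t) w)" for w
        by (rule blinfun_apply_integral)
      moreover have "blinfun_apply (F' x t) (a *s w) = a * blinfun_apply (F' x t) w" for t
        using U(2) qU[OF xb, of t] by (simp add: F'a[OF xb] cdiff_on_def)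
      ultimately show ?thesis
        by (simp add: integral_mult_right)
    qed
    ultimately show ?thesis by blast
  qed
  then have "(\<lambda>x. dd f x v) differentiable (at x) \<and>
      (\<forall>a w. dd (\<lambda>x. dd f x v) x (a *s w) = a * dd (\<lambda>x. dd f x v) x w)" if x: "x \<in> U" for x
  proof -
    obtain D where D: "((\<lambda>x. dd f x v) has_derivative D) (at x)" "\<forall>a w. D (a *s w) = a * D w"
      using ex[OF x] by blast
    show ?thesis
      unfolding dd_eqI[OF D(1)] using differentiableI[OF D(1)] D(2) by (rule conjI)
  qed
  then show ?thesis
    unfolding cdiff_on_def by (rule ballI)
qed

lemma cdiff_on_smooth:
  assumes "open U" "cdiff_on U f"
  shows "smooth_on U f"
proof -
  have "Ck_on k U f" if "cdiff_on U f" for k f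
    using that
  proof (induction k arbitrary: f)
    case 0
    then show ?case
      by (simp add: cdiff_on_continuous)
  next
    case (Suc k)
    have "Ck_on k U (\<lambda>x. dd f x v)" for v
      by (rule Suc.IH[OF cdiff_on_dd[OF assms(1) Suc.prems]])
    moreover have "\<forall>x\<in>U. f differentiable (at x)"
      using cdiff_onD(1)[OF Suc.prems] by (rule ballI)
    ultimately show ?case
      unfolding Ck_on.simps by (intro conjI allI)
  qed
  then show ?thesis
    unfolding smooth_on_def using assms(2) by (intro allI)
qed

lemma dd_vec_nth:
  assumes "f differentiable (at x)"
  shows "((\<lambda>y. f y $ j) has_derivative (\<lambda>h. dd f x h $ j)) (at x)"
  using bounded_linear.has_derivative[OF bounded_linear_vec_nth dd_has_derivative[OF assms]] .

lemma holomorphic_map_on_iff: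
  "holomorphic_map_on U F \<longleftrightarrow> open U \<and>
     (\<forall>x\<in>U. F differentiable (at x) \<and> (\<forall>a v. dd F x (a *s v) = a *s dd F x v))"
proof -
  have "(\<exists>D. (F has_derivative D) (at x) \<and> (\<forall>a v. D (a *s v) = a *s D v)) \<longleftrightarrow>
      F differentiable (at x) \<and> (\<forall>a v. dd F x (a *s v) = a *s dd F x v)" for x
  proof
    assume "\<exists>D. (F has_derivative D) (at x) \<and> (\<forall>a v. D (a *s v) = a *s D v)"
    then obtain D where D: "(F has_derivative D) (at x)" "\<forall>a v. D (a *s v) = a *s D v"
      by blast
    then show "F differentiable (at x) \<and> (\<forall>a v. dd F x (a *s v) = a *s dd F x v)"
      unfolding dd_eqI[OF D(1)] using differentiableI by blast
  next
    assume "F differentiable (at x) \<and> (\<forall>a v. dd F x (a *s v) = a *s dd F x v)"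
    then show "\<exists>D. (F has_derivative D) (at x) \<and> (\<forall>a v. D (a *s v) = a *s D v)"
      using dd_has_derivative by blast
  qed
  then show ?thesis
    unfolding holomorphic_map_on_def by simp
qed

lemma holomorphic_map_on_nth:
  assumes "holomorphic_map_on U F"
  shows "cdiff_on U (\<lambda>x. F x $ j)"
  unfolding cdiff_on_def
proof (intro ballI conjI allI)
  fix x assume "x \<in> U"
  then have F: "F differentiable (at x)" "\<And>a v. dd F x (a *s v) = a *s dd F x v"
    using assms by (auto simp: holomorphic_map_on_iff)
  show "(\<lambda>x. F x $ j) differentiable (at x)"
    using dd_vec_nth[OF F(1)] by (rule differentiableI)
  show "dd (\<lambda>x. F x $ j) x (a *s v) = a * dd (\<lambda>x. F x $ j) x v" for a v
    by (simp add: dd_eqI[OF dd_vec_nth[OF F(1)]] F(2))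
qed

lemma smooth_on_nth_imp:
  fixes F :: "'a::real_normed_vector \<Rightarrow> complex ^ 'n::finite"
  assumes "open U" "\<And>j. smooth_on U (\<lambda>x. F x $ j)"
  shows "smooth_on U F"
proof -
  have "Ck_on k U (\<lambda>x. \<Sum>j\<in>UNIV. (F x $ j) *s axis j 1)" for k
    using assms by (intro Ck_on_sum Ck_on_linear_comp[OF _ bounded_linear_smult_left]) (auto simp: smooth_on_def)
  then show ?thesis
    by (simp add: smooth_on_def basis_expansion)
qed

lemma holomorphic_map_on_smooth:
  assumes "holomorphic_map_on U F"
  shows "smooth_on U F"
  using assms holomorphic_map_on_nth[OF assms]
  by (intro smooth_on_nth_imp cdiff_on_smooth) (auto simp: holomorphic_map_on_def)

text \<open>
  Together with the complex linearity of \<open>dd F x\<close> this says that the second derivative of a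
  holomorphic map is complex bilinear.
\<close>

lemma holomorphic_map_on_dd:
  assumes "holomorphic_map_on U F"
  shows "holomorphic_map_on U (\<lambda>x. dd F x v)"
  unfolding holomorphic_map_on_iff
proof (intro conjI ballI allI)
  show U: "open U" using assms by (simp add: holomorphic_map_on_def)
  fix x assume x: "x \<in> U"
  show diff: "(\<lambda>x. dd F x v) differentiable (at x)"
    using smooth_on_differentiable[OF smooth_on_dd[OF holomorphic_map_on_smooth[OF assms]] x] .
  have F: "F differentiable (at y)" if "y \<in> U" for y
    using that assms by (simp add: holomorphic_map_on_iff)
  have c: "cdiff_on U (\<lambda>x. dd (\<lambda>y. F y $ j) x v)" for j
    by (intro cdiff_on_dd U holomorphic_map_on_nth assms)
  have j: "dd (\<lambda>y. dd F y v) x w $ j = dd (\<lambda>x. dd (\<lambda>y. F y $ j) x v) x w" for j w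
  proof -
    have "((\<lambda>y. dd (\<lambda>z. F z $ j) y v) has_derivative (\<lambda>h. dd (\<lambda>y. dd F y v) x h $ j)) (at x)"
      by (rule has_derivative_transform_within_open[OF dd_vec_nth[OF diff] U x])
        (simp add: dd_eqI[OF dd_vec_nth[OF F]])
    from dd_eqI[OF this] show ?thesis by simp
  qed
  show "dd (\<lambda>y. dd F y v) x (a *s w) = a *s dd (\<lambda>y. dd F y v) x w" for a w
  proof -
    have "dd (\<lambda>x. dd (\<lambda>y. F y $ i) x v) x (a *s w) = a * dd (\<lambda>x. dd (\<lambda>y. F y $ i) x v) x w" for i
      by (rule cdiff_onD(2)[OF c x])
    then show ?thesis
      unfolding vec_eq_iff vector_smult_component j by (rule allI)
  qed
qed

section \<open>Mixed derivatives as limits of differences\<close>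

text \<open>
  Iterated differences determine mixed derivatives by \<open>diff2_tendsto\<close> and \<open>diff3_tendsto\<close>; for
  polynomials they are computed by plain algebra.
\<close>

definition diff2 :: "('a::ab_group_add \<Rightarrow> 'b::ab_group_add) \<Rightarrow> 'a \<Rightarrow> 'a \<Rightarrow> 'a \<Rightarrow> 'b" where
  "diff2 f x a b = f (x + a + b) - f (x + a) - f (x + b) + f x"

definition diff3 :: "('a::ab_group_add \<Rightarrow> 'b::ab_group_add) \<Rightarrow> 'a \<Rightarrow> 'a \<Rightarrow> 'a \<Rightarrow> 'a \<Rightarrow> 'b" where
  "diff3 f x a b c = diff2 f (x + c) a b - diff2 f x a b"

lemma mvt_diff1:
  fixes f :: "'a::real_normed_vector \<Rightarrow> real"
  assumes "0 < t" and diff: "\<And>s. s \<in> {0..t} \<Longrightarrow> f differentiable (at (x + s *\<^sub>R a))"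
  shows "\<exists>s\<in>{0..t}. f (x + t *\<^sub>R a) - f x = t * dd f (x + s *\<^sub>R a) a"
proof -
  have "\<exists>s\<in>{0<..<t}. f (x + t *\<^sub>R a) - f (x + 0 *\<^sub>R a) = dd f (x + s *\<^sub>R a) ((t - 0) *\<^sub>R a)"
  proof (rule mvt_simple[OF \<open>0 < t\<close>, of "\<lambda>s. f (x + s *\<^sub>R a)" "\<lambda>s h. dd f (x + s *\<^sub>R a) (h *\<^sub>R a)"])
    fix s assume "0 \<le> s" "s \<le> t"
    then have "(f has_derivative dd f (x + s *\<^sub>R a)) (at (x + s *\<^sub>R a))"
      using diff by (intro dd_has_derivative) simp
    moreover have "((\<lambda>s. x + s *\<^sub>R a) has_derivative (\<lambda>h. h *\<^sub>R a)) (at s)"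
      by (auto intro!: derivative_eq_intros)
    ultimately have "((\<lambda>s. f (x + s *\<^sub>R a)) has_derivative (\<lambda>h. dd f (x + s *\<^sub>R a) (h *\<^sub>R a))) (at s)"
      using diff_chain_at[of "\<lambda>s. x + s *\<^sub>R a" "\<lambda>h. h *\<^sub>R a" s f] by (simp add: o_def)
    then show "((\<lambda>s. f (x + s *\<^sub>R a)) has_derivative (\<lambda>h. dd f (x + s *\<^sub>R a) (h *\<^sub>R a))) (at s within {0..t})"
      by (rule has_derivative_at_withinI)
  qed
  then obtain s where s: "s \<in> {0<..<t}" "f (x + t *\<^sub>R a) - f x = dd f (x + s *\<^sub>R a) (t *\<^sub>R a)"
    by auto
  moreover have "dd f (x + s *\<^sub>R a) (t *\<^sub>R a) = t * dd f (x + s *\<^sub>R a) a"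
    using linear_dd[OF diff, of s] s(1) by (simp add: linear_scale)
  ultimately show ?thesis
    by (intro bexI[of _ s]) auto
qed

lemma dd_shift_diff:
  fixes f :: "'a::real_normed_vector \<Rightarrow> real"
  assumes "f differentiable (at (y + w))" "f differentiable (at y)"
  shows "((\<lambda>y. f (y + w) - f y) has_derivative (\<lambda>h. dd f (y + w) h - dd f y h)) (at y)"
proof -
  have "((\<lambda>y. y + w) has_derivative (\<lambda>h. h)) (at y)"
    by (auto intro!: derivative_eq_intros)
  then have "((\<lambda>y. f (y + w)) has_derivative dd f (y + w)) (at y)"
    using diff_chain_at[of "\<lambda>y. y + w" "\<lambda>h. h" y f "dd f (y + w)"] assms(1)
    by (simp add: o_def dd_has_derivative)
  then show ?thesis
    using assms(2) by (intro has_derivative_diff dd_has_derivative)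
qed

text \<open>
  The mean value theorem is applied in the direction \<open>b\<close> to the difference in the direction
  \<open>a\<close>, and then in the direction \<open>a\<close> to the derivative in the direction \<open>b\<close>.
\<close>

lemma mvt_diff2:
  fixes f :: "'a::real_normed_vector \<Rightarrow> real"
  assumes "0 < t" "Ck_on 2 S f"
    and S: "\<And>s1 s2. s1 \<in> {0..t} \<Longrightarrow> s2 \<in> {0..t} \<Longrightarrow> x + s1 *\<^sub>R a + s2 *\<^sub>R b \<in> S"
  shows "\<exists>s1\<in>{0..t}. \<exists>s2\<in>{0..t}.
    diff2 f x (t *\<^sub>R a) (t *\<^sub>R b) = t\<^sup>2 * dd (\<lambda>y. dd f y b) (x + s1 *\<^sub>R a + s2 *\<^sub>R b) a"
proof -
  have C: "\<And>x. x \<in> S \<Longrightarrow> f differentiable (at x)"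
    "\<And>x. x \<in> S \<Longrightarrow> (\<lambda>y. dd f y b) differentiable (at x)"
    using assms(2) by (auto simp: numeral_2_eq_2)
  let ?g = "\<lambda>y. f (y + t *\<^sub>R a) - f y"
  have dg: "(?g has_derivative (\<lambda>h. dd f (x + s *\<^sub>R b + t *\<^sub>R a) h - dd f (x + s *\<^sub>R b) h)) (at (x + s *\<^sub>R b))"
    if "s \<in> {0..t}" for s
    using S[of t s] S[of 0 s] that \<open>0 < t\<close>
    by (intro dd_shift_diff C) (auto simp: algebra_simps)
  obtain s2 where s2: "s2 \<in> {0..t}" "?g (x + t *\<^sub>R b) - ?g x = t * dd ?g (x + s2 *\<^sub>R b) b"
    using mvt_diff1[OF \<open>0 < t\<close>, of ?g x b] dg unfolding differentiable_def by blast
  have "(\<lambda>y. dd f y b) differentiable (at (x + s2 *\<^sub>R b + s *\<^sub>R a))" if "s \<in> {0..t}" for s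
    using S[of s s2] s2(1) that by (intro C) (auto simp: algebra_simps)
  then obtain s1 where s1: "s1 \<in> {0..t}" 
    "dd f (x + s2 *\<^sub>R b + t *\<^sub>R a) b - dd f (x + s2 *\<^sub>R b) b = t * dd (\<lambda>y. dd f y b) (x + s2 *\<^sub>R b + s1 *\<^sub>R a) a"
    using mvt_diff1[OF \<open>0 < t\<close>, of "\<lambda>y. dd f y b" "x + s2 *\<^sub>R b" a] by blast
  have "diff2 f x (t *\<^sub>R a) (t *\<^sub>R b) = ?g (x + t *\<^sub>R b) - ?g x"
    by (simp add: diff2_def algebra_simps)
  also have "\<dots> = t * (t * dd (\<lambda>y. dd f y b) (x + s1 *\<^sub>R a + s2 *\<^sub>R b) a)"
    unfolding s2(2) dd_eqI[OF dg[OF s2(1)]] s1(2) by (simp add: add.commute add.left_commute)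
  finally show ?thesis
    using s1 s2 by (intro bexI[of _ s1] bexI[of _ s2]) (auto simp: power2_eq_square)
qed

lemma mvt_diff3:
  fixes f :: "'a::real_normed_vector \<Rightarrow> real"
  assumes "0 < t" "Ck_on 3 S f"
    and S: "\<And>s1 s2 s3. s1 \<in> {0..t} \<Longrightarrow> s2 \<in> {0..t} \<Longrightarrow> s3 \<in> {0..t} \<Longrightarrow>
              x + s1 *\<^sub>R a + s2 *\<^sub>R b + s3 *\<^sub>R c \<in> S"
  shows "\<exists>s1\<in>{0..t}. \<exists>s2\<in>{0..t}. \<exists>s3\<in>{0..t}.
    diff3 f x (t *\<^sub>R a) (t *\<^sub>R b) (t *\<^sub>R c) =
      t^3 * dd (\<lambda>y. dd (\<lambda>y. dd f y c) y b) (x + s1 *\<^sub>R a + s2 *\<^sub>R b + s3 *\<^sub>R c) a"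
proof -
  have C: "\<And>x. x \<in> S \<Longrightarrow> f differentiable (at x)" "Ck_on 2 S (\<lambda>y. dd f y c)"
    using assms(2) by (auto simp: numeral_3_eq_3 numeral_2_eq_2)
  let ?g = "\<lambda>y. diff2 f y (t *\<^sub>R a) (t *\<^sub>R b)"
  have dg: "(?g has_derivative (\<lambda>h. diff2 (\<lambda>y. dd f y h) (x + s *\<^sub>R c) (t *\<^sub>R a) (t *\<^sub>R b))) (at (x + s *\<^sub>R c))"
    if s: "s \<in> {0..t}" for s
  proof -
    have "((\<lambda>y. (f ((y + t *\<^sub>R b) + t *\<^sub>R a) - f (y + t *\<^sub>R b)) - (f (y + t *\<^sub>R a) - f y)) has_derivative
       (\<lambda>h. (dd f (x + s *\<^sub>R c + t *\<^sub>R b + t *\<^sub>R a) h - dd f (x + s *\<^sub>R c + t *\<^sub>R b) h)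
          - (dd f (x + s *\<^sub>R c + t *\<^sub>R a) h - dd f (x + s *\<^sub>R c) h))) (at (x + s *\<^sub>R c))"
    proof (intro has_derivative_diff)
      have sh: "((\<lambda>y. f (y + w)) has_derivative dd f (x + s *\<^sub>R c + w)) (at (x + s *\<^sub>R c))"
        if "x + s *\<^sub>R c + w \<in> S" for w
      proof -
        have "((\<lambda>y. y + w) has_derivative (\<lambda>h. h)) (at (x + s *\<^sub>R c))"
          by (auto intro!: derivative_eq_intros)
        then show ?thesis
          using diff_chain_at[of "\<lambda>y. y + w" "\<lambda>h. h" "x + s *\<^sub>R c" f "dd f (x + s *\<^sub>R c + w)"] that
          by (simp add: o_def dd_has_derivative C)
      qed
      show "((\<lambda>y. f (y + t *\<^sub>R b + t *\<^sub>R a)) has_derivative dd f (x + s *\<^sub>R c + t *\<^sub>R b + t *\<^sub>R a)) (at (x + s *\<^sub>R c))"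
        using sh[of "t *\<^sub>R b + t *\<^sub>R a"] S[of t t s] s \<open>0 < t\<close> by (simp add: algebra_simps)
      show "((\<lambda>y. f (y + t *\<^sub>R b)) has_derivative dd f (x + s *\<^sub>R c + t *\<^sub>R b)) (at (x + s *\<^sub>R c))"
        using sh[of "t *\<^sub>R b"] S[of 0 t s] s \<open>0 < t\<close> by (simp add: algebra_simps)
      show "((\<lambda>y. f (y + t *\<^sub>R a)) has_derivative dd f (x + s *\<^sub>R c + t *\<^sub>R a)) (at (x + s *\<^sub>R c))"
        using sh[of "t *\<^sub>R a"] S[of t 0 s] s \<open>0 < t\<close> by (simp add: algebra_simps)
      show "(f has_derivative dd f (x + s *\<^sub>R c)) (at (x + s *\<^sub>R c))"
        using sh[of 0] S[of 0 0 s] s \<open>0 < t\<close> by simp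
    qed
    then show ?thesis
      by (simp add: diff2_def algebra_simps)
  qed
  obtain s3 where s3: "s3 \<in> {0..t}" "?g (x + t *\<^sub>R c) - ?g x = t * dd ?g (x + s3 *\<^sub>R c) c"
    using mvt_diff1[OF \<open>0 < t\<close>, of ?g x c] dg unfolding differentiable_def by blast
  have "x + s3 *\<^sub>R c + s1 *\<^sub>R a + s2 *\<^sub>R b \<in> S" if "s1 \<in> {0..t}" "s2 \<in> {0..t}" for s1 s2
    using S[of s1 s2 s3] s3(1) that by (simp add: algebra_simps)
  then obtain s1 s2 where s12: "s1 \<in> {0..t}" "s2 \<in> {0..t}"
    "diff2 (\<lambda>y. dd f y c) (x + s3 *\<^sub>R c) (t *\<^sub>R a) (t *\<^sub>R b) =
       t\<^sup>2 * dd (\<lambda>y. dd (\<lambda>y. dd f y c) y b) (x + s3 *\<^sub>R c + s1 *\<^sub>R a + s2 *\<^sub>R b) a"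
    using mvt_diff2[OF \<open>0 < t\<close> C(2), of "x + s3 *\<^sub>R c" a b] by blast
  have "diff3 f x (t *\<^sub>R a) (t *\<^sub>R b) (t *\<^sub>R c) = 
    t * (t\<^sup>2 * dd (\<lambda>y. dd (\<lambda>y. dd f y c) y b) (x + s3 *\<^sub>R c + s1 *\<^sub>R a + s2 *\<^sub>R b) a)"
    unfolding diff3_def s3(2) dd_eqI[OF dg[OF s3(1)]] s12(3) by simp
  also have "x + s3 *\<^sub>R c + s1 *\<^sub>R a + s2 *\<^sub>R b = x + s1 *\<^sub>R a + s2 *\<^sub>R b + s3 *\<^sub>R c"
    by (simp add: algebra_simps)
  finally show ?thesis
    using s12 s3 by (intro bexI[of _ s1] bexI[of _ s2] bexI[of _ s3]) (auto simp: power2_eq_square power3_eq_cube)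
qed

text \<open>
  The values \<open>q t\<close> are attained by the continuous function \<open>h\<close> at points that move into \<open>x\<close>.
\<close>

lemma tendsto_from_mvt:
  fixes h :: "'a::real_normed_vector \<Rightarrow> real"
  assumes "open S" "x \<in> S" "isCont h x"
    and ex: "\<And>t. 0 < t \<Longrightarrow> cball x (t * K) \<subseteq> S \<Longrightarrow> \<exists>y\<in>cball x (t * K). q t = h y"
  shows "(q \<longlongrightarrow> h x) (at_right 0)"
proof (rule tendstoI)
  fix e :: real assume "0 < e"
  obtain d1 where d1: "0 < d1" "\<And>y. dist y x < d1 \<Longrightarrow> dist (h y) (h x) < e"
    using assms(3) \<open>0 < e\<close> unfolding continuous_at_eps_delta by blast
  obtain d2 where d2: "0 < d2" "ball x d2 \<subseteq> S"
    using assms(1,2) open_contains_ball by blast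
  define d where "d = min d1 d2 / (\<bar>K\<bar> + 1)"
  have "0 < d" using d1 d2 by (simp add: d_def)
  have "dist (q t) (h x) < e" if t: "0 < t" "t < d" for t
  proof -
    have "t * K \<le> t * (\<bar>K\<bar> + 1)"
      using t by (intro mult_left_mono) auto
    also have "\<dots> < min d1 d2"
      using t(2) by (simp add: d_def pos_less_divide_eq)
    finally have tK: "t * K < d1" "t * K < d2" by auto
    then have "cball x (t * K) \<subseteq> S"
      using d2(2) by (auto simp: subset_iff)
    from ex[OF t(1) this] obtain y where y: "y \<in> cball x (t * K)" "q t = h y"
      by blast
    then show ?thesis
      using d1(2)[of y] tK(1) by (simp add: dist_commute)
  qed
  then show "\<forall>\<^sub>F t in at_right 0. dist (q t) (h x) < e"
    using \<open>0 < d\<close> unfolding eventually_at_right_field by blast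
qed

lemma diff2_tendsto:
  fixes f :: "'a::real_normed_vector \<Rightarrow> real"
  assumes "open S" "x \<in> S" "Ck_on 2 S f"
  shows "((\<lambda>t. diff2 f x (t *\<^sub>R a) (t *\<^sub>R b) / t\<^sup>2) \<longlongrightarrow> dd (\<lambda>y. dd f y b) x a) (at_right 0)"
proof (rule tendsto_from_mvt[OF assms(1,2), where K = "norm a + norm b"])
  show "isCont (\<lambda>y. dd (\<lambda>y. dd f y b) y a) x"
    using assms by (auto simp: numeral_2_eq_2 continuous_on_eq_continuous_at)
  fix t :: real assume t: "0 < t" and sub: "cball x (t * (norm a + norm b)) \<subseteq> S"
  have cb: "x + s1 *\<^sub>R a + s2 *\<^sub>R b \<in> cball x (t * (norm a + norm b))"
    if "s1 \<in> {0..t}" "s2 \<in> {0..t}" for s1 s2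
  proof -
    have "norm (s1 *\<^sub>R a + s2 *\<^sub>R b) \<le> norm (s1 *\<^sub>R a) + norm (s2 *\<^sub>R b)"
      by (rule norm_triangle_ineq)
    also have "\<dots> \<le> t * norm a + t * norm b"
      using that by (intro add_mono) (auto intro: mult_right_mono)
    also have "s1 *\<^sub>R a + s2 *\<^sub>R b = (x + s1 *\<^sub>R a + s2 *\<^sub>R b) - x"
      by simp
    finally show ?thesis
      unfolding mem_cball dist_commute[of x] by (simp only: dist_norm distrib_left)
  qed
  obtain s1 s2 where "s1 \<in> {0..t}" "s2 \<in> {0..t}"
     "diff2 f x (t *\<^sub>R a) (t *\<^sub>R b) = t\<^sup>2 * dd (\<lambda>y. dd f y b) (x + s1 *\<^sub>R a + s2 *\<^sub>R b) a"
    using mvt_diff2[OF t assms(3), of x a b] cb sub by blast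
  then show "\<exists>y\<in>cball x (t * (norm a + norm b)).
      diff2 f x (t *\<^sub>R a) (t *\<^sub>R b) / t\<^sup>2 = dd (\<lambda>y. dd f y b) y a"
    using cb t by (intro bexI[of _ "x + s1 *\<^sub>R a + s2 *\<^sub>R b"]) auto
qed

lemma diff3_tendsto:
  fixes f :: "'a::real_normed_vector \<Rightarrow> real"
  assumes "open S" "x \<in> S" "Ck_on 3 S f"
  shows "((\<lambda>t. diff3 f x (t *\<^sub>R a) (t *\<^sub>R b) (t *\<^sub>R c) / t^3)
     \<longlongrightarrow> dd (\<lambda>y. dd (\<lambda>y. dd f y c) y b) x a) (at_right 0)"
proof (rule tendsto_from_mvt[OF assms(1,2), where K = "norm a + norm b + norm c"])
  show "isCont (\<lambda>y. dd (\<lambda>y. dd (\<lambda>y. dd f y c) y b) y a) x"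
    using assms by (auto simp: numeral_3_eq_3 continuous_on_eq_continuous_at)
  fix t :: real assume t: "0 < t" and sub: "cball x (t * (norm a + norm b + norm c)) \<subseteq> S"
  have cb: "x + s1 *\<^sub>R a + s2 *\<^sub>R b + s3 *\<^sub>R c \<in> cball x (t * (norm a + norm b + norm c))"
    if "s1 \<in> {0..t}" "s2 \<in> {0..t}" "s3 \<in> {0..t}" for s1 s2 s3
  proof -
    have "norm (s1 *\<^sub>R a + s2 *\<^sub>R b + s3 *\<^sub>R c) \<le> norm (s1 *\<^sub>R a) + norm (s2 *\<^sub>R b) + norm (s3 *\<^sub>R c)"
      by (intro norm_triangle_le add_mono norm_triangle_ineq order_refl)
    also have "\<dots> \<le> t * norm a + t * norm b + t * norm c"
      using that by (intro add_mono) (auto intro: mult_right_mono)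
    also have "s1 *\<^sub>R a + s2 *\<^sub>R b + s3 *\<^sub>R c = (x + s1 *\<^sub>R a + s2 *\<^sub>R b + s3 *\<^sub>R c) - x"
      by simp
    finally show ?thesis
      unfolding mem_cball dist_commute[of x] by (simp only: dist_norm distrib_left)
  qed
  obtain s1 s2 s3 where "s1 \<in> {0..t}" "s2 \<in> {0..t}" "s3 \<in> {0..t}"
     "diff3 f x (t *\<^sub>R a) (t *\<^sub>R b) (t *\<^sub>R c) =
        t^3 * dd (\<lambda>y. dd (\<lambda>y. dd f y c) y b) (x + s1 *\<^sub>R a + s2 *\<^sub>R b + s3 *\<^sub>R c) a"
    using mvt_diff3[OF t assms(3), of x a b c] cb sub by blast
  then show "\<exists>y\<in>cball x (t * (norm a + norm b + norm c)).
      diff3 f x (t *\<^sub>R a) (t *\<^sub>R b) (t *\<^sub>R c) / t^3 = dd (\<lambda>y. dd (\<lambda>y. dd f y c) y b) y a"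
    using cb t by (intro bexI[of _ "x + s1 *\<^sub>R a + s2 *\<^sub>R b + s3 *\<^sub>R c"]) auto
qed

definition hess :: "('a::real_normed_vector \<Rightarrow> real) \<Rightarrow> 'a \<Rightarrow> 'a \<Rightarrow> 'a \<Rightarrow> real" where
  "hess f x a b = dd (\<lambda>y. dd f y a) x b"

text \<open>
  Second differences are symmetric in the two increments, so their limits are.
\<close>

lemma hess_commute:
  assumes "open S" "x \<in> S" "Ck_on 2 S f"
  shows "hess f x a b = hess f x b a"
proof -
  have "((\<lambda>t. diff2 f x (t *\<^sub>R a) (t *\<^sub>R b) / t\<^sup>2) \<longlongrightarrow> hess f x b a) (at_right 0)"
    unfolding hess_def by (rule diff2_tendsto[OF assms])
  moreover have "((\<lambda>t. diff2 f x (t *\<^sub>R b) (t *\<^sub>R a) / t\<^sup>2) \<longlongrightarrow> hess f x a b) (at_right 0)"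
    unfolding hess_def by (rule diff2_tendsto[OF assms])
  moreover have "diff2 f x (t *\<^sub>R b) (t *\<^sub>R a) = diff2 f x (t *\<^sub>R a) (t *\<^sub>R b)" for t
    by (simp add: diff2_def algebra_simps)
  ultimately show ?thesis
    using tendsto_unique[of "at_right (0::real)"] by (simp add: trivial_limit_at_right_real)
qed

lemma linear_hess:
  assumes "open S" "x \<in> S" "Ck_on 2 S f"
  shows "linear (hess f x a)" and "linear (\<lambda>a. hess f x a b)"
proof -
  show *: "linear (hess f x a)" for a
    unfolding hess_def using assms by (intro linear_dd) (auto simp: numeral_2_eq_2)
  then show "linear (\<lambda>a. hess f x a b)"
    by (subst hess_commute[OF assms])
qed

section \<open>Minima on a level set\<close>

text \<open>
  Near \<open>p + t X\<close> there are zeros of \<open>r\<close>: the values of \<open>r\<close> at \<open>p + t (X \<plusminus> \<epsilon> n)\<close> have opposite signs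
  for a direction \<open>n\<close> transversal to the level set. If \<open>g' X\<close> were negative, \<open>g\<close> would be
  negative at such a zero for small \<open>\<epsilon>\<close> and \<open>t\<close>.
\<close>

lemma tangential_minimum:
  fixes r g :: "'a::real_normed_vector \<Rightarrow> real"
  assumes V: "open V" "p \<in> V" and r: "r p = 0" "continuous_on V r" "(r has_derivative r') (at p)"
    and n: "r' n \<noteq> 0" and X: "r' X = 0"
    and g: "(g has_derivative g') (at p)" "g p = 0" "\<And>x. x \<in> V \<Longrightarrow> r x = 0 \<Longrightarrow> 0 \<le> g x"
  shows "0 \<le> g' X"
proof (rule ccontr)
  assume neg: "\<not> 0 \<le> g' X"
  define d where "d = - g' X"
  have "0 < d" using neg by (simp add: d_def)
  \<comment> \<open>The size of \<open>\<epsilon>\<close> makes \<open>g' (X + s n) \<le> - d / 2\<close> for \<open>\<bar>s\<bar> \<le> \<epsilon>\<close>.\<close>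
  define \<epsilon> where "\<epsilon> = d / (2 * (\<bar>g' n\<bar> + 1))"
  have "0 < \<epsilon>" using \<open>0 < d\<close> by (simp add: \<epsilon>_def)
  \<comment> \<open>The points considered have distance at most \<open>t * R\<close> from \<open>p\<close>; the error terms of \<open>g\<close> and \<open>r\<close>
    are made small against \<open>t * d\<close> and \<open>t * \<epsilon> * \<bar>r' n\<bar>\<close>.\<close>
  define R where "R = norm X + \<epsilon> * norm n + 1"
  have "0 < R" using \<open>0 < \<epsilon>\<close> by (simp add: R_def add_nonneg_pos)
  have lin: "linear r'" "linear g'"
    using r(3) g(1) by (auto intro: has_derivative_linear)
  obtain d1 where d1: "0 < d1"
    "\<And>y. norm (y - p) < d1 \<Longrightarrow> norm (g y - g p - g' (y - p)) \<le> d / (4 * R) * norm (y - p)"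
    using g(1) \<open>0 < d\<close> \<open>0 < R\<close> unfolding has_derivative_at_alt
    by (metis divide_pos_pos mult_pos_pos zero_less_numeral)
  have "0 < \<epsilon> * \<bar>r' n\<bar> / (2 * R)"
    using \<open>0 < \<epsilon>\<close> \<open>0 < R\<close> n by simp
  then obtain d2 where d2: "0 < d2"
    "\<And>y. norm (y - p) < d2 \<Longrightarrow> norm (r y - r p - r' (y - p)) \<le> \<epsilon> * \<bar>r' n\<bar> / (2 * R) * norm (y - p)"
    using r(3) unfolding has_derivative_at_alt by blast
  obtain d3 where d3: "0 < d3" "ball p d3 \<subseteq> V"
    using V open_contains_ball by blast
  define t where "t = min d1 (min d2 d3) / (2 * R)"
  have t: "0 < t" using d1 d2 d3 \<open>0 < R\<close> by (simp add: t_def)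
  have "t * R = min d1 (min d2 d3) / 2"
    using \<open>0 < R\<close> by (simp add: t_def)
  moreover have "0 < min d1 (min d2 d3)"
    using d1(1) d2(1) d3(1) by simp
  ultimately have "t * R < min d1 (min d2 d3)"
    by linarith
  then have tR: "t * R < d1" "t * R < d2" "t * R < d3" by auto
  define y where "y s = p + t *\<^sub>R (X + s *\<^sub>R n)" for s
  have ny: "norm (y s - p) \<le> t * R" if "s \<in> {-\<epsilon>..\<epsilon>}" for s
  proof -
    have "\<bar>s\<bar> * norm n \<le> \<epsilon> * norm n"
      using that by (intro mult_right_mono) auto
    then have "norm (X + s *\<^sub>R n) \<le> R"
      using norm_triangle_ineq[of X "s *\<^sub>R n"] by (simp add: R_def)
    then show ?thesis
      using t by (simp add: y_def)
  qed
  have r'y: "r' (y s - p) = t * s * r' n" and g'y: "g' (y s - p) = t * (- d + s * g' n)" for s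
    by (simp_all add: y_def linear_scale[OF lin(1)] linear_add[OF lin(1)]
        linear_scale[OF lin(2)] linear_add[OF lin(2)] X d_def)
  have ry: "\<bar>r (y s) - t * s * r' n\<bar> \<le> t * \<epsilon> * \<bar>r' n\<bar> / 2" if "s \<in> {-\<epsilon>..\<epsilon>}" for s
  proof -
    have "\<bar>r (y s) - t * s * r' n\<bar> \<le> \<epsilon> * \<bar>r' n\<bar> / (2 * R) * norm (y s - p)"
      using d2(2)[of "y s"] ny[OF that] tR(2) by (simp add: r(1) r'y)
    also have "\<dots> \<le> \<epsilon> * \<bar>r' n\<bar> / (2 * R) * (t * R)"
      using ny[OF that] \<open>0 < \<epsilon>\<close> \<open>0 < R\<close> by (intro mult_left_mono) auto
    finally show ?thesis
      using \<open>0 < R\<close> by (simp add: field_simps)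
  qed
  have yV: "y s \<in> V" if "s \<in> {-\<epsilon>..\<epsilon>}" for s
    using ny[OF that] tR(3) d3(2) by (auto simp: dist_norm norm_minus_commute)
  have cont: "continuous_on {-\<epsilon>..\<epsilon>} (\<lambda>s. r (y s))"
    by (rule continuous_on_compose2[OF r(2)]) (auto simp: y_def intro!: continuous_intros yV[unfolded y_def])
  define A where "A = t * \<epsilon> * r' n"
  have "\<bar>r (y \<epsilon>) - A\<bar> \<le> \<bar>A\<bar> / 2" "\<bar>r (y (-\<epsilon>)) + A\<bar> \<le> \<bar>A\<bar> / 2"
    using ry[of \<epsilon>] ry[of "-\<epsilon>"] \<open>0 < \<epsilon>\<close> t by (simp_all add: A_def abs_mult)
  then have "(r (y (-\<epsilon>)) \<le> 0 \<and> 0 \<le> r (y \<epsilon>)) \<or> (r (y \<epsilon>) \<le> 0 \<and> 0 \<le> r (y (-\<epsilon>)))"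
    by linarith
  then have "\<exists>s\<ge>-\<epsilon>. s \<le> \<epsilon> \<and> r (y s) = 0"
    using IVT'[OF _ _ _ cont, of 0] IVT2'[OF _ _ _ cont, of 0] \<open>0 < \<epsilon>\<close> by auto
  then obtain s where s: "s \<in> {-\<epsilon>..\<epsilon>}" "r (y s) = 0"
    by auto
  have "s * g' n \<le> \<bar>s\<bar> * \<bar>g' n\<bar>"
    by (metis abs_ge_self abs_mult)
  also have "\<dots> \<le> \<epsilon> * \<bar>g' n\<bar>"
    using s(1) by (intro mult_right_mono) auto
  also have "\<dots> \<le> d / 2"
    using \<open>0 < d\<close> by (simp add: \<epsilon>_def field_simps)
  finally have "g' (y s - p) \<le> t * (- d / 2)"
    unfolding g'y using t by (intro mult_left_mono) auto
  moreover have "\<bar>g (y s) - g' (y s - p)\<bar> \<le> d / (4 * R) * (t * R)"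
  proof -
    have "\<bar>g (y s) - g' (y s - p)\<bar> \<le> d / (4 * R) * norm (y s - p)"
      using d1(2)[of "y s"] ny[OF s(1)] tR(1) by (simp add: g(2))
    also have "\<dots> \<le> d / (4 * R) * (t * R)"
      using ny[OF s(1)] \<open>0 < d\<close> \<open>0 < R\<close> by (intro mult_left_mono) auto
    finally show ?thesis .
  qed
  moreover have "d / (4 * R) * (t * R) = t * d / 4"
    using \<open>0 < R\<close> by simp
  moreover have "0 < t * d" using t \<open>0 < d\<close> by simp
  ultimately have "g (y s) < 0"
    by (simp add: abs_le_iff)
  then show False
    using g(3)[OF yV[OF s(1)] s(2)] by simp
qed

lemma tangential_critical:
  fixes r g :: "'a::real_normed_vector \<Rightarrow> real"
  assumes "open V" "p \<in> V" "r p = 0" "continuous_on V r" "(r has_derivative r') (at p)"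
    "r' n \<noteq> 0" "r' X = 0"
    "(g has_derivative g') (at p)" "g p = 0" "\<And>x. x \<in> V \<Longrightarrow> r x = 0 \<Longrightarrow> 0 \<le> g x"
  shows "g' X = 0"
proof -
  have "r' (- X) = 0" "g' (- X) = - g' X"
    using assms(5,7,8) by (auto dest!: has_derivative_linear simp: linear_neg)
  then show ?thesis
    using tangential_minimum[OF assms] tangential_minimum[OF assms(1-6), of "-X" g g'] assms(8-10)
    by fastforce
qed

section \<open>The Levi Hessian of a function\<close>

lemma bounded_linear_smult: "bounded_linear (\<lambda>v :: complex ^ 'n::finite. c *s v)"
proof -
  have "linear (\<lambda>v :: complex ^ 'n. c *s v)"
    by (rule linearI) (simp_all add: vec_eq_iff distrib_left)
  then show ?thesis
    by (simp add: linear_conv_bounded_linear)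
qed

lemma i_smult_i [simp]: "\<i> *s (\<i> *s v) = - (v :: complex ^ 'n)"
  by (simp add: vec_eq_iff)

lemma smult_decompose: "c *s v = Re c *\<^sub>R v + Im c *\<^sub>R (\<i> *s (v :: complex ^ 'n))"
  by (simp add: vec_eq_iff complex_eq_iff)

text \<open>
  The complex Hessian as a real symmetric form: in terms of the mixed derivatives of \<open>r\<close> it is
  \<open>4 Re (\<Sum> r\<^sub>j\<^sub>k a\<^sub>j cnj b\<^sub>k)\<close>. The imaginary part of the Hermitian form is \<open>lev r x a (\<i> *s b)\<close>.
\<close>

definition lev :: "(complex ^ 'n::finite \<Rightarrow> real) \<Rightarrow> complex ^ 'n \<Rightarrow> complex ^ 'n \<Rightarrow> complex ^ 'n \<Rightarrow> real" where
  "lev r x a b = hess r x a b + hess r x (\<i> *s a) (\<i> *s b)"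

locale smooth_function =
  fixes U :: "(complex ^ 'n::finite) set" and r :: "complex ^ 'n \<Rightarrow> real"
  assumes open_domain: "open U" and smooth: "smooth_on U r"
begin

lemma has_derivative_r: "x \<in> U \<Longrightarrow> (r has_derivative dd r x) (at x)"
  by (rule dd_has_derivative[OF smooth_on_differentiable[OF smooth]])

lemma linear_dr: "x \<in> U \<Longrightarrow> linear (dd r x)"
  by (rule linear_dd[OF smooth_on_differentiable[OF smooth]])

lemmas dr_linear_simps = linear_add[OF linear_dr] linear_diff[OF linear_dr]
  linear_scale[OF linear_dr] linear_neg[OF linear_dr] linear_0[OF linear_dr]

lemma hess_sym: "x \<in> U \<Longrightarrow> hess r x a b = hess r x b a"
  by (rule hess_commute[OF open_domain _ smooth_onD[OF smooth]])

lemma linear_hess_right: "x \<in> U \<Longrightarrow> linear (hess r x a)"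
  by (rule linear_hess[OF open_domain _ smooth_onD[OF smooth]])

lemma linear_hess_left: "x \<in> U \<Longrightarrow> linear (\<lambda>a. hess r x a b)"
  by (rule linear_hess[OF open_domain _ smooth_onD[OF smooth]])

lemmas hess_linear_simps =
  linear_add[OF linear_hess_right] linear_diff[OF linear_hess_right]
  linear_scale[OF linear_hess_right] linear_neg[OF linear_hess_right] linear_0[OF linear_hess_right]
  linear_add[OF linear_hess_left] linear_diff[OF linear_hess_left]
  linear_scale[OF linear_hess_left] linear_neg[OF linear_hess_left] linear_0[OF linear_hess_left]

lemma lev_sym: "x \<in> U \<Longrightarrow> lev r x a b = lev r x b a"
  by (simp add: lev_def hess_sym)

lemma lev_linear_simps:
  assumes "x \<in> U"
  shows "lev r x (a + a') b = lev r x a b + lev r x a' b" "lev r x (a - a') b = lev r x a b - lev r x a' b"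
    "lev r x (- a) b = - lev r x a b" "lev r x (c *\<^sub>R a) b = c * lev r x a b"
    "lev r x a (b + b') = lev r x a b + lev r x a b'" "lev r x a (b - b') = lev r x a b - lev r x a b'"
    "lev r x a (- b) = - lev r x a b" "lev r x a (c *\<^sub>R b) = c * lev r x a b"
proof -
  note J = bounded_linear.linear[OF bounded_linear_smult[of \<i>]]
  note simps = lev_def linear_add[OF J] linear_diff[OF J] linear_neg[OF J] linear_scale[OF J]
    hess_linear_simps[OF assms] real_scaleR_def algebra_simps
  show "lev r x (a + a') b = lev r x a b + lev r x a' b" "lev r x (a - a') b = lev r x a b - lev r x a' b"
    "lev r x (- a) b = - lev r x a b" "lev r x (c *\<^sub>R a) b = c * lev r x a b"
    "lev r x a (b + b') = lev r x a b + lev r x a b'" "lev r x a (b - b') = lev r x a b - lev r x a b'"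
    "lev r x a (- b) = - lev r x a b" "lev r x a (c *\<^sub>R b) = c * lev r x a b"
    by (simp_all only: simps)
qed

lemma lev_i_i: "x \<in> U \<Longrightarrow> lev r x (\<i> *s a) (\<i> *s b) = lev r x a b"
  by (simp add: lev_def hess_linear_simps)

lemma has_derivative_dr_field:
  assumes "x \<in> U" "(W has_derivative W') (at x)"
  shows "((\<lambda>y. dd r y (W y)) has_derivative (\<lambda>h. hess r x (W x) h + dd r x (W' h))) (at x)"
  unfolding hess_def
  by (rule has_derivative_linear_family[OF open_domain assms(1) linear_dr _ assms(2)])
    (use smooth_on_differentiable[OF smooth_on_dd[OF smooth] assms(1)] in auto)

lemma differentiable_hess: "x \<in> U \<Longrightarrow> (\<lambda>y. hess r y a b) differentiable (at x)"
  unfolding hess_def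
  by (rule smooth_on_differentiable[OF smooth_on_dd[OF smooth_on_dd[OF smooth]]])

lemma differentiable_hess_field:
  assumes x: "x \<in> U" and A: "A differentiable (at x)" and B: "B differentiable (at x)"
  shows "(\<lambda>y. hess r y (A y) (B y)) differentiable (at x)"
proof -
  note d = differentiable_hess[OF x]
  have "(\<lambda>y. hess r y (A y) b) differentiable (at x)" for b
    by (rule differentiableI[OF has_derivative_linear_family[OF open_domain x linear_hess_left d dd_has_derivative[OF A]]])
  from differentiableI[OF has_derivative_linear_family[OF open_domain x linear_hess_right this dd_has_derivative[OF B]]]
  show ?thesis .
qed

lemma differentiable_lev_field:
  assumes "x \<in> U" "A differentiable (at x)" "B differentiable (at x)"
  shows "(\<lambda>y. lev r y (A y) (B y)) differentiable (at x)"
proof -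
  have "(\<lambda>y. \<i> *s A y) differentiable (at x)" "(\<lambda>y. \<i> *s B y) differentiable (at x)"
    using assms(2,3) by (auto intro: differentiableI bounded_linear.has_derivative[OF bounded_linear_smult] dd_has_derivative)
  then show ?thesis
    unfolding lev_def using assms by (intro differentiable_add differentiable_hess_field)
qed

lemma dd_hess_field:
  assumes x: "x \<in> U" and A: "A differentiable (at x)"
  shows "((\<lambda>y. hess r y (A y) (A y)) has_derivative
    (\<lambda>h. dd (\<lambda>y. hess r y (A x) (A x)) x h + 2 * hess r x (A x) (dd A x h))) (at x)"
proof -
  note d = differentiable_hess[OF x]
  have D1: "((\<lambda>y. hess r y (A y) b) has_derivative
      (\<lambda>h. dd (\<lambda>y. hess r y (A x) b) x h + hess r x (dd A x h) b)) (at x)" for b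
    by (rule has_derivative_linear_family[OF open_domain x linear_hess_left d dd_has_derivative[OF A]])
  have D2: "((\<lambda>y. hess r y (A y) (A y)) has_derivative
      (\<lambda>h. dd (\<lambda>y. hess r y (A y) (A x)) x h + hess r x (A x) (dd A x h))) (at x)"
    by (rule has_derivative_linear_family[OF open_domain x linear_hess_right differentiableI[OF D1] dd_has_derivative[OF A]])
  show ?thesis
    using D2 unfolding dd_eqI[OF D1] by (simp add: hess_sym[OF x, of _ "A x"] algebra_simps)
qed

lemma dd_lev_constant:
  assumes x: "x \<in> U"
  shows "((\<lambda>y. lev r y a a) has_derivative
    (\<lambda>h. dd (\<lambda>y. hess r y a a) x h + dd (\<lambda>y. hess r y (\<i> *s a) (\<i> *s a)) x h)) (at x)"
proof -
  note d = differentiable_hess[OF x]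
  show ?thesis
    unfolding lev_def by (intro has_derivative_add dd_has_derivative d)
qed

text \<open>
  Differentiating the two arguments \<open>A y\<close> contributes terms \<open>lev r x (A x) (A' h)\<close>, which vanish
  when \<open>A x\<close> is a null vector.
\<close>

lemma dd_lev_field:
  assumes x: "x \<in> U" and A: "A differentiable (at x)" and null: "\<And>b. lev r x (A x) b = 0"
  shows "dd (\<lambda>y. lev r y (A y) (A y)) x h = dd (\<lambda>y. lev r y (A x) (A x)) x h"
proof -
  have D: "((\<lambda>y. \<i> *s A y) has_derivative (\<lambda>h. \<i> *s dd A x h)) (at x)"
    by (rule bounded_linear.has_derivative[OF bounded_linear_smult dd_has_derivative[OF A]])
  note D2 = has_derivative_add[OF dd_hess_field[OF x A] dd_hess_field[OF x differentiableI[OF D]]]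
  have "dd (\<lambda>y. lev r y (A y) (A y)) x h = dd (\<lambda>y. lev r y (A x) (A x)) x h + 2 * lev r x (A x) (dd A x h)"
    unfolding dd_eqI[OF dd_lev_constant[OF x]] unfolding lev_def dd_eqI[OF D2] dd_eqI[OF D] by simp
  then show ?thesis using null by simp
qed

text \<open>
  The complex linear functional \<open>v \<mapsto> dr v - \<i> dr (\<i> v)\<close> has the complex tangent space as its
  kernel. Subtracting from \<open>a\<close> the multiple of \<open>n\<close> with the same value of the functional gives a
  smooth field in the kernel.
\<close>

lemma holomorphic_tangent_field:
  assumes p: "p \<in> U" and n: "dd r p n \<noteq> 0" and a: "dd r p a = 0" "dd r p (\<i> *s a) = 0"
  shows "\<exists>V A. open V \<and> p \<in> V \<and> V \<subseteq> U \<and> smooth_on V A \<and> A p = a \<and>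
    (\<forall>x\<in>V. dd r x (A x) = 0 \<and> dd r x (\<i> *s A x) = 0)"
proof -
  \<comment> \<open>Twice the differential \<open>\<partial>r\<close>, which is complex linear in \<open>v\<close>.\<close>
  define \<delta> where "\<delta> x v = Complex (dd r x v) (- dd r x (\<i> *s v))" for x v
  define V where "V = U \<inter> (\<lambda>x. dd r x n) -` (- {0})"
  have "open V"
    unfolding V_def
    by (rule continuous_open_preimage[OF smooth_on_continuous[OF smooth_on_dd[OF smooth]] open_domain]) auto
  have pV: "p \<in> V" and VU: "V \<subseteq> U" using p n by (auto simp: V_def)
  have lin: "\<delta> x (c *s v) = c * \<delta> x v" "\<delta> x (v - w) = \<delta> x v - \<delta> x w" if "x \<in> V" for x c v w
  proof -
    have x: "x \<in> U" using that VU by auto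
    note J = bounded_linear.linear[OF bounded_linear_smult[of \<i>]]
    show "\<delta> x (c *s v) = c * \<delta> x v"
      unfolding smult_decompose[of c]
      by (simp add: \<delta>_def complex_eq_iff dr_linear_simps[OF x] linear_add[OF J] linear_scale[OF J])
    show "\<delta> x (v - w) = \<delta> x v - \<delta> x w"
      by (simp add: \<delta>_def complex_eq_iff dr_linear_simps[OF x] linear_diff[OF J])
  qed
  have n0: "\<delta> x n \<noteq> 0" if "x \<in> V" for x
    using that by (auto simp: V_def \<delta>_def complex_eq_iff)
  have smooth_\<delta>: "Ck_on k V (\<lambda>x. \<delta> x v)" for k v
  proof -
    have "Ck_on k V (\<lambda>x. dd r x w)" for w
      by (rule smooth_onD[OF smooth_on_subset[OF smooth_on_dd[OF smooth] VU]])
    then have "Ck_on k V (\<lambda>x. dd r x v *\<^sub>R 1 + dd r x (\<i> *s v) *\<^sub>R (- \<i>))"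
      by (intro Ck_on_add Ck_on_scaleR Ck_on_const \<open>open V\<close>)
    also have "(\<lambda>x. dd r x v *\<^sub>R 1 + dd r x (\<i> *s v) *\<^sub>R (- \<i>)) = (\<lambda>x. \<delta> x v)"
      by (auto simp: \<delta>_def complex_eq_iff)
    finally show ?thesis .
  qed
  define A where "A x = a + (- 1 * \<delta> x a * inverse (\<delta> x n)) *s n" for x
  have A: "A x = a - (\<delta> x a * inverse (\<delta> x n)) *s n" for x
    by (simp add: A_def)
  have "Ck_on k V A" for k
    unfolding A_def
    by (intro Ck_on_add Ck_on_const \<open>open V\<close> Ck_on_linear_comp[OF _ bounded_linear_smult_left] Ck_on_mult
        smooth_\<delta> Ck_on_inverse n0)
  then have smA: "smooth_on V A" by (simp add: smooth_on_def)
  have Ap: "A p = a"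
    using a by (simp add: A \<delta>_def Complex_eq_0)
  have "\<delta> x (A x) = 0" if "x \<in> V" for x
    using n0[OF that] by (simp add: A lin[OF that])
  then have "\<forall>x\<in>V. dd r x (A x) = 0 \<and> dd r x (\<i> *s A x) = 0"
    by (auto simp: \<delta>_def Complex_eq_0)
  then show ?thesis
    using \<open>open V\<close> pV VU smA Ap by blast
qed

lemma tangent_field:
  assumes p: "p \<in> U" and n: "dd r p n \<noteq> 0" and a: "dd r p a = 0"
  shows "\<exists>V A. open V \<and> p \<in> V \<and> V \<subseteq> U \<and> smooth_on V A \<and> A p = a \<and> (\<forall>x\<in>V. dd r x (A x) = 0)"
proof -
  define V where "V = U \<inter> (\<lambda>x. dd r x n) -` (- {0})"
  have "open V"
    unfolding V_def
    by (rule continuous_open_preimage[OF smooth_on_continuous[OF smooth_on_dd[OF smooth]] open_domain]) auto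
  have pV: "p \<in> V" and VU: "V \<subseteq> U" using p n by (auto simp: V_def)
  define A where "A x = a + (-1 * dd r x a * inverse (dd r x n)) *\<^sub>R n" for x
  have "Ck_on k V (\<lambda>x. dd r x w)" for k w
    by (rule smooth_onD[OF smooth_on_subset[OF smooth_on_dd[OF smooth] VU]])
  then have "Ck_on k V A" for k
    unfolding A_def
    by (intro Ck_on_add Ck_on_const \<open>open V\<close> Ck_on_scaleR Ck_on_mult Ck_on_inverse) (auto simp: V_def)
  then have "smooth_on V A" by (simp add: smooth_on_def)
  moreover have "A p = a" using a by (simp add: A_def)
  moreover have "dd r x (A x) = 0" if "x \<in> V" for x
    using that VU by (auto simp: A_def V_def dr_linear_simps)
  ultimately show ?thesis
    using \<open>open V\<close> pV VU by blast
qed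

text \<open>
  The function \<open>s * lev r x (A x) (A x)\<close> is nonnegative on the level set and vanishes at \<open>p\<close>.
\<close>

lemma lev_critical:
  assumes V: "open V" "p \<in> V" "V \<subseteq> U" and p: "r p = 0" "dd r p n \<noteq> 0" and "s \<noteq> 0"
    and pos: "\<And>x a. x \<in> V \<Longrightarrow> r x = 0 \<Longrightarrow> dd r x a = 0 \<Longrightarrow> dd r x (\<i> *s a) = 0 \<Longrightarrow> 0 \<le> s * lev r x a a"
    and A: "A differentiable (at p)"
      "\<And>x. x \<in> V \<Longrightarrow> r x = 0 \<Longrightarrow> dd r x (A x) = 0 \<and> dd r x (\<i> *s A x) = 0"
    and zero: "lev r p (A p) (A p) = 0" and X: "dd r p X = 0"
  shows "dd (\<lambda>x. lev r x (A x) (A x)) p X = 0"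
proof -
  have pU: "p \<in> U" using V by auto
  let ?g = "\<lambda>x. lev r x (A x) (A x)"
  have "((\<lambda>x. s * ?g x) has_derivative (\<lambda>h. s * dd ?g p h)) (at p)"
    by (intro has_derivative_mult_right dd_has_derivative differentiable_lev_field pU A(1))
  then have "s * dd ?g p X = 0"
    by (rule tangential_critical[OF V(1,2) p(1) continuous_on_subset[OF smooth_on_continuous[OF smooth] V(3)]
          has_derivative_r[OF pU] p(2) X])
      (use pos A(2) zero in auto)
  then show ?thesis using \<open>s \<noteq> 0\<close> by simp
qed

lemma lev_critical_polar:
  assumes V: "open V" "p \<in> V" "V \<subseteq> U" and p: "r p = 0" "dd r p n \<noteq> 0" and "s \<noteq> 0"
    and pos: "\<And>x a. x \<in> V \<Longrightarrow> r x = 0 \<Longrightarrow> dd r x a = 0 \<Longrightarrow> dd r x (\<i> *s a) = 0 \<Longrightarrow> 0 \<le> s * lev r x a a"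
    and A: "A differentiable (at p)"
      "\<And>x. x \<in> V \<Longrightarrow> r x = 0 \<Longrightarrow> dd r x (A x) = 0 \<and> dd r x (\<i> *s A x) = 0"
    and B: "B differentiable (at p)"
      "\<And>x. x \<in> V \<Longrightarrow> r x = 0 \<Longrightarrow> dd r x (B x) = 0 \<and> dd r x (\<i> *s B x) = 0"
    and zero: "lev r p (A p) (A p) = 0" "lev r p (A p) (B p) = 0" "lev r p (B p) (B p) = 0"
    and X: "dd r p X = 0"
  shows "dd (\<lambda>x. lev r x (A x) (B x)) p X = 0"
proof -
  have pU: "p \<in> U" using V by auto
  note J = bounded_linear.linear[OF bounded_linear_smult[of \<i>]]
  have zero': "lev r p (B p) (A p) = 0"
    using zero(2) lev_sym[OF pU] by simp
  let ?P = "\<lambda>x. lev r x (A x + B x) (A x + B x)" and ?M = "\<lambda>x. lev r x (A x - B x) (A x - B x)"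
  have P: "dd ?P p X = 0"
    by (rule lev_critical[OF V p \<open>s \<noteq> 0\<close> pos _ _ _ X])
      (use A B zero zero' V(3) in \<open>auto simp: dr_linear_simps linear_add[OF J] lev_linear_simps[OF pU] subset_iff\<close>)
  have M: "dd ?M p X = 0"
    by (rule lev_critical[OF V p \<open>s \<noteq> 0\<close> pos _ _ _ X])
      (use A B zero zero' V(3) in \<open>auto simp: dr_linear_simps linear_diff[OF J] lev_linear_simps[OF pU] subset_iff\<close>)
  have "((\<lambda>x. 1 / 4 * (?P x - ?M x)) has_derivative (\<lambda>h. 1 / 4 * (dd ?P p h - dd ?M p h))) (at p)"
    by (intro has_derivative_mult_right has_derivative_diff dd_has_derivative differentiable_lev_field pU
        differentiable_add differentiable_diff A(1) B(1))
  then have "((\<lambda>x. lev r x (A x) (B x)) has_derivative (\<lambda>h. 1 / 4 * (dd ?P p h - dd ?M p h))) (at p)"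
  proof (rule has_derivative_transform_within_open[OF _ open_domain pU])
    fix x assume "x \<in> U"
    then show "1 / 4 * (?P x - ?M x) = lev r x (A x) (B x)"
      using lev_sym[of x "B x" "A x"] by (simp add: lev_linear_simps)
  qed
  from dd_eqI[OF this] show ?thesis
    using P M by simp
qed

end

section \<open>Tangent spaces and brackets on a hypersurface\<close>

locale hypersurface_patch = smooth_function U r
  for U :: "(complex ^ 'n::finite) set" and r :: "complex ^ 'n \<Rightarrow> real" +
  fixes M :: "(complex ^ 'n) set"
  assumes zero_set: "M \<inter> U = {x \<in> U. r x = 0}"
    and regular: "\<And>x. x \<in> M \<inter> U \<Longrightarrow> dd r x \<noteq> (\<lambda>v. 0)"
begin

lemma defining: "defining_function M U r"
  using open_domain smooth zero_set regular by (simp add: defining_function_def)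

lemma r_eq_0: "x \<in> M \<Longrightarrow> x \<in> U \<Longrightarrow> r x = 0"
  using zero_set by blast

lemma critical_on_M:
  fixes g :: "complex ^ 'n \<Rightarrow> real"
  assumes x: "x \<in> M" "x \<in> U" and V: "open V" "x \<in> V"
    and g: "(g has_derivative g') (at x)" "g x = 0" "\<And>y. y \<in> M \<Longrightarrow> y \<in> V \<Longrightarrow> 0 \<le> g y"
    and X: "dd r x X = 0"
  shows "g' X = 0"
proof -
  obtain n where n: "dd r x n \<noteq> 0"
    using regular[of x] x by (auto simp: fun_eq_iff)
  show ?thesis
  proof (rule tangential_critical[OF _ _ _ _ has_derivative_r[OF x(2)] n X g(1,2)])
    show "open (U \<inter> V)" "x \<in> U \<inter> V" using open_domain V x by auto
    show "r x = 0" using x zero_set by auto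
    show "continuous_on (U \<inter> V) r"
      using smooth_on_continuous[OF smooth] by (rule continuous_on_subset) auto
    show "0 \<le> g y" if "y \<in> U \<inter> V" "r y = 0" for y
      using g(3)[of y] that zero_set by auto
  qed
qed

text \<open>
  Tangent vectors are defined through an arbitrary defining function \<open>r'\<close>. As \<open>r\<close> vanishes where
  \<open>r'\<close> does, it has a minimum there, and so the kernel of \<open>dr'\<close> is contained in that of \<open>dr\<close>.
\<close>

lemma tangent_space_iff:
  assumes "x \<in> M" "x \<in> U"
  shows "v \<in> tangent_space M x \<longleftrightarrow> dd r x v = 0"
proof
  assume "v \<in> tangent_space M x"
  then obtain U' r' where r': "x \<in> U'" "defining_function M U' r'" "dd r' x v = 0"
    by (auto simp: tangent_space_def)
  interpret r': hypersurface_patch U' r' M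
    using r'(2) by unfold_locales (auto simp: defining_function_def)
  show "dd r x v = 0"
    by (rule r'.critical_on_M[OF assms(1) r'(1) open_domain assms(2) has_derivative_r[OF assms(2)] _ _ r'(3)])
      (use r_eq_0 assms in auto)
next
  assume "dd r x v = 0"
  then show "v \<in> tangent_space M x"
    using defining assms by (auto simp: tangent_space_def)
qed

lemma complex_tangent_space_iff:
  "x \<in> M \<Longrightarrow> x \<in> U \<Longrightarrow> v \<in> complex_tangent_space M x \<longleftrightarrow> dd r x v = 0 \<and> dd r x (\<i> *s v) = 0"
  by (simp add: complex_tangent_space_def tangent_space_iff)

lemma CT_iff: "x \<in> M \<Longrightarrow> x \<in> U \<Longrightarrow> Z \<in> CT M x \<longleftrightarrow> dd r x (fst Z) = 0 \<and> dd r x (snd Z) = 0"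
  by (cases Z) (simp add: CT_def tangent_space_iff)

lemma CH_iff: "x \<in> M \<Longrightarrow> x \<in> U \<Longrightarrow> Z \<in> CH M x \<longleftrightarrow>
   dd r x (fst Z) = 0 \<and> dd r x (\<i> *s fst Z) = 0 \<and> dd r x (snd Z) = 0 \<and> dd r x (\<i> *s snd Z) = 0"
  by (cases Z) (auto simp: CH_def complex_tangent_space_iff)

lemma H10_iff:
  assumes "x \<in> M" "x \<in> U"
  shows "Z \<in> H10 M x \<longleftrightarrow> dd r x (fst Z) = 0 \<and> dd r x (\<i> *s fst Z) = 0 \<and> snd Z = - (\<i> *s fst Z)"
proof -
  have "cJ Z = cscale \<i> Z \<longleftrightarrow> snd Z = - (\<i> *s fst Z)"
    by (auto simp: cJ_def cscale_def prod_eq_iff vec_eq_iff)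
  then show ?thesis
    unfolding H10_def mem_Collect_eq CH_iff[OF assms]
    by (auto simp: dr_linear_simps[OF assms(2)] linear_neg[OF bounded_linear.linear[OF bounded_linear_smult]])
qed

lemma H01_iff:
  assumes "x \<in> M" "x \<in> U"
  shows "Z \<in> H01 M x \<longleftrightarrow> dd r x (fst Z) = 0 \<and> dd r x (\<i> *s fst Z) = 0 \<and> snd Z = \<i> *s fst Z"
proof -
  have "Z \<in> H01 M x \<longleftrightarrow> cconj Z \<in> H10 M x"
    unfolding H01_def by (auto simp: image_iff cconj_def) (metis fst_conv minus_minus prod.collapse snd_conv)
  then show ?thesis
    by (auto simp: H10_iff[OF assms] cconj_def)
qed

text \<open>
  The function \<open>y \<mapsto> dr (c B)\<close> vanishes on \<open>M\<close>, so its derivative along the tangent vector \<open>a\<close> is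
  zero. Used with \<open>c = 1\<close> and \<open>c = \<i>\<close>.
\<close>

lemma hess_tangent:
  assumes x: "x \<in> M" "x \<in> U" and V: "open V" "x \<in> V"
    and B: "B differentiable (at x)" "\<And>y. y \<in> M \<inter> V \<Longrightarrow> dd r y (c *s B y) = 0"
    and a: "dd r x a = 0"
  shows "dd r x (c *s dd B x a) = - hess r x (c *s B x) a"
proof -
  have g: "((\<lambda>y. dd r y (c *s B y)) has_derivative (\<lambda>h. hess r x (c *s B x) h + dd r x (c *s dd B x h))) (at x)"
    by (intro has_derivative_dr_field x bounded_linear.has_derivative[OF bounded_linear_smult] dd_has_derivative B(1))
  have "hess r x (c *s B x) a + dd r x (c *s dd B x a) = 0"
    by (rule critical_on_M[OF x V g _ _ a]) (use B(2) x V in auto)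
  then show ?thesis by simp
qed

lemma bracket_components:
  assumes "L differentiable (at x)" "L' differentiable (at x)"
  defines "X \<equiv> \<lambda>y. fst (L y)" and "Y \<equiv> \<lambda>y. snd (L y)"
    and "X' \<equiv> \<lambda>y. fst (L' y)" and "Y' \<equiv> \<lambda>y. snd (L' y)"
  shows "bracket L L' x =
    ((dd X' x (X x) - dd X x (X' x)) - (dd Y' x (Y x) - dd Y x (Y' x)),
     (dd Y' x (X x) - dd X x (Y' x)) + (dd X' x (Y x) - dd Y x (X' x)))"
proof -
  have L: "dd L x h = (dd X x h, dd Y x h)" if "L differentiable (at x)" "X = (\<lambda>y. fst (L y))" "Y = (\<lambda>y. snd (L y))"
    for L X Y h
    using dd_eqI[OF has_derivative_fst[OF dd_has_derivative[OF that(1)]]]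
      dd_eqI[OF has_derivative_snd[OF dd_has_derivative[OF that(1)]]] by (simp add: that)
  show ?thesis
    unfolding bracket_def cderiv_field_def
    by (simp add: L[OF assms(1) X_def[THEN meta_eq_to_obj_eq] Y_def[THEN meta_eq_to_obj_eq]]
        L[OF assms(2) X'_def[THEN meta_eq_to_obj_eq] Y'_def[THEN meta_eq_to_obj_eq]] cscale_def)
      (simp add: X_def Y_def X'_def Y'_def)
qed

text \<open>
  The bracket is tangent to \<open>M\<close>, and its class modulo the complex tangent space depends on
  the sections only through their values at \<open>x\<close>. By \<open>hess_tangent\<close> each of the derivatives in the
  bracket turns into a second derivative of \<open>r\<close>.
\<close>

lemma bracket_levi:
  assumes x: "x \<in> M" "x \<in> U"
    and L2: "local_section M (H10 M) x L2" and L1: "local_section M (H01 M) x L1"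
  defines "Z \<equiv> bracket L2 L1 x"
  shows "Z \<in> CT M x"
    and "dd r x (\<i> *s fst Z) = - 2 * lev r x (fst (L2 x)) (\<i> *s fst (L1 x))"
    and "dd r x (\<i> *s snd Z) = 2 * lev r x (fst (L2 x)) (fst (L1 x))"
proof -
  obtain V2 where V2: "open V2" "x \<in> V2" "smooth_on V2 L2" "\<And>y. y \<in> M \<inter> V2 \<Longrightarrow> L2 y \<in> H10 M y"
    using L2 by (auto simp: local_section_def)
  obtain V1 where V1: "open V1" "x \<in> V1" "smooth_on V1 L1" "\<And>y. y \<in> M \<inter> V1 \<Longrightarrow> L1 y \<in> H01 M y"
    using L1 by (auto simp: local_section_def)
  define V where "V = U \<inter> V1 \<inter> V2"
  have V: "open V" "x \<in> V" using V1 V2 open_domain x by (auto simp: V_def)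
  have diff: "L2 differentiable (at x)" "L1 differentiable (at x)"
    using V1 V2 by (auto intro: smooth_on_differentiable)
  define a a' b b' where "a y = fst (L2 y)" and "a' y = snd (L2 y)" and "b y = fst (L1 y)" and "b' y = snd (L1 y)" for y
  have ab: "dd r y (a y) = 0" "dd r y (\<i> *s a y) = 0" "a' y = - (\<i> *s a y)"
     "dd r y (b y) = 0" "dd r y (\<i> *s b y) = 0" "b' y = \<i> *s b y" if "y \<in> M \<inter> V" for y
    using V1(4)[of y] V2(4)[of y] that
    by (auto simp: V_def H10_iff H01_iff a_def a'_def b_def b'_def)
  have d: "a differentiable (at x)" "a' differentiable (at x)" "b differentiable (at x)" "b' differentiable (at x)"
    unfolding a_def a'_def b_def b'_def
    using diff by (auto intro: differentiableI has_derivative_fst has_derivative_snd dd_has_derivative)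
  note neg = linear_neg[OF bounded_linear.linear[OF bounded_linear_smult[of \<i>]]]
  have tan: "dd r y (\<i> *s a' y) = 0" "dd r y (\<i> *s b' y) = 0" "dd r y (a' y) = 0" "dd r y (b' y) = 0"
    if "y \<in> M \<inter> V" for y
  proof -
    have yU: "y \<in> U" using that by (auto simp: V_def)
    show "dd r y (\<i> *s a' y) = 0" "dd r y (\<i> *s b' y) = 0" "dd r y (a' y) = 0" "dd r y (b' y) = 0"
      using ab[OF that] by (simp_all add: neg dr_linear_simps[OF yU])
  qed
  have xMV: "x \<in> M \<inter> V" using x V by auto
  note at = ab(1,4)[OF xMV] tan(3,4)[OF xMV]
  note h = hess_tangent[OF x V]
  have h1: "dd r x (1 *s dd B x c) = - hess r x (1 *s B x) c" if "B differentiable (at x)"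
    "\<And>y. y \<in> M \<inter> V \<Longrightarrow> dd r y (B y) = 0" "dd r x c = 0" for B c
    using that by (intro h) auto
  have br: "fst Z = (dd b x (a x) - dd a x (b x)) - (dd b' x (a' x) - dd a' x (b' x))"
    "snd Z = (dd b' x (a x) - dd a x (b' x)) + (dd b x (a' x) - dd a' x (b x))"
    unfolding Z_def bracket_components[OF diff] a_def a'_def b_def b'_def by auto
  note Jlin = linear_add[OF bounded_linear.linear[OF bounded_linear_smult[of \<i>]]]
    linear_diff[OF bounded_linear.linear[OF bounded_linear_smult[of \<i>]]]
  note Js = h[OF d(1) ab(2)] h[OF d(2) tan(1)] h[OF d(3) ab(5)] h[OF d(4) tan(2)]
  note Is = h1[OF d(1) ab(1), simplified] h1[OF d(2) tan(3), simplified]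
    h1[OF d(3) ab(4), simplified] h1[OF d(4) tan(4), simplified]
  show "Z \<in> CT M x"
    unfolding CT_iff[OF x] br
    by (simp add: dr_linear_simps[OF x(2)] Is at hess_sym[OF x(2), of "b x"] hess_sym[OF x(2), of "b' x"])
  have xU: "x \<in> U" by (rule x)
  show "dd r x (\<i> *s fst Z) = - 2 * lev r x (fst (L2 x)) (\<i> *s fst (L1 x))"
    unfolding br Jlin dr_linear_simps[OF xU]
    by (simp only: Js at, simp add: ab(3,6)[OF xMV] neg hess_linear_simps[OF xU] lev_def a_def[symmetric] b_def[symmetric]
       hess_sym[OF xU, of "\<i> *s b x"] hess_sym[OF xU, of "b x"])
  show "dd r x (\<i> *s snd Z) = 2 * lev r x (fst (L2 x)) (fst (L1 x))"
    unfolding br Jlin dr_linear_simps[OF xU]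
    by (simp only: Js at, simp add: ab(3,6)[OF xMV] neg hess_linear_simps[OF xU] lev_def a_def[symmetric] b_def[symmetric]
       hess_sym[OF xU, of "\<i> *s b x"] hess_sym[OF xU, of "b x"])
qed

end

section \<open>The Levi form\<close>

text \<open>
  The class of \<open>Z\<close> in the fibre of \<open>\<complex>Q\<close>, for \<open>Z \<in> CT M p\<close>.
\<close>

definition coset :: "(complex ^ 'n::finite) set \<Rightarrow> complex ^ 'n \<Rightarrow> 'n cvec \<Rightarrow> 'n cvec set" where
  "coset M p Z = {Z' \<in> CT M p. Z - Z' \<in> CH M p}"

lemma CQ_iff: "c \<in> CQ M p \<longleftrightarrow> (\<exists>Z\<in>CT M p. c = coset M p Z)"
proof -
  have "{(Z, Z'). Z \<in> CT M p \<and> Z' \<in> CT M p \<and> Z - Z' \<in> CH M p} `` {Z} = coset M p Z" if "Z \<in> CT M p" for Z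
    using that by (auto simp: coset_def)
  then show ?thesis
    unfolding CQ_def quotient_def by auto
qed

lemma cpair_cscale: "cpair \<omega> (cscale c Z) = c * cpair \<omega> Z"
  by (simp add: cpair_def cscale_def complex_eq_iff blinfun.add_right blinfun.diff_right blinfun.scaleR_right)

lemma smooth_on_linear_image:
  assumes "open V" "smooth_on V A" "bounded_linear h"
  shows "smooth_on V (\<lambda>x. h (A x))"
  using assms by (simp add: smooth_on_def Ck_on_linear_comp)

lemma bounded_linear_10: "bounded_linear (\<lambda>a. (a, - (\<i> *s a)) :: 'n::finite cvec)"
  by (intro bounded_linear_Pair bounded_linear_ident bounded_linear_minus bounded_linear_smult)

lemma bounded_linear_01: "bounded_linear (\<lambda>a. (a, \<i> *s a) :: 'n::finite cvec)"
  by (intro bounded_linear_Pair bounded_linear_ident bounded_linear_smult)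

lemma differentiable_bracket:
  fixes L L' :: "complex ^ 'n \<Rightarrow> ('n::finite) cvec"
  assumes "open V" "x \<in> V" "smooth_on V L" "smooth_on V L'"
  shows "bracket L L' differentiable (at x)"
proof -
  have dir: "(\<lambda>y. dd L y (W y)) differentiable (at x)" 
    if "smooth_on V L" "W differentiable (at x)" for L :: "complex ^ 'n \<Rightarrow> 'n cvec" and W
    by (rule differentiableI[OF has_derivative_linear_family[OF assms(1,2) _ _ dd_has_derivative[OF that(2)]]])
      (use linear_dd smooth_on_differentiable[OF that(1)]
        smooth_on_differentiable[OF smooth_on_dd[OF that(1)] assms(2)] in auto)
  have fs: "(\<lambda>y. fst (L y)) differentiable (at x)" "(\<lambda>y. snd (L y)) differentiable (at x)"
    if "smooth_on V L" for L :: "complex ^ 'n \<Rightarrow> 'n cvec"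
    using smooth_on_differentiable[OF that assms(2)]
    by (auto intro: differentiableI has_derivative_fst has_derivative_snd dd_has_derivative)
  have "linear (cscale \<i> :: 'n cvec \<Rightarrow> 'n cvec)"
    by (rule linearI) (auto simp: cscale_def)
  then have bl: "bounded_linear (cscale \<i> :: 'n cvec \<Rightarrow> 'n cvec)"
    by (simp add: linear_conv_bounded_linear)
  have cs: "(\<lambda>y. cscale \<i> (W y)) differentiable (at x)" if "W differentiable (at x)"
    for W :: "complex ^ 'n \<Rightarrow> 'n cvec"
    by (rule differentiableI[OF bounded_linear.has_derivative[OF bl dd_has_derivative[OF that]]])
  have "(\<lambda>x. bracket L L' x) differentiable (at x)"
    unfolding bracket_def cderiv_field_def
    by (intro differentiable_diff differentiable_add dir fs cs assms(3,4))
  then show ?thesis by simp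
qed

context hypersurface_patch
begin

lemma CH_eq_coset: 
  assumes "x \<in> M" "x \<in> U"
  shows "CH M x = coset M x 0"
  by (auto simp: coset_def CH_iff[OF assms] CT_iff[OF assms] dr_linear_simps[OF assms(2)]
      linear_neg[OF bounded_linear.linear[OF bounded_linear_smult]])

lemma zero_in_CT: "x \<in> M \<Longrightarrow> x \<in> U \<Longrightarrow> 0 \<in> CT M x"
  by (simp add: CT_iff dr_linear_simps)

lemma zero_in_CH: "x \<in> M \<Longrightarrow> x \<in> U \<Longrightarrow> 0 \<in> CH M x"
  by (simp add: CH_iff dr_linear_simps)

lemma qpair_coset:
  assumes x: "x \<in> M" "x \<in> U" and \<omega>: "\<forall>a\<in>complex_tangent_space M x. blinfun_apply \<omega> a = 0"
    and Z: "Z \<in> CT M x"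
  shows "qpair \<omega> (coset M x Z) = cpair \<omega> Z"
proof -
  have const: "cpair \<omega> Z' = cpair \<omega> Z" if "Z' \<in> coset M x Z" for Z'
  proof -
    have "fst (Z - Z') \<in> complex_tangent_space M x" "snd (Z - Z') \<in> complex_tangent_space M x"
      using that by (simp_all add: coset_def CH_def mem_Times_iff)
    then show ?thesis
      using \<omega> by (fastforce simp: cpair_def blinfun.diff_right)
  qed
  have mem: "Z \<in> coset M x Z"
    using Z zero_in_CH[OF x] by (simp add: coset_def)
  have "cpair \<omega> ` coset M x Z = {cpair \<omega> Z}"
  proof
    show "cpair \<omega> ` coset M x Z \<subseteq> {cpair \<omega> Z}"
      using const by blast
    show "{cpair \<omega> Z} \<subseteq> cpair \<omega> ` coset M x Z"
      using mem by blast
  qed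
  then show ?thesis by (simp add: qpair_def)
qed

text \<open>
  The combination \<open>dr (\<i> Y) X - dr (\<i> X) Y\<close> is a complex tangent vector, hence killed by \<open>\<omega>\<close>. In
  other words, \<open>\<omega>\<close> and \<open>dr \<circ> J\<close> are proportional on the tangent space.
\<close>

lemma contact_proportional:
  assumes x: "x \<in> M" "x \<in> U" and \<omega>: "\<forall>a\<in>complex_tangent_space M x. blinfun_apply \<omega> a = 0"
    and "dd r x X = 0" "dd r x Y = 0"
  shows "blinfun_apply \<omega> X * dd r x (\<i> *s Y) = blinfun_apply \<omega> Y * dd r x (\<i> *s X)"
proof -
  note J = bounded_linear.linear[OF bounded_linear_smult[of \<i>]]
  have "dd r x (\<i> *s Y) *\<^sub>R X - dd r x (\<i> *s X) *\<^sub>R Y \<in> complex_tangent_space M x"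
    using assms(4,5)
    by (simp add: complex_tangent_space_iff[OF x] dr_linear_simps[OF x(2)] linear_diff[OF J] linear_scale[OF J])
  from bspec[OF \<omega> this] show ?thesis
    by (simp add: blinfun.diff_right blinfun.scaleR_right mult.commute)
qed

lemma contact_transversal:
  assumes x: "x \<in> M" "x \<in> U" and \<omega>: "\<forall>a\<in>complex_tangent_space M x. blinfun_apply \<omega> a = 0"
    and "dd r x X = 0" "blinfun_apply \<omega> X \<noteq> 0"
  shows "dd r x (\<i> *s X) \<noteq> 0"
proof
  assume "dd r x (\<i> *s X) = 0"
  then have "X \<in> complex_tangent_space M x"
    using assms(4) by (simp add: complex_tangent_space_iff[OF x])
  then show False
    using \<omega> assms(5) by blast
qed

text \<open>
  A covector that annihilates the complex tangent space but not the tangent space separates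
  the points of \<open>\<complex>Q\<close>.
\<close>

lemma coset_eqI:
  assumes x: "x \<in> M" "x \<in> U" and \<omega>: "\<forall>a\<in>complex_tangent_space M x. blinfun_apply \<omega> a = 0"
    and X: "dd r x X = 0" "blinfun_apply \<omega> X \<noteq> 0"
    and Z: "Z \<in> CT M x" "W \<in> CT M x" and eq: "cpair \<omega> Z = cpair \<omega> W"
  shows "coset M x Z = coset M x W"
proof -
  note J = bounded_linear.linear[OF bounded_linear_smult[of \<i>]]
  have zero: "dd r x (\<i> *s Y) = 0" if "dd r x Y = 0" "blinfun_apply \<omega> Y = 0" for Y
    using contact_proportional[OF x \<omega> X(1) that(1)] that(2) X(2) by simp
  have "dd r x (\<i> *s (fst Z - fst W)) = 0" "dd r x (\<i> *s (snd Z - snd W)) = 0"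
    using Z eq zero[of "fst Z - fst W"] zero[of "snd Z - snd W"]
    by (simp_all add: CT_iff[OF x] dr_linear_simps[OF x(2)] blinfun.diff_right cpair_def)
  then have "dd r x (\<i> *s fst Z) = dd r x (\<i> *s fst W)" "dd r x (\<i> *s snd Z) = dd r x (\<i> *s snd W)"
    by (simp_all add: dr_linear_simps[OF x(2)] linear_diff[OF J])
  then show ?thesis
    using Z unfolding coset_def CH_iff[OF x] CT_iff[OF x]
    by (auto simp: dr_linear_simps[OF x(2)] linear_diff[OF J])
qed

text \<open>
  The definite descriptions behind the Levi form and the cubic tensor are evaluated by
  exhibiting one class with the required property; a single nonvanishing contact form gives
  uniqueness.
\<close>

lemma the_coset:
  assumes x: "x \<in> M" "x \<in> U" and \<omega>: "\<forall>a\<in>complex_tangent_space M x. blinfun_apply \<omega> a = 0"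
    and X: "dd r x X = 0" "blinfun_apply \<omega> X \<noteq> 0"
    and Z: "Z \<in> CT M x" and P: "P (coset M x Z)"
    and uniq: "\<And>c. P c \<Longrightarrow> qpair \<omega> c = cpair \<omega> Z"
  shows "(THE c. c \<in> CQ M x \<and> P c) = coset M x Z"
proof (rule the_equality)
  show "coset M x Z \<in> CQ M x \<and> P (coset M x Z)"
    using Z P by (auto simp: CQ_iff)
next
  fix c assume c: "c \<in> CQ M x \<and> P c"
  then obtain W where W: "W \<in> CT M x" "c = coset M x W"
    by (auto simp: CQ_iff)
  have "cpair \<omega> W = cpair \<omega> Z"
    using uniq[of c] c qpair_coset[OF x \<omega> W(1)] W(2) by simp
  then show "c = coset M x Z"
    using coset_eqI[OF x \<omega> X W(1) Z] W(2) by simp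
qed

lemma section_through:
  assumes x: "x \<in> M" "x \<in> U"
  shows "Z \<in> CT M x \<Longrightarrow> \<exists>L. local_section M (CT M) x L \<and> L x = Z"
    and "Z \<in> H10 M x \<Longrightarrow> \<exists>L. local_section M (H10 M) x L \<and> L x = Z"
    and "Z \<in> H01 M x \<Longrightarrow> \<exists>L. local_section M (H01 M) x L \<and> L x = Z"
proof -
  obtain n where n: "dd r x n \<noteq> 0"
    using regular[of x] x by (auto simp: fun_eq_iff)
  note hol = holomorphic_tangent_field[OF x(2) n]
  note neg = linear_neg[OF bounded_linear.linear[OF bounded_linear_smult[of \<i>]]]
  show "\<exists>L. local_section M (H10 M) x L \<and> L x = Z" if "Z \<in> H10 M x"
  proof -
    have h: "dd r x (fst Z) = 0" "dd r x (\<i> *s fst Z) = 0"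
      using that by (simp_all add: H10_iff[OF x])
    obtain V A where A: "open V" "x \<in> V" "V \<subseteq> U" "smooth_on V A" "A x = fst Z"
      "\<forall>y\<in>V. dd r y (A y) = 0 \<and> dd r y (\<i> *s A y) = 0"
      using hol[OF h] by blast
    have "(A x, - (\<i> *s A x)) = Z"
      using that A(5) by (simp add: H10_iff[OF x] prod_eq_iff)
    moreover have "local_section M (H10 M) x (\<lambda>y. (A y, - (\<i> *s A y)))"
      unfolding local_section_def using A
      by (intro exI[of _ V] conjI smooth_on_linear_image[OF _ _ bounded_linear_10]) (auto simp: H10_iff subset_iff)
    ultimately show ?thesis
      by (intro exI[of _ "\<lambda>y. (A y, - (\<i> *s A y))"]) auto
  qed
  show "\<exists>L. local_section M (H01 M) x L \<and> L x = Z" if "Z \<in> H01 M x"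
  proof -
    have h: "dd r x (fst Z) = 0" "dd r x (\<i> *s fst Z) = 0"
      using that by (simp_all add: H01_iff[OF x])
    obtain V A where A: "open V" "x \<in> V" "V \<subseteq> U" "smooth_on V A" "A x = fst Z"
      "\<forall>y\<in>V. dd r y (A y) = 0 \<and> dd r y (\<i> *s A y) = 0"
      using hol[OF h] by blast
    have "(A x, \<i> *s A x) = Z"
      using that A(5) by (simp add: H01_iff[OF x] prod_eq_iff)
    moreover have "local_section M (H01 M) x (\<lambda>y. (A y, \<i> *s A y))"
      unfolding local_section_def using A
      by (intro exI[of _ V] conjI smooth_on_linear_image[OF _ _ bounded_linear_01]) (auto simp: H01_iff subset_iff)
    ultimately show ?thesis
      by (intro exI[of _ "\<lambda>y. (A y, \<i> *s A y)"]) auto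
  qed
  show "\<exists>L. local_section M (CT M) x L \<and> L x = Z" if "Z \<in> CT M x"
  proof -
    have Z: "dd r x (fst Z) = 0" "dd r x (snd Z) = 0"
      using that by (auto simp: CT_iff[OF x])
    obtain V A where A: "open V" "x \<in> V" "V \<subseteq> U" "smooth_on V A" "A x = fst Z" "\<forall>y\<in>V. dd r y (A y) = 0"
      using tangent_field[OF x(2) n Z(1)] by blast
    obtain V' B where B: "open V'" "x \<in> V'" "V' \<subseteq> U" "smooth_on V' B" "B x = snd Z" "\<forall>y\<in>V'. dd r y (B y) = 0"
      using tangent_field[OF x(2) n Z(2)] by blast
    have V: "open (V \<inter> V')" using A B by auto
    have bl: "bounded_linear (\<lambda>a :: complex ^ 'n. (a, 0) :: 'n cvec)"
      "bounded_linear (\<lambda>a :: complex ^ 'n. (0, a) :: 'n cvec)"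
      by (intro bounded_linear_Pair bounded_linear_ident bounded_linear_zero)+
    have "Ck_on k (V \<inter> V') A" "Ck_on k (V \<inter> V') B" for k
      using Ck_on_subset[OF smooth_onD[OF A(4)] Int_lower1] Ck_on_subset[OF smooth_onD[OF B(4)] Int_lower2]
      by blast+
    then have "Ck_on k (V \<inter> V') (\<lambda>y. (A y, 0) + (0, B y))" for k
      by (rule Ck_on_add[OF V Ck_on_linear_comp[OF V bl(1)] Ck_on_linear_comp[OF V bl(2)]])
    then have "smooth_on (V \<inter> V') (\<lambda>y. (A y, B y))"
      by (simp add: smooth_on_def)
    moreover have "(A y, B y) \<in> CT M y" if "y \<in> M \<inter> (V \<inter> V')" for y
      using that A(3,6) B(6) by (auto simp: CT_iff)
    ultimately have "local_section M (CT M) x (\<lambda>y. (A y, B y))"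
      unfolding local_section_def using A(2) B(2) V by blast
    then show ?thesis
      using A(5) B(5) by (intro exI[of _ "\<lambda>y. (A y, B y)"]) auto
  qed
qed

text \<open>
  Other sections with the same values, and other contact forms, lead to the same class: the
  values of \<open>dr \<circ> J\<close> on the bracket are fixed by \<open>bracket_levi\<close>, and any contact form is
  proportional to it.
\<close>

lemma levi_form_eq_bracket:
  assumes x: "x \<in> M" "x \<in> U"
    and \<theta>: "contact_form_on M W \<theta>" "x \<in> W" and X: "X \<in> tangent_space M x" "blinfun_apply (\<theta> x) X \<noteq> 0"
    and L: "local_section M (H10 M) x L2" "local_section M (H01 M) x L1"
  shows "levi_form M x (L2 x) (L1 x) = coset M x (cscale \<i> (bracket L2 L1 x))"
proof -
  have X': "dd r x X = 0" using X(1) by (simp add: tangent_space_iff[OF x])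
  have van: "\<forall>a\<in>complex_tangent_space M x. blinfun_apply (\<theta> x) a = 0" if "local_contact_form M x \<theta>" for \<theta>
    using that x by (auto simp: local_contact_form_def contact_form_on_def)
  have lc: "local_contact_form M x \<theta>"
    using \<theta> by (auto simp: local_contact_form_def)
  note trans = contact_transversal[OF x van[OF lc] X' X(2)]
  have CTi: "cscale \<i> Z \<in> CT M x" if "Z \<in> CT M x" for Z
    using that by (simp add: CT_iff[OF x] cscale_def dr_linear_simps[OF x(2)])
  define Z where "Z = bracket L2 L1 x"
  note Z = bracket_levi[OF x L, folded Z_def]
  have same: "cpair (\<theta> x) (bracket L2' L1' x) = cpair (\<theta> x) Z"
    if "local_section M (H10 M) x L2'" "L2' x = L2 x" "local_section M (H01 M) x L1'" "L1' x = L1 x"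
      "local_contact_form M x \<theta>" for L2' L1' \<theta>
  proof -
    note Z' = bracket_levi[OF x that(1,3)]
    note pr = contact_proportional[OF x van[OF that(5)] _ X']
    have t: "dd r x (fst Z) = 0" "dd r x (snd Z) = 0" "dd r x (fst (bracket L2' L1' x)) = 0"
      "dd r x (snd (bracket L2' L1' x)) = 0"
      using Z(1) Z'(1) unfolding CT_iff[OF x] by blast+
    have "blinfun_apply (\<theta> x) (fst (bracket L2' L1' x)) * dd r x (\<i> *s X) = blinfun_apply (\<theta> x) (fst Z) * dd r x (\<i> *s X)"
      unfolding pr[OF t(1)] pr[OF t(3)] Z Z' that(2,4) ..
    moreover have "blinfun_apply (\<theta> x) (snd (bracket L2' L1' x)) * dd r x (\<i> *s X) = blinfun_apply (\<theta> x) (snd Z) * dd r x (\<i> *s X)"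
      unfolding pr[OF t(2)] pr[OF t(4)] Z Z' that(2,4) ..
    ultimately show ?thesis
      using trans by (simp add: cpair_def)
  qed
  show ?thesis
    unfolding levi_form_def Z_def[symmetric]
  proof (rule the_coset[OF x van[OF lc] X' X(2) CTi[OF Z(1)]])
    show "\<forall>L2' L1' \<theta>. local_section M (H10 M) x L2' \<and> L2' x = L2 x \<and>
       local_section M (H01 M) x L1' \<and> L1' x = L1 x \<and> local_contact_form M x \<theta> \<longrightarrow>
       qpair (\<theta> x) (coset M x (cscale \<i> Z)) = \<i> * cpair (\<theta> x) (bracket L2' L1' x)"
      using same by (auto simp: qpair_coset[OF x van CTi[OF Z(1)]] cpair_cscale)
  next
    fix c assume "\<forall>L2' L1' \<theta>. local_section M (H10 M) x L2' \<and> L2' x = L2 x \<and>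
       local_section M (H01 M) x L1' \<and> L1' x = L1 x \<and> local_contact_form M x \<theta> \<longrightarrow>
       qpair (\<theta> x) c = \<i> * cpair (\<theta> x) (bracket L2' L1' x)"
    then have "qpair (\<theta> x) c = \<i> * cpair (\<theta> x) (bracket L2 L1 x)"
      using L lc by blast
    then show "qpair (\<theta> x) c = cpair (\<theta> x) (cscale \<i> Z)"
      by (simp add: cpair_cscale Z_def)
  qed
qed

lemma K10_lev:
  assumes x: "x \<in> M" "x \<in> U"
    and \<theta>: "contact_form_on M W \<theta>" "x \<in> W" and X: "X \<in> tangent_space M x" "blinfun_apply (\<theta> x) X \<noteq> 0"
    and v: "v \<in> K10 M x" and b: "dd r x b = 0" "dd r x (\<i> *s b) = 0"
  shows "lev r x (fst v) b = 0"
proof -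
  have b': "(b, - (\<i> *s b)) \<in> H10 M x" "(b, \<i> *s b) \<in> H01 M x"
    using b by (auto simp: H10_iff[OF x] H01_iff[OF x])
  have vH: "v \<in> H10 M x" using v by (simp add: K10_def)
  obtain L2 where L2: "local_section M (H10 M) x L2" "L2 x = v"
    using section_through(2)[OF x vH] by blast
  obtain L1 where L1: "local_section M (H01 M) x L1" "L1 x = (b, \<i> *s b)"
    using section_through(3)[OF x b'(2)] by blast
  have "levi_form M x v (cconj (b, - (\<i> *s b))) = CH M x"
    using v b'(1) by (auto simp: K10_def)
  then have "CH M x = coset M x (cscale \<i> (bracket L2 L1 x))"
    using levi_form_eq_bracket[OF x \<theta> X L2(1) L1(1)] by (simp add: cconj_def L2 L1)
  moreover have "cscale \<i> (bracket L2 L1 x) \<in> coset M x (cscale \<i> (bracket L2 L1 x))"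
    using bracket_levi(1)[OF x L2(1) L1(1)] zero_in_CH[OF x]
    by (simp add: coset_def CT_iff[OF x] cscale_def dr_linear_simps[OF x(2)])
  ultimately have "cscale \<i> (bracket L2 L1 x) \<in> CH M x" by simp
  then have "dd r x (\<i> *s (- snd (bracket L2 L1 x))) = 0"
    by (simp add: CH_iff[OF x] cscale_def)
  then show ?thesis
    using bracket_levi(3)[OF x L2(1) L1(1)]
    by (simp add: L2 L1 linear_neg[OF bounded_linear.linear[OF bounded_linear_smult]] dr_linear_simps[OF x(2)])
qed

end

section \<open>Pseudoconvexity and the cubic tensor\<close>

lemma pseudoconvex_contact_form:
  assumes "pseudoconvex M" "p \<in> M"
  shows "\<exists>W \<theta> X. p \<in> W \<and> contact_form_on M W \<theta> \<and> X \<in> tangent_space M p \<and> blinfun_apply (\<theta> p) X \<noteq> 0"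
proof -
  obtain W \<theta> where W: "p \<in> W" "contact_form_on M W \<theta>"
    and tr: "\<forall>x \<in> M \<inter> W. \<exists>X \<in> tangent_space M x. blinfun_apply (\<theta> x) X \<noteq> 0"
    using assms unfolding pseudoconvex_def by metis
  have "p \<in> M \<inter> W" using assms(2) W(1) by simp
  from bspec[OF tr this] W show ?thesis by blast
qed

context hypersurface_patch
begin

lemma ex_transversal:
  assumes "x \<in> M" "x \<in> U"
  shows "\<exists>n. dd r x n \<noteq> 0"
  using regular[of x] assms by (auto simp: fun_eq_iff)

lemma differentiable_contact:
  assumes "open W" "x \<in> W" "smooth_on W \<theta>" "A differentiable (at x)"
  shows "(\<lambda>y. blinfun_apply (\<theta> y) (A y)) differentiable (at x)"
  by (rule differentiableI[OF bounded_bilinear.FDERIV[OF bounded_bilinear_blinfun_apply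
      dd_has_derivative[OF smooth_on_differentiable[OF assms(3,2)]] dd_has_derivative[OF assms(4)]]])

lemma differentiable_dr_i:
  assumes "x \<in> U" "A differentiable (at x)"
  shows "(\<lambda>y. dd r y (\<i> *s A y)) differentiable (at x)"
  by (rule differentiableI[OF has_derivative_dr_field[OF assms(1)
      bounded_linear.has_derivative[OF bounded_linear_smult dd_has_derivative[OF assms(2)]]]])

text \<open>
  The contact form \<open>\<theta>\<close> of the pseudoconvexity condition is a multiple of \<open>dr \<circ> J\<close> on the tangent
  spaces. The factor is nonzero and depends continuously on the point, so it has a constant
  sign near \<open>p\<close>.
\<close>

lemma pseudoconvex_lev:
  assumes "pseudoconvex M" and p: "p \<in> M" "p \<in> U"
  shows "\<exists>s V. s \<noteq> 0 \<and> open V \<and> p \<in> V \<and> V \<subseteq> U \<and>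
    (\<forall>x\<in>V. r x = 0 \<longrightarrow> (\<forall>a. dd r x a = 0 \<and> dd r x (\<i> *s a) = 0 \<longrightarrow> 0 \<le> s * lev r x a a))"
proof -
  from \<open>pseudoconvex M\<close> p obtain W \<theta> where pW: "p \<in> W" and \<theta>: "contact_form_on M W \<theta>"
    and tr: "\<And>x. x \<in> M \<inter> W \<Longrightarrow> \<exists>X \<in> tangent_space M x. blinfun_apply (\<theta> x) X \<noteq> 0"
    and pos: "\<And>x v. x \<in> M \<inter> W \<Longrightarrow> v \<in> H10 M x \<Longrightarrow> qpair (\<theta> x) (levi_form M x v (cconj v)) \<in> \<real>\<^sub>\<ge>\<^sub>0"
    unfolding pseudoconvex_def by metis
  have W: "open W" "smooth_on W \<theta>" using \<theta> by (auto simp: contact_form_on_def)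
  have van: "\<forall>a\<in>complex_tangent_space M x. blinfun_apply (\<theta> x) a = 0" if "x \<in> M \<inter> W" for x
    using \<theta> that by (auto simp: contact_form_on_def)
  obtain X0 where X0: "dd r p X0 = 0" "blinfun_apply (\<theta> p) X0 \<noteq> 0"
    using tr[of p] p pW tangent_space_iff[OF p] by auto
  obtain n where n: "dd r p n \<noteq> 0" using ex_transversal[OF p] by blast
  obtain V1 \<xi> where \<xi>: "open V1" "p \<in> V1" "V1 \<subseteq> U" "smooth_on V1 \<xi>" "\<xi> p = X0" "\<forall>x\<in>V1. dd r x (\<xi> x) = 0"
    using tangent_field[OF p(2) n X0(1)] by blast
  \<comment> \<open>On the tangent space at \<open>x\<close> one has \<open>\<theta> = k (dr \<circ> J)\<close> for a number \<open>k\<close>, and \<open>\<mu> x\<close> is \<open>- k\<close> times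
    the square of \<open>dr (\<i> \<xi>)\<close>. It has the sign of \<open>- k\<close>, and its continuity is evident.\<close>
  define \<mu> where "\<mu> x = - (blinfun_apply (\<theta> x) (\<xi> x) * dd r x (\<i> *s \<xi> x))" for x
  have "\<mu> p \<noteq> 0"
    using contact_transversal[OF p van X0] X0(2) p pW by (simp add: \<mu>_def \<xi>(5))
  have "continuous_on (V1 \<inter> W) \<mu>"
  proof (rule continuous_at_imp_continuous_on, rule ballI)
    fix x assume x: "x \<in> V1 \<inter> W"
    then have "\<xi> differentiable (at x)" "x \<in> U"
      using smooth_on_differentiable[OF \<xi>(4)] \<xi>(3) by auto
    then have "\<mu> differentiable (at x)"
      unfolding \<mu>_def using x W
      by (intro differentiable_minus differentiable_mult differentiable_contact[of W] differentiable_dr_i) auto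
    then show "isCont \<mu> x"
      by (rule differentiable_imp_continuous_within)
  qed
  then have cont: "continuous_on (V1 \<inter> W) (\<lambda>x. \<mu> p * \<mu> x)"
    by (intro continuous_intros)
  define V where "V = (V1 \<inter> W) \<inter> (\<lambda>x. \<mu> p * \<mu> x) -` {0<..}"
  have "open V"
    unfolding V_def
    by (rule continuous_open_preimage[OF cont open_Int[OF \<xi>(1) W(1)] open_greaterThan])
  moreover have "p \<in> V"
    using \<xi>(2) pW \<open>\<mu> p \<noteq> 0\<close> by (auto simp: V_def zero_less_mult_iff linorder_neq_iff)
  moreover have "V \<subseteq> U" using \<xi>(3) by (auto simp: V_def)
  moreover have "0 \<le> \<mu> p * lev r x a a"
    if xV: "x \<in> V" and "r x = 0" and a: "dd r x a = 0" "dd r x (\<i> *s a) = 0" for x a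
  proof -
    have x: "x \<in> M" "x \<in> U" and xW: "x \<in> M \<inter> W" and xV1: "x \<in> V1"
      using that \<open>V \<subseteq> U\<close> zero_set by (auto simp: V_def)
    have H: "(a, - (\<i> *s a)) \<in> H10 M x" "(a, \<i> *s a) \<in> H01 M x"
      using a by (auto simp: H10_iff[OF x] H01_iff[OF x])
    obtain L2 where L2: "local_section M (H10 M) x L2" "L2 x = (a, - (\<i> *s a))"
      using section_through(2)[OF x H(1)] by blast
    obtain L1 where L1: "local_section M (H01 M) x L1" "L1 x = (a, \<i> *s a)"
      using section_through(3)[OF x H(2)] by blast
    define Z where "Z = bracket L2 L1 x"
    note Z = bracket_levi[OF x L2(1) L1(1), folded Z_def, unfolded L2 L1 fst_conv]
    obtain X where X: "X \<in> tangent_space M x" "blinfun_apply (\<theta> x) X \<noteq> 0"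
      using tr[OF xW] by blast
    have iZ: "cscale \<i> Z \<in> CT M x"
      using Z(1) by (simp add: CT_iff[OF x] cscale_def dr_linear_simps[OF x(2)])
    have "levi_form M x (a, - (\<i> *s a)) (cconj (a, - (\<i> *s a))) = coset M x (cscale \<i> Z)"
      using levi_form_eq_bracket[OF x \<theta> _ X L2(1) L1(1)] xW
      by (simp add: L2 L1 cconj_def Z_def)
    then have "qpair (\<theta> x) (levi_form M x (a, - (\<i> *s a)) (cconj (a, - (\<i> *s a)))) = \<i> * cpair (\<theta> x) Z"
      using qpair_coset[OF x van[OF xW] iZ] by (simp add: cpair_cscale)
    with pos[OF xW H(1)] have "\<i> * cpair (\<theta> x) Z \<in> \<real>\<^sub>\<ge>\<^sub>0"
      by simp
    then have neg: "blinfun_apply (\<theta> x) (snd Z) \<le> 0"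
      by (simp add: cpair_def complex_nonneg_Reals_iff)
    have "blinfun_apply (\<theta> x) (snd Z) * dd r x (\<i> *s \<xi> x) = blinfun_apply (\<theta> x) (\<xi> x) * (2 * lev r x a a)"
      using contact_proportional[OF x van[OF xW], of "snd Z" "\<xi> x"] Z \<xi>(6) xV1
      by (auto simp: CT_iff[OF x])
    then have "\<mu> x * (2 * lev r x a a) = - blinfun_apply (\<theta> x) (snd Z) * (dd r x (\<i> *s \<xi> x))\<^sup>2"
      unfolding \<mu>_def power2_eq_square by algebra
    then have "0 \<le> \<mu> x * (2 * lev r x a a)"
      using neg by (simp add: mult_nonpos_nonneg)
    moreover have "0 < \<mu> p * \<mu> x"
      using xV by (simp add: V_def)
    ultimately show ?thesis
      by (auto simp: zero_le_mult_iff zero_less_mult_iff)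
  qed
  ultimately show ?thesis
    using \<open>\<mu> p \<noteq> 0\<close> by blast
qed

text \<open>
  Here \<open>f\<close> is a multiple of \<open>l\<close> on \<open>M\<close>, and \<open>l\<close> vanishes at \<open>p\<close> to second order along \<open>X\<close>.
\<close>

lemma product_critical:
  fixes f h k l :: "complex ^ 'n \<Rightarrow> real"
  assumes p: "p \<in> M" "p \<in> U" and V: "open V" "p \<in> V"
    and d: "f differentiable (at p)" "h differentiable (at p)" "k differentiable (at p)" "l differentiable (at p)"
    and eq: "\<And>x. x \<in> M \<inter> V \<Longrightarrow> f x * h x = k x * l x"
    and l: "l p = 0" "dd l p X = 0" and "h p \<noteq> 0" and X: "dd r p X = 0"
  shows "f p = 0" and "dd f p X = 0"
proof -
  show fp: "f p = 0"
    using eq[of p] p V l(1) \<open>h p \<noteq> 0\<close> by auto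
  have "((\<lambda>x. f x * h x - k x * l x) has_derivative
      (\<lambda>v. (f p * dd h p v + dd f p v * h p) - (k p * dd l p v + dd k p v * l p))) (at p)"
    by (intro has_derivative_diff has_derivative_mult dd_has_derivative d)
  then have "(f p * dd h p X + dd f p X * h p) - (k p * dd l p X + dd k p X * l p) = 0"
    by (rule critical_on_M[OF p V _ _ _ X]) (use eq p V in auto)
  then show "dd f p X = 0"
    using fp l \<open>h p \<noteq> 0\<close> by simp
qed

text \<open>
  After multiplication by a nonvanishing differentiable function, the real and imaginary parts
  are multiples of \<open>lev r x a b\<close> and \<open>lev r x a (\<i> b)\<close>, where \<open>a\<close> and \<open>b\<close> are the fields underlying
  the two sections. As these lie in the Levi kernel at \<open>p\<close>, \<open>lev_critical_polar\<close> applies.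
\<close>

lemma cubic_critical:
  assumes "pseudoconvex M" and p: "p \<in> M" "p \<in> U"
    and L2: "local_section M (H10 M) p L2" "L2 p \<in> K10 M p"
    and L1: "local_section M (H01 M) p L1" "L1 p \<in> K01 M p"
    and \<theta>: "local_contact_form M p \<theta>" and X: "dd r p X = 0"
  shows "dd (\<lambda>x. cpair (\<theta> x) (bracket L2 L1 x)) p X = 0"
proof -
  obtain W' \<theta>' X0 where pW': "p \<in> W'" and \<theta>': "contact_form_on M W' \<theta>'"
    and X0: "X0 \<in> tangent_space M p" "blinfun_apply (\<theta>' p) X0 \<noteq> 0"
    using pseudoconvex_contact_form[OF assms(1) p(1)] by blast
  have X0': "dd r p X0 = 0" using X0(1) by (simp add: tangent_space_iff[OF p])
  have van': "\<forall>a\<in>complex_tangent_space M p. blinfun_apply (\<theta>' p) a = 0"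
    using \<theta>' p pW' by (auto simp: contact_form_on_def)
  note iX0 = contact_transversal[OF p van' X0' X0(2)]
  obtain n where n: "dd r p n \<noteq> 0" using ex_transversal[OF p] by blast
  obtain V1 \<xi> where \<xi>: "open V1" "p \<in> V1" "V1 \<subseteq> U" "smooth_on V1 \<xi>" "\<xi> p = X0" "\<forall>x\<in>V1. dd r x (\<xi> x) = 0"
    using tangent_field[OF p(2) n X0'] by blast
  obtain s V0 where s: "s \<noteq> 0" and V0: "open V0" "p \<in> V0" "V0 \<subseteq> U"
    and pos: "\<And>x a. x \<in> V0 \<Longrightarrow> r x = 0 \<Longrightarrow> dd r x a = 0 \<Longrightarrow> dd r x (\<i> *s a) = 0 \<Longrightarrow> 0 \<le> s * lev r x a a"
    using pseudoconvex_lev[OF assms(1) p] by blast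
  obtain W where W: "p \<in> W" "open W" "smooth_on W \<theta>"
    "\<And>x. x \<in> M \<inter> W \<Longrightarrow> \<forall>a\<in>complex_tangent_space M x. blinfun_apply (\<theta> x) a = 0"
    using \<theta> by (auto simp: local_contact_form_def contact_form_on_def)
  obtain W2 where W2: "open W2" "p \<in> W2" "smooth_on W2 L2" "\<And>x. x \<in> M \<inter> W2 \<Longrightarrow> L2 x \<in> H10 M x"
    using L2(1) by (auto simp: local_section_def)
  obtain W1 where W1: "open W1" "p \<in> W1" "smooth_on W1 L1" "\<And>x. x \<in> M \<inter> W1 \<Longrightarrow> L1 x \<in> H01 M x"
    using L1(1) by (auto simp: local_section_def)
  define V where "V = V0 \<inter> V1 \<inter> W \<inter> W1 \<inter> W2"
  have V: "open V" "p \<in> V" and VU: "V \<subseteq> U"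
    using V0 \<xi> W W1 W2 by (auto simp: V_def)
  have sub: "V \<subseteq> V0" "V \<subseteq> V1" "V \<subseteq> W" "V \<subseteq> W1" "V \<subseteq> W2" by (auto simp: V_def)
  have sm: "smooth_on V L2" "smooth_on V L1"
    using smooth_on_subset W1(3) W2(3) sub by blast+
  define a where "a x = fst (L2 x)" for x
  define b where "b x = fst (L1 x)" for x
  define Z where "Z x = bracket L2 L1 x" for x
  have da: "a differentiable (at p)" and db: "b differentiable (at p)" and dib: "(\<lambda>x. \<i> *s b x) differentiable (at p)"
    and d\<xi>: "\<xi> differentiable (at p)"
  proof -
    show "a differentiable (at p)"
      unfolding a_def by (rule differentiableI[OF has_derivative_fst[OF dd_has_derivative[OF smooth_on_differentiable[OF sm(1) V(2)]]]])
    show b: "b differentiable (at p)"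
      unfolding b_def by (rule differentiableI[OF has_derivative_fst[OF dd_has_derivative[OF smooth_on_differentiable[OF sm(2) V(2)]]]])
    show "(\<lambda>x. \<i> *s b x) differentiable (at p)"
      by (rule differentiableI[OF bounded_linear.has_derivative[OF bounded_linear_smult dd_has_derivative[OF b]]])
    show "\<xi> differentiable (at p)"
      by (rule smooth_on_differentiable[OF \<xi>(4,2)])
  qed
  have dZ: "Z differentiable (at p)"
    unfolding Z_def using differentiable_bracket[OF V sm] by simp
  have sect: "local_section M (H10 M) x L2" "local_section M (H01 M) x L1" if x: "x \<in> V" for x
  proof -
    show "local_section M (H10 M) x L2"
      unfolding local_section_def using W2(1,3,4) sub(5) x by (intro exI[of _ W2] conjI ballI) auto
    show "local_section M (H01 M) x L1"
      unfolding local_section_def using W1(1,3,4) sub(4) x by (intro exI[of _ W1] conjI ballI) auto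
  qed
  have inM: "x \<in> M" "x \<in> U" if "x \<in> V" "r x = 0" for x
    using that VU zero_set by auto
  have A: "dd r x (a x) = 0 \<and> dd r x (\<i> *s a x) = 0" and B: "dd r x (b x) = 0 \<and> dd r x (\<i> *s b x) = 0"
    if "x \<in> V" "r x = 0" for x
    using W1(4)[of x] W2(4)[of x] inM[OF that] sub that unfolding a_def b_def by (auto simp: H10_iff H01_iff)
  \<comment> \<open>The imaginary part of the Hermitian form pairs \<open>a\<close> with the rotated field \<open>\<i> b\<close>.\<close>
  have iB: "dd r x (\<i> *s b x) = 0 \<and> dd r x (\<i> *s (\<i> *s b x)) = 0" if "x \<in> V" "r x = 0" for x
    using B[OF that] inM[OF that] by (simp add: dr_linear_simps)
  have rp: "r p = 0" using r_eq_0[OF p] .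
  note K = K10_lev[OF p \<theta>' pW' X0]
  have Ka: "lev r p (a p) c = 0" if "dd r p c = 0" "dd r p (\<i> *s c) = 0" for c
    using K[OF L2(2) that] by (simp add: a_def)
  have "cconj (L1 p) \<in> K10 M p"
    using L1(2) by (auto simp: K01_def cconj_def)
  then have Kb: "lev r p (b p) c = 0" if "dd r p c = 0" "dd r p (\<i> *s c) = 0" for c
    using K[OF _ that] by (auto simp: b_def cconj_def)
  note Ap = A[OF V(2) rp] and Bp = B[OF V(2) rp] and iBp = iB[OF V(2) rp]
  have Kib: "lev r p (\<i> *s b p) (\<i> *s b p) = 0"
    using Kb Bp by (simp add: lev_i_i[OF p(2)])
  have posV: "0 \<le> s * lev r x a a" if "x \<in> V" "r x = 0" "dd r x a = 0" "dd r x (\<i> *s a) = 0" for x a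
    using pos[of x a] that sub by blast
  have crit1: "dd (\<lambda>x. lev r x (a x) (b x)) p X = 0"
    by (rule lev_critical_polar[OF V VU rp n s posV da A db B _ _ _ X]) (use Ka Kb Ap Bp in auto)
  have crit2: "dd (\<lambda>x. lev r x (a x) (\<i> *s b x)) p X = 0"
    by (rule lev_critical_polar[OF V VU rp n s posV da A dib iB _ _ _ X]) (use Ka Kib Ap iBp in auto)
  \<comment> \<open>By \<open>contact_proportional\<close>, \<open>k / h\<close> is the factor between \<open>\<theta>\<close> and \<open>dr \<circ> J\<close>.\<close>
  define h where "h x = dd r x (\<i> *s \<xi> x)" for x
  define k where "k x = blinfun_apply (\<theta> x) (\<xi> x)" for x
  have dh: "h differentiable (at p)"
    unfolding h_def by (rule differentiable_dr_i[OF p(2) d\<xi>])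
  have dk: "k differentiable (at p)"
    unfolding k_def by (rule differentiable_contact[OF W(2,1,3) d\<xi>])
  have hp: "h p \<noteq> 0" using iX0 by (simp add: h_def \<xi>(5))
  have dZ12: "(\<lambda>x. fst (Z x)) differentiable (at p)" "(\<lambda>x. snd (Z x)) differentiable (at p)"
    using dZ by (auto intro: differentiableI has_derivative_fst has_derivative_snd dd_has_derivative)
  define f1 where "f1 x = blinfun_apply (\<theta> x) (fst (Z x))" for x
  define f2 where "f2 x = blinfun_apply (\<theta> x) (snd (Z x))" for x
  have df1: "f1 differentiable (at p)" and df2: "f2 differentiable (at p)"
    unfolding f1_def f2_def by (intro differentiable_contact[OF W(2,1,3)] dZ12)+
  have eq: "f1 x * h x = k x * (- 2 * lev r x (a x) (\<i> *s b x))" "f2 x * h x = k x * (2 * lev r x (a x) (b x))"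
    if "x \<in> M \<inter> V" for x
  proof -
    have x: "x \<in> M" "x \<in> U" "x \<in> V" and xW: "x \<in> M \<inter> W" and xV1: "x \<in> V1"
      using that VU sub by auto
    note Zx = bracket_levi[OF x(1,2) sect[OF x(3)], folded Z_def a_def b_def]
    show "f1 x * h x = k x * (- 2 * lev r x (a x) (\<i> *s b x))"
      using contact_proportional[OF x(1,2) W(4)[OF xW], of "fst (Z x)" "\<xi> x"] Zx \<xi>(6) xV1
      by (simp add: CT_iff[OF x(1,2)] f1_def h_def k_def)
    show "f2 x * h x = k x * (2 * lev r x (a x) (b x))"
      using contact_proportional[OF x(1,2) W(4)[OF xW], of "snd (Z x)" "\<xi> x"] Zx \<xi>(6) xV1
      by (simp add: CT_iff[OF x(1,2)] f2_def h_def k_def)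
  qed
  have dl: "((\<lambda>x. c * lev r x (a x) (b' x)) has_derivative (\<lambda>v. c * dd (\<lambda>x. lev r x (a x) (b' x)) p v)) (at p)"
    if "b' differentiable (at p)" for c b'
    by (intro has_derivative_mult_right dd_has_derivative differentiable_lev_field p(2) da that)
  have levp: "lev r p (a p) (\<i> *s b p) = 0" "lev r p (a p) (b p) = 0"
    using Ka Bp iBp by blast+
  have l1: "- 2 * lev r p (a p) (\<i> *s b p) = 0" "dd (\<lambda>x. - 2 * lev r x (a x) (\<i> *s b x)) p X = 0"
    unfolding dd_eqI[OF dl[OF dib]] crit2 levp by simp_all
  have l2: "2 * lev r p (a p) (b p) = 0" "dd (\<lambda>x. 2 * lev r x (a x) (b x)) p X = 0"
    unfolding dd_eqI[OF dl[OF db]] crit1 levp by simp_all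
  have z1: "dd f1 p X = 0"
    by (rule product_critical(2)[OF p V df1 dh dk differentiableI[OF dl[OF dib]] _ l1 hp X]) (rule eq(1))
  have z2: "dd f2 p X = 0"
    by (rule product_critical(2)[OF p V df2 dh dk differentiableI[OF dl[OF db]] _ l2 hp X]) (rule eq(2))
  have D: "((\<lambda>x. f1 x *\<^sub>R 1 + f2 x *\<^sub>R \<i>) has_derivative (\<lambda>v. dd f1 p v *\<^sub>R 1 + dd f2 p v *\<^sub>R \<i>)) (at p)"
    by (intro has_derivative_add has_derivative_scaleR_left dd_has_derivative df1 df2)
  have feq: "(\<lambda>x. f1 x *\<^sub>R 1 + f2 x *\<^sub>R \<i>) = (\<lambda>x. cpair (\<theta> x) (bracket L2 L1 x))"
    by (simp add: fun_eq_iff complex_eq_iff cpair_def f1_def f2_def Z_def)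
  show ?thesis
    using dd_eqI[OF D[unfolded feq]] by (simp add: z1 z2)
qed

lemma cubic_tensor_vanishes:
  assumes "pseudoconvex M" and p: "p \<in> M" "p \<in> U"
    and v: "v3 \<in> CT M p" "v2 \<in> K10 M p" "v1 \<in> K01 M p"
  shows "cubic_tensor M p v3 v2 v1 = CH M p"
proof -
  obtain W' \<theta>' X0 where pW': "p \<in> W'" and \<theta>': "contact_form_on M W' \<theta>'"
    and X0: "X0 \<in> tangent_space M p" "blinfun_apply (\<theta>' p) X0 \<noteq> 0"
    using pseudoconvex_contact_form[OF assms(1) p(1)] by blast
  have X0': "dd r p X0 = 0" using X0(1) by (simp add: tangent_space_iff[OF p])
  have van: "\<forall>a\<in>complex_tangent_space M p. blinfun_apply (\<theta> p) a = 0" if "local_contact_form M p \<theta>" for \<theta>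
    using that p by (auto simp: local_contact_form_def contact_form_on_def)
  have lc: "local_contact_form M p \<theta>'"
    using \<theta>' pW' by (auto simp: local_contact_form_def)
  have vH: "v2 \<in> H10 M p" "v1 \<in> H01 M p"
    using v by (auto simp: K10_def K01_def H01_def)
  obtain L3 where L3: "local_section M (CT M) p L3" "L3 p = v3"
    using section_through(1)[OF p v(1)] by blast
  obtain L2 where L2: "local_section M (H10 M) p L2" "L2 p = v2"
    using section_through(2)[OF p vH(1)] by blast
  obtain L1 where L1: "local_section M (H01 M) p L1" "L1 p = v1"
    using section_through(3)[OF p vH(2)] by blast
  have t: "dd r p (fst v3) = 0" "dd r p (snd v3) = 0"
    using v(1) by (simp_all add: CT_iff[OF p])
  have zero: "cderiv v3 (\<lambda>x. cpair (\<theta> x) (bracket L2 L1 x)) p = 0"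
    if "local_section M (H10 M) p L2" "L2 p = v2" "local_section M (H01 M) p L1" "L1 p = v1"
      "local_contact_form M p \<theta>" for L2 L1 \<theta>
    unfolding cderiv_def
    using cubic_critical[OF assms(1) p that(1) _ that(3) _ that(5) t(1)]
      cubic_critical[OF assms(1) p that(1) _ that(3) _ that(5) t(2)] v that(2,4) by simp
  show ?thesis
    unfolding cubic_tensor_def CH_eq_coset[OF p]
  proof (rule the_coset[OF p van[OF lc] X0' X0(2) zero_in_CT[OF p]])
    show "\<forall>L3 L2 L1 \<theta>. local_section M (CT M) p L3 \<and> L3 p = v3 \<and> local_section M (H10 M) p L2 \<and> L2 p = v2 \<and>
       local_section M (H01 M) p L1 \<and> L1 p = v1 \<and> local_contact_form M p \<theta> \<longrightarrow>
       qpair (\<theta> p) (coset M p 0) = \<i> * cderiv (L3 p) (\<lambda>x. cpair (\<theta> x) (bracket L2 L1 x)) p"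
    proof (intro allI impI, elim conjE)
      fix L3 L2 L1 \<theta>
      assume *: "L3 p = v3" "local_section M (H10 M) p L2" "L2 p = v2" "local_section M (H01 M) p L1" "L1 p = v1"
      "local_contact_form M p \<theta>"
      show "qpair (\<theta> p) (coset M p 0) = \<i> * cderiv (L3 p) (\<lambda>x. cpair (\<theta> x) (bracket L2 L1 x)) p"
        unfolding *(1) zero[OF *(2-6)] qpair_coset[OF p van[OF *(6)] zero_in_CT[OF p]]
        by (simp add: cpair_def blinfun.zero_right Complex_eq_0)
    qed
  next
    fix c
    assume "\<forall>L3 L2 L1 \<theta>. local_section M (CT M) p L3 \<and> L3 p = v3 \<and> local_section M (H10 M) p L2 \<and> L2 p = v2 \<and>
       local_section M (H01 M) p L1 \<and> L1 p = v1 \<and> local_contact_form M p \<theta> \<longrightarrow>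
       qpair (\<theta> p) c = \<i> * cderiv (L3 p) (\<lambda>x. cpair (\<theta> x) (bracket L2 L1 x)) p"
    then have "qpair (\<theta>' p) c = \<i> * cderiv (L3 p) (\<lambda>x. cpair (\<theta>' x) (bracket L2 L1 x)) p"
      using L3 L2 L1 lc by blast
    then show "qpair (\<theta>' p) c = cpair (\<theta>' p) 0"
      unfolding L3(2) zero[OF L2 L1 lc] by (simp add: cpair_def blinfun.zero_right Complex_eq_0)
  qed
qed

lemma CK_subset_CT:
  assumes p: "p \<in> M" "p \<in> U"
  shows "CK M p \<subseteq> CT M p"
proof -
  have "v + cconj u \<in> CT M p" if "v \<in> H10 M p" "u \<in> H10 M p" for v u
    using that by (simp add: H10_iff[OF p] CT_iff[OF p] cconj_def dr_linear_simps[OF p(2)])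
  then show ?thesis
    unfolding CK_def K01_def K10_def by blast
qed

end

section \<open>Holomorphic changes of coordinates\<close>

lemma dd_compose_holomorphic:
  assumes F: "holomorphic_map_on U F" and \<rho>: "smooth_function T \<rho>" and FT: "F ` U \<subseteq> T" and x: "x \<in> U"
  shows "((\<lambda>y. \<rho> (F y)) has_derivative (\<lambda>h. dd \<rho> (F x) (dd F x h))) (at x)"
proof -
  interpret smooth_function T \<rho> by (rule \<rho>)
  have "(F has_derivative dd F x) (at x)"
    using F x by (simp add: holomorphic_map_on_iff dd_has_derivative)
  moreover have "(\<rho> has_derivative dd \<rho> (F x)) (at (F x))"
    using FT x by (intro has_derivative_r) auto
  ultimately show ?thesis
    using diff_chain_at[of F "dd F x" x \<rho> "dd \<rho> (F x)"] by (simp add: o_def)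
qed

text \<open>
  The chain rule for the Hessian contains the second derivative of \<open>F\<close>. It is complex bilinear,
  so its contributions from \<open>(a, a)\<close> and \<open>(\<i> a, \<i> a)\<close> cancel.
\<close>

lemma lev_compose_holomorphic:
  assumes F: "holomorphic_map_on U F" and \<rho>: "smooth_function T \<rho>" and FT: "F ` U \<subseteq> T" and x: "x \<in> U"
  shows "lev (\<lambda>y. \<rho> (F y)) x a a = lev \<rho> (F x) (dd F x a) (dd F x a)"
proof -
  interpret smooth_function T \<rho> by (rule \<rho>)
  have U: "open U" using F by (simp add: holomorphic_map_on_def)
  have FxT: "F y \<in> T" if "y \<in> U" for y using FT that by auto
  have dF: "(F has_derivative dd F y) (at y)" "dd F y (c *s v) = c *s dd F y v" if "y \<in> U" for y c v
    using F that by (simp_all add: holomorphic_map_on_iff dd_has_derivative)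
  have ddF: "((\<lambda>y. dd F y v) has_derivative dd (\<lambda>y. dd F y v) x) (at x)"
    "dd (\<lambda>y. dd F y v) x (c *s w) = c *s dd (\<lambda>y. dd F y v) x w" for v c w
    using holomorphic_map_on_dd[OF F, of v] x by (simp_all add: holomorphic_map_on_iff dd_has_derivative)
  have h: "hess (\<lambda>y. \<rho> (F y)) x a b =
      hess \<rho> (F x) (dd F x a) (dd F x b) + dd \<rho> (F x) (dd (\<lambda>y. dd F y a) x b)" for a b
  proof -
    have inner: "((\<lambda>y. dd \<rho> (F y) v) has_derivative (\<lambda>h. hess \<rho> (F x) v (dd F x h))) (at x)" for v
    proof -
      have "((\<lambda>z. dd \<rho> z v) has_derivative hess \<rho> (F x) v) (at (F x))"
        unfolding hess_def
        by (rule dd_has_derivative[OF smooth_on_differentiable[OF smooth_on_dd[OF smooth] FxT[OF x]]])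
      then show ?thesis
        using diff_chain_at[OF dF(1)[OF x], of "\<lambda>z. dd \<rho> z v"] by (simp add: o_def)
    qed
    have "((\<lambda>y. dd \<rho> (F y) (dd F y a)) has_derivative
        (\<lambda>h. dd (\<lambda>y. dd \<rho> (F y) (dd F x a)) x h + dd \<rho> (F x) (dd (\<lambda>y. dd F y a) x h))) (at x)"
      by (rule has_derivative_linear_family[OF U x linear_dr[OF FxT] differentiableI[OF inner] ddF(1)])
    then have "((\<lambda>y. dd (\<lambda>y. \<rho> (F y)) y a) has_derivative
        (\<lambda>h. dd (\<lambda>y. dd \<rho> (F y) (dd F x a)) x h + dd \<rho> (F x) (dd (\<lambda>y. dd F y a) x h))) (at x)"
      by (rule has_derivative_transform_within_open[OF _ U x])
        (simp add: dd_eqI[OF dd_compose_holomorphic[OF F \<rho> FT]])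
    from dd_eqI[OF this] show ?thesis
      unfolding hess_def[of "\<lambda>y. \<rho> (F y)"] dd_eqI[OF inner] by simp
  qed
  have "((\<lambda>y. \<i> *s dd F y a) has_derivative (\<lambda>h. \<i> *s dd (\<lambda>y. dd F y a) x h)) (at x)"
    by (rule bounded_linear.has_derivative[OF bounded_linear_smult ddF(1)])
  then have "((\<lambda>y. dd F y (\<i> *s a)) has_derivative (\<lambda>h. \<i> *s dd (\<lambda>y. dd F y a) x h)) (at x)"
    by (rule has_derivative_transform_within_open[OF _ U x]) (simp add: dF(2))
  from dd_eqI[OF this] have "dd (\<lambda>y. dd F y (\<i> *s a)) x (\<i> *s a) = - dd (\<lambda>y. dd F y a) x a"
    by (simp add: ddF(2))
  then show ?thesis
    by (simp add: lev_def h dF(2)[OF x] dr_linear_simps[OF FxT[OF x]])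
qed

text \<open>
  The function \<open>\<rho> \<circ> F\<close> defines \<open>M\<close> near \<open>p\<close>, so its complex Hessian has a sign on complex tangent
  vectors. The sign is carried over to \<open>\<rho>\<close> in the coordinates, where \<open>lev_critical\<close> is applied
  to an extension of \<open>a\<close> to a complex tangent field; the extension does not influence the
  derivative because \<open>a\<close> is a null vector.
\<close>

lemma chart_levi_critical:
  fixes F :: "complex ^ 'n::finite \<Rightarrow> complex ^ 'n"
  assumes "pseudoconvex M" and p: "p \<in> M" "p \<in> U"
    and chart: "holomorphic_chart U F" and \<rho>: "smooth_function (F ` U) \<rho>"
    and zero: "\<And>x. x \<in> U \<Longrightarrow> x \<in> M \<longleftrightarrow> \<rho> (F x) = 0"
    and n: "dd \<rho> (F p) n \<noteq> 0" and a: "dd \<rho> (F p) a = 0" "dd \<rho> (F p) (\<i> *s a) = 0"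
    and null: "\<And>b. lev \<rho> (F p) a b = 0" and X: "dd \<rho> (F p) X = 0"
  shows "dd (\<lambda>y. lev \<rho> y a a) (F p) X = 0"
proof -
  interpret rho: smooth_function "F ` U" \<rho> by (rule \<rho>)
  define G where "G = the_inv_into U F"
  have F: "holomorphic_map_on U F" and inj: "inj_on F U" and G: "holomorphic_map_on (F ` U) G"
    using chart by (auto simp: holomorphic_chart_def G_def)
  have U: "open U" using F by (simp add: holomorphic_map_on_def)
  have GF: "G (F x) = x" if "x \<in> U" for x
    using the_inv_into_f_f[OF inj that] by (simp add: G_def)
  have dF: "(F has_derivative dd F x) (at x)" "dd F x (c *s v) = c *s dd F x v" if "x \<in> U" for x c v
    using F that by (simp_all add: holomorphic_map_on_iff dd_has_derivative)
  have dG: "(G has_derivative dd G z) (at z)" if "z \<in> F ` U" for z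
    using G that unfolding holomorphic_map_on_iff by (blast intro: dd_has_derivative)
  have inv: "dd F x (dd G (F x) v) = v" if x: "x \<in> U" for x v
  proof -
    have "(F \<circ> G has_derivative dd F (G (F x)) \<circ> dd G (F x)) (at (F x))"
      using dG[of "F x"] dF(1)[OF x] x by (intro diff_chain_at) (auto simp: GF)
    then have "((\<lambda>z. z) has_derivative dd F x \<circ> dd G (F x)) (at (F x))"
      unfolding GF[OF x]
      by (rule has_derivative_transform_within_open[OF _ rho.open_domain]) (use x GF in auto)
    then have "dd F x \<circ> dd G (F x) = (\<lambda>v. v)"
      using has_derivative_unique has_derivative_ident by blast
    then show ?thesis by (simp add: fun_eq_iff)
  qed
  define r where "r x = \<rho> (F x)" for x
  have dr: "(r has_derivative (\<lambda>h. dd \<rho> (F x) (dd F x h))) (at x)" if "x \<in> U" for x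
    unfolding r_def by (rule dd_compose_holomorphic[OF F \<rho> subset_refl that])
  have smr: "smooth_on U r"
    unfolding smooth_on_def r_def
    using Ck_on_compose[OF U rho.open_domain smooth_onD[OF rho.smooth] smooth_onD[OF holomorphic_map_on_smooth[OF F]]]
    by blast
  \<comment> \<open>The differential of \<open>r\<close> is nonzero on the preimage \<open>m\<close> of \<open>n\<close> at \<open>p\<close>, hence near \<open>p\<close>.\<close>
  define m where "m = dd G (F p) n"
  define U0 where "U0 = U \<inter> (\<lambda>x. dd r x m) -` (- {0})"
  have U0: "open U0"
    unfolding U0_def
    by (rule continuous_open_preimage[OF smooth_on_continuous[OF smooth_on_dd[OF smr]] U]) auto
  have U0U: "U0 \<subseteq> U" by (auto simp: U0_def)
  have pU0: "p \<in> U0"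
    using p n by (simp add: U0_def dd_eqI[OF dr] m_def inv)
  interpret r: hypersurface_patch U0 r M
  proof
    show "smooth_on U0 r" by (rule smooth_on_subset[OF smr U0U])
    show "M \<inter> U0 = {x \<in> U0. r x = 0}" using zero U0U by (auto simp: r_def)
    show "dd r x \<noteq> (\<lambda>v. 0)" if "x \<in> M \<inter> U0" for x
      using that unfolding U0_def by (metis (mono_tags) ComplD IntD2 singletonI vimageD)
  qed (rule U0)
  obtain s V where s: "s \<noteq> 0" and V: "open V" "p \<in> V" "V \<subseteq> U0"
    and pos: "\<forall>x\<in>V. r x = 0 \<longrightarrow> (\<forall>a. dd r x a = 0 \<and> dd r x (\<i> *s a) = 0 \<longrightarrow> 0 \<le> s * lev r x a a)"
    using r.pseudoconvex_lev[OF assms(1) p(1) pU0] by blast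
  define V' where "V' = (F ` U) \<inter> G -` V"
  have "continuous_on (F ` U) G"
    by (rule smooth_on_continuous[OF holomorphic_map_on_smooth[OF G]])
  then have V': "open V'"
    unfolding V'_def by (rule continuous_open_preimage[OF _ rho.open_domain V(1)])
  have pV': "F p \<in> V'" using p V by (simp add: V'_def GF)
  have sub: "V' \<subseteq> F ` U" by (auto simp: V'_def)
  have pos': "0 \<le> s * lev \<rho> z A A"
    if z: "z \<in> V'" "\<rho> z = 0" and A: "dd \<rho> z A = 0" "dd \<rho> z (\<i> *s A) = 0" for z A
  proof -
    obtain x where x: "x \<in> U" "z = F x" using z by (auto simp: V'_def)
    have xV: "x \<in> V" using z x by (simp add: V'_def GF)
    define v where "v = dd G (F x) A"
    have v: "dd F x v = A" by (simp add: v_def inv[OF x(1)])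
    have "r x = 0" "dd r x v = 0" "dd r x (\<i> *s v) = 0"
      using z A x by (simp_all add: r_def dd_eqI[OF dr] v dF(2))
    then have "0 \<le> s * lev r x v v"
      using pos xV by blast
    also have "lev r x v v = lev \<rho> z A A"
      unfolding r_def using lev_compose_holomorphic[OF F \<rho> subset_refl x(1), of v] by (simp add: v x(2))
    finally show ?thesis .
  qed
  have FpU: "F p \<in> F ` U" using p by auto
  have \<rho>p: "\<rho> (F p) = 0" using zero p by auto
  obtain W A where W: "open W" "F p \<in> W" "W \<subseteq> F ` U" "smooth_on W A" "A (F p) = a"
    "\<forall>x\<in>W. dd \<rho> x (A x) = 0 \<and> dd \<rho> x (\<i> *s A x) = 0"
    using rho.holomorphic_tangent_field[OF FpU n a] by blast
  have dA: "A differentiable (at (F p))"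
    by (rule smooth_on_differentiable[OF W(4,2)])
  have "dd (\<lambda>x. lev \<rho> x (A x) (A x)) (F p) X = 0"
  proof (rule rho.lev_critical[OF _ _ _ \<rho>p n s])
    show "open (V' \<inter> W)" "F p \<in> V' \<inter> W" "V' \<inter> W \<subseteq> F ` U"
      using V' pV' W sub by auto
    show "0 \<le> s * lev \<rho> x a a"
      if "x \<in> V' \<inter> W" "\<rho> x = 0" "dd \<rho> x a = 0" "dd \<rho> x (\<i> *s a) = 0" for x a
      using pos' that by blast
    show "dd \<rho> x (A x) = 0 \<and> dd \<rho> x (\<i> *s A x) = 0" if "x \<in> V' \<inter> W" for x
      using W(6) that by blast
    show "lev \<rho> (F p) (A (F p)) (A (F p)) = 0" using null W(5) by simp
  qed (use dA X in auto)
  then show ?thesis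
    using rho.dd_lev_field[OF FpU dA, of X] null W(5) by simp
qed

section \<open>Third order jets\<close>

lemma diff3_sum: "diff3 (\<lambda>x. \<Sum>i\<in>I. f i x) x a b c = (\<Sum>i\<in>I. diff3 (f i) x a b c)"
  by (simp add: diff3_def diff2_def sum.distrib sum_subtractf)

lemma diff3_add: "diff3 (\<lambda>x. f x + g x) x a b c = diff3 f x a b c + diff3 g x a b c"
  by (simp add: diff3_def diff2_def)

lemma diff3_cmult: "diff3 (\<lambda>x. k * f x) x a b c = k * diff3 f x a b (c :: 'a::ab_group_add)"
  for k :: "'b::comm_ring_1"
  by (simp add: diff3_def diff2_def algebra_simps)

lemma diff3_Re: "diff3 (\<lambda>x. Re (f x)) x a b c = Re (diff3 f x a b c)"
  by (simp add: diff3_def diff2_def)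

text \<open>
  The function \<open>f\<close> agrees with \<open>l + q + c\<close> to third order along every ray, with one
  coefficient for each power of \<open>t\<close>. Vanishing third differences express that \<open>q\<close> is quadratic.
\<close>

locale cubic_jet =
  fixes f :: "'a::real_normed_vector \<Rightarrow> real" and S and l q c :: "'a \<Rightarrow> real"
  assumes open_S: "open S" and zero_S: "0 \<in> S" and C3: "Ck_on 3 S f"
    and l: "linear l" and q: "\<And>a b c. diff3 q 0 a b c = 0" 
    and jet: "\<And>x. \<exists>K. \<forall>\<^sub>F t in at_right 0. \<bar>f (t *\<^sub>R x) - (t * l x + t\<^sup>2 * q x + t^3 * c x)\<bar> \<le> K * t^4"
begin

lemma remainder: "((\<lambda>t. (f (t *\<^sub>R x) - (t * l x + t\<^sup>2 * q x + t^3 * c x)) / t^3) \<longlongrightarrow> 0) (at_right 0)"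
proof -
  obtain K where K: "\<forall>\<^sub>F t in at_right 0. \<bar>f (t *\<^sub>R x) - (t * l x + t\<^sup>2 * q x + t^3 * c x)\<bar> \<le> K * t^4"
    using jet by blast
  have "((\<lambda>t. K * t) \<longlongrightarrow> K * 0) (at_right 0)"
    by (intro tendsto_intros)
  then have lim: "((\<lambda>t. K * t) \<longlongrightarrow> 0) (at_right 0)"
    by simp
  have "\<forall>\<^sub>F t in at_right 0. norm ((f (t *\<^sub>R x) - (t * l x + t\<^sup>2 * q x + t^3 * c x)) / t^3) \<le> K * t"
    using K eventually_at_right_less[of 0]
  proof eventually_elim
    case (elim t)
    then have "\<bar>f (t *\<^sub>R x) - (t * l x + t\<^sup>2 * q x + t^3 * c x)\<bar> / t^3 \<le> K * t^4 / t^3"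
      by (intro divide_right_mono) auto
    also have "\<dots> = K * t"
      using elim(2) by (simp add: power4_eq_xxxx power3_eq_cube)
    finally show ?case
      using elim(2) by simp
  qed
  then show ?thesis
    by (rule Lim_null_comparison[OF _ lim])
qed

text \<open>
  Any difference of \<open>f\<close> at the origin is a combination of values along rays, so its leading term
  can be found from limits along rays.
\<close>

lemma third_limit: "((\<lambda>t. (f (t *\<^sub>R x) - t * l x - t\<^sup>2 * q x) / t^3) \<longlongrightarrow> c x) (at_right 0)"
proof -
  have "((\<lambda>t. (f (t *\<^sub>R x) - (t * l x + t\<^sup>2 * q x + t^3 * c x)) / t^3 + c x) \<longlongrightarrow> 0 + c x) (at_right 0)"
    by (intro tendsto_add remainder tendsto_const)
  moreover have "\<forall>\<^sub>F t in at_right 0. (f (t *\<^sub>R x) - (t * l x + t\<^sup>2 * q x + t^3 * c x)) / t^3 + c x =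
      (f (t *\<^sub>R x) - t * l x - t\<^sup>2 * q x) / t^3"
    using eventually_at_right_less[of 0] by eventually_elim (simp add: field_simps)
  ultimately show ?thesis
    by (simp add: tendsto_cong)
qed

lemma second_limit: "((\<lambda>t. (f (t *\<^sub>R x) - t * l x) / t\<^sup>2) \<longlongrightarrow> q x) (at_right 0)"
proof -
  have "((\<lambda>t. t * ((f (t *\<^sub>R x) - t * l x - t\<^sup>2 * q x) / t^3) + q x) \<longlongrightarrow> 0 * c x + q x) (at_right 0)"
    by (intro tendsto_intros third_limit)
  moreover have "\<forall>\<^sub>F t in at_right 0. t * ((f (t *\<^sub>R x) - t * l x - t\<^sup>2 * q x) / t^3) + q x =
      (f (t *\<^sub>R x) - t * l x) / t\<^sup>2"
    using eventually_at_right_less[of 0]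
    by eventually_elim (simp add: field_simps power2_eq_square power3_eq_cube)
  ultimately show ?thesis
    by (simp add: tendsto_cong)
qed

lemma first_limit: "((\<lambda>t. f (t *\<^sub>R x) / t) \<longlongrightarrow> l x) (at_right 0)"
proof -
  have "((\<lambda>t. t * ((f (t *\<^sub>R x) - t * l x) / t\<^sup>2) + l x) \<longlongrightarrow> 0 * q x + l x) (at_right 0)"
    by (intro tendsto_intros second_limit)
  moreover have "\<forall>\<^sub>F t in at_right 0. t * ((f (t *\<^sub>R x) - t * l x) / t\<^sup>2) + l x = f (t *\<^sub>R x) / t"
    using eventually_at_right_less[of 0] by eventually_elim (simp add: field_simps power2_eq_square)
  ultimately show ?thesis
    by (simp add: tendsto_cong)
qed

lemma value_at_0: "f 0 = 0"
proof -
  have "((\<lambda>t. t * (f (t *\<^sub>R 0) / t)) \<longlongrightarrow> 0 * l 0) (at_right 0)"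
    by (intro tendsto_intros first_limit)
  moreover have "\<forall>\<^sub>F t in at_right 0. t * (f (t *\<^sub>R 0) / t) = f 0"
    using eventually_at_right_less[of 0] by eventually_elim simp
  ultimately have lim: "((\<lambda>t :: real. f 0) \<longlongrightarrow> 0) (at_right 0)"
    by (simp add: tendsto_cong)
  show ?thesis
    by (rule tendsto_unique[OF trivial_limit_at_right_real tendsto_const lim])
qed

lemma first_derivative: "dd f 0 a = l a"
proof -
  have "f differentiable (at 0)"
    using C3 zero_S by (simp add: numeral_3_eq_3)
  then have D: "(f has_derivative dd f 0) (at 0)"
    by (rule dd_has_derivative)
  have "((\<lambda>t. t *\<^sub>R a) has_derivative (\<lambda>t. t *\<^sub>R a)) (at (0::real))"
    by (auto intro!: derivative_eq_intros)
  then have "((\<lambda>t. f (t *\<^sub>R a)) has_derivative (\<lambda>t. dd f 0 (t *\<^sub>R a))) (at 0)"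
    using diff_chain_at[of "\<lambda>t. t *\<^sub>R a" "\<lambda>t. t *\<^sub>R a" 0 f "dd f 0"] D by (simp add: o_def)
  moreover have "(\<lambda>t. dd f 0 (t *\<^sub>R a)) = (*) (dd f 0 a)"
    using has_derivative_linear[OF D] by (simp add: fun_eq_iff linear_scale)
  ultimately have "((\<lambda>t. f (t *\<^sub>R a)) has_field_derivative dd f 0 a) (at 0)"
    by (simp add: has_field_derivative_def)
  then have "((\<lambda>t. f (t *\<^sub>R a) / t) \<longlongrightarrow> dd f 0 a) (at 0)"
    by (simp add: has_field_derivative_iff value_at_0)
  then have "((\<lambda>t. f (t *\<^sub>R a) / t) \<longlongrightarrow> dd f 0 a) (at_right 0)"
    by (rule tendsto_within_subset) simp
  then show ?thesis
    using tendsto_unique[OF _ _ first_limit] by (simp add: trivial_limit_at_right_real)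
qed

lemma second_derivative: "hess f 0 a b = diff2 q 0 a b"
proof -
  note la = linear_add[OF l] linear_0[OF l]
  have "((\<lambda>t. diff2 f 0 (t *\<^sub>R b) (t *\<^sub>R a) / t\<^sup>2) \<longlongrightarrow> hess f 0 a b) (at_right 0)"
    unfolding hess_def
    by (rule diff2_tendsto[OF open_S zero_S Ck_on_mono[OF _ C3]]) simp
  moreover have "((\<lambda>t. diff2 f 0 (t *\<^sub>R b) (t *\<^sub>R a) / t\<^sup>2) \<longlongrightarrow> diff2 q 0 a b) (at_right 0)"
  proof -
    let ?e = "\<lambda>x t. (f (t *\<^sub>R x) - t * l x) / t\<^sup>2"
    have "((\<lambda>t. ?e (a + b) t - ?e a t - ?e b t + ?e 0 t) \<longlongrightarrow> q (a + b) - q a - q b + q 0) (at_right 0)"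
      by (intro tendsto_intros second_limit)
    moreover have "?e (a + b) t - ?e a t - ?e b t + ?e 0 t = diff2 f 0 (t *\<^sub>R b) (t *\<^sub>R a) / t\<^sup>2" for t
      by (simp add: diff2_def la scaleR_add_right add_divide_distrib diff_divide_distrib algebra_simps)
    ultimately show ?thesis
      by (simp add: diff2_def)
  qed
  ultimately show ?thesis
    using tendsto_unique[of "at_right (0::real)"] by (simp add: trivial_limit_at_right_real)
qed

lemma third_derivative: "dd (\<lambda>y. hess f y d b) 0 a = diff3 c 0 a b d"
proof -
  note la = linear_add[OF l] linear_0[OF l]
  have "((\<lambda>t. diff3 f 0 (t *\<^sub>R a) (t *\<^sub>R b) (t *\<^sub>R d) / t^3) \<longlongrightarrow> dd (\<lambda>y. hess f y d b) 0 a) (at_right 0)"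
    unfolding hess_def by (rule diff3_tendsto[OF open_S zero_S C3])
  moreover have "((\<lambda>t. diff3 f 0 (t *\<^sub>R a) (t *\<^sub>R b) (t *\<^sub>R d) / t^3) \<longlongrightarrow> diff3 c 0 a b d) (at_right 0)"
  proof -
    let ?e = "\<lambda>x t. (f (t *\<^sub>R x) - t * l x - t\<^sup>2 * q x) / t^3"
    have "((\<lambda>t. (?e (d + a + b) t - ?e (d + a) t - ?e (d + b) t + ?e d t) - (?e (a + b) t - ?e a t - ?e b t + ?e 0 t))
       \<longlongrightarrow> (c (d + a + b) - c (d + a) - c (d + b) + c d) - (c (a + b) - c a - c b + c 0)) (at_right 0)"
      by (intro tendsto_intros third_limit)
    moreover have "(?e (d + a + b) t - ?e (d + a) t - ?e (d + b) t + ?e d t) - (?e (a + b) t - ?e a t - ?e b t + ?e 0 t)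
        = diff3 f 0 (t *\<^sub>R a) (t *\<^sub>R b) (t *\<^sub>R d) / t^3" for t
    proof -
      have "(q (d + a + b) - q (d + a) - q (d + b) + q d) - (q (a + b) - q a - q b + q 0) = 0"
        using q[of a b d] by (simp add: diff3_def diff2_def)
      then have "t\<^sup>2 * q (d + a + b) = t\<^sup>2 * (q (d + a) + q (d + b) - q d + (q (a + b) - q a - q b + q 0))"
        by simp
      then have "diff3 f 0 (t *\<^sub>R a) (t *\<^sub>R b) (t *\<^sub>R d) =
        ((f (t *\<^sub>R (d + a + b)) - t * l (d + a + b) - t\<^sup>2 * q (d + a + b))
        - (f (t *\<^sub>R (d + a)) - t * l (d + a) - t\<^sup>2 * q (d + a))
        - (f (t *\<^sub>R (d + b)) - t * l (d + b) - t\<^sup>2 * q (d + b))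
        + (f (t *\<^sub>R d) - t * l d - t\<^sup>2 * q d))
        - ((f (t *\<^sub>R (a + b)) - t * l (a + b) - t\<^sup>2 * q (a + b))
        - (f (t *\<^sub>R a) - t * l a - t\<^sup>2 * q a)
        - (f (t *\<^sub>R b) - t * l b - t\<^sup>2 * q b)
        + (f (t *\<^sub>R 0) - t * l 0 - t\<^sup>2 * q 0))"
        by (simp add: diff3_def diff2_def la scaleR_add_right algebra_simps)
      then show ?thesis
        by (simp only: add_divide_distrib diff_divide_distrib)
    qed
    ultimately show ?thesis
      by (simp add: diff3_def diff2_def)
  qed
  ultimately show ?thesis
    using tendsto_unique[of "at_right (0::real)"] by (simp add: trivial_limit_at_right_real)
qed

end

lemma diff2_sum: "diff2 (\<lambda>x. \<Sum>i\<in>I. f i x) x a b = (\<Sum>i\<in>I. diff2 (f i) x a b)"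
  by (simp add: diff2_def sum.distrib sum_subtractf)

lemma diff2_cmult: "diff2 (\<lambda>x. k * f x) x a b = k * diff2 f x a (b :: 'a::ab_group_add)"
  for k :: "'b::comm_ring_1"
  by (simp add: diff2_def algebra_simps)

text \<open>
  If \<open>f\<close> is the cubic part of the jet of a function \<open>\<rho>\<close>, this is the derivative of
  \<open>y \<mapsto> lev \<rho> y a a\<close> at the origin in the direction \<open>X\<close>, by \<open>cubic_jet.third_derivative\<close>.
\<close>

definition levi3 :: "(complex ^ 'n::finite \<Rightarrow> 'b::ab_group_add) \<Rightarrow> complex ^ 'n \<Rightarrow> complex ^ 'n \<Rightarrow> 'b" where
  "levi3 f X a = diff3 f 0 X a a + diff3 f 0 X (\<i> *s a) (\<i> *s a)"

lemma levi3_sum: "levi3 (\<lambda>x. \<Sum>i\<in>I. f i x) X a = (\<Sum>i\<in>I. levi3 (f i) X a)"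
  by (simp add: levi3_def diff3_sum sum.distrib)

lemma levi3_add: "levi3 (\<lambda>x. f x + g x) X a = levi3 f X a + levi3 g X a"
  by (simp add: levi3_def diff3_add)

lemma levi3_cmult: "levi3 (\<lambda>x. k * f x) X a = k * levi3 f X a"
  for k :: "'b::comm_ring_1"
  by (simp add: levi3_def diff3_cmult distrib_left)

lemma levi3_Re: "levi3 (\<lambda>x. Re (f x)) X a = Re (levi3 f X a)"
  by (simp add: levi3_def diff3_Re)

text \<open>
  Only the terms with \<open>a\<close> in one holomorphic and in the antiholomorphic factor survive; the terms
  \<open>a\<^sub>j a\<^sub>k cnj (X\<^sub>l)\<close> cancel against those of \<open>\<i> a\<close>.
\<close>

lemma levi3_monomial:
  "levi3 (\<lambda>z. z $ j * z $ k * cnj (z $ l)) X a = 4 * ((X $ j * a $ k + a $ j * X $ k) * cnj (a $ l))"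
  by (simp add: levi3_def diff3_def diff2_def algebra_simps)

lemma cmod_sq: "(cmod z)\<^sup>2 = Re z * Re z + Im z * Im z"
  unfolding cmod_power2 by (simp add: power2_eq_square)

lemma diff3_norm_square: "diff3 (\<lambda>z. (cmod (z $ j))\<^sup>2) 0 a b c = 0"
  by (simp add: diff3_def diff2_def cmod_sq algebra_simps)

lemma diff2_norm_square: "a $ j = 0 \<Longrightarrow> diff2 (\<lambda>z. (cmod (z $ j))\<^sup>2) 0 a b = 0"
  by (simp add: diff2_def)

lemma levi3_norm_square_linear:
  assumes "linear u" "u a = 0" "u (\<i> *s a) = 0"
  shows "levi3 (\<lambda>z. (cmod (z $ j))\<^sup>2 * u z) X a = 4 * (cmod (a $ j))\<^sup>2 * u X"
  unfolding levi3_def diff3_def diff2_def linear_add[OF assms(1)] linear_0[OF assms(1)] assms(2,3)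
  by (simp add: cmod_sq algebra_simps)

section \<open>The cubic normal form\<close>

text \<open>
  For \<open>a\<close> in the \<open>z\<^sub>3\<close> space, which is the Levi kernel at the origin, \<open>levi3\<close> of the cubic part
  vanishes in all tangential directions \<open>X\<close>. The three groups of unwanted terms are isolated
  by taking \<open>a\<close> to be the \<open>z\<^sub>3\<close> part of \<open>z\<close> and \<open>X\<close> to be its \<open>z\<^sub>2\<close> part, its \<open>z\<^sub>3\<close> part, or
  the direction of \<open>u\<close>.
\<close>

lemma cubic_normal_form_vanishing:
  fixes M :: "(complex ^ 'n::finite) set"
  assumes pc: "pseudoconvex M" and p: "p \<in> M"
    and nf: "cubic_normal_form M p q U F k0 I2 \<phi> \<phi>21 \<phi>111"
  shows "(\<exists>c. \<forall>z. \<phi>21 z =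
            (\<Sum>j\<in>I2. \<Sum>k\<in>I2. \<Sum>l\<in>- insert k0 I2. c j k l * z $ j * z $ k * cnj (z $ l)))
         \<and> (\<forall>z u. \<phi>111 z u = 0)"
proof -
  define I3 where "I3 = - insert k0 I2"
  have pU: "p \<in> U" and chart: "holomorphic_chart U F" and Fp: "F p = 0" and k0: "k0 \<notin> I2" "k0 \<notin> I3"
    using nf by (auto simp: cubic_normal_form_def I3_def)
  define u where "u \<zeta> = Re (\<i> * (\<zeta> $ k0 - cnj (\<zeta> $ k0)))" for \<zeta> :: "complex ^ 'n"
  have u: "u \<zeta> = - 2 * Im (\<zeta> $ k0)" for \<zeta>
    by (simp add: u_def)
  have u_lin: "linear u"
    by (rule linearI) (simp_all add: u)
  define L where "L \<zeta> = (zpart k0 \<zeta>, u \<zeta>)" for \<zeta>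
  have z_lin: "linear (zpart k0 :: complex ^ 'n \<Rightarrow> _)"
    by (rule linearI) (auto simp: zpart_def vec_eq_iff)
  have L_lin: "bounded_linear L"
    unfolding L_def
    by (intro bounded_linear_Pair) (use z_lin u_lin in \<open>auto simp: linear_conv_bounded_linear\<close>)
  have graph: "graph_in_chart M U F k0 \<phi>"
    using nf by (simp add: cubic_normal_form_def)
  then obtain N where N: "open N" "0 \<in> N" "smooth_on N \<phi>" "\<And>\<zeta>. \<zeta> \<in> F ` U \<Longrightarrow> L \<zeta> \<in> N"
    unfolding graph_in_chart_def L_def u_def by blast
  have graph_eq: "F ` (M \<inter> U) = {\<zeta> \<in> F ` U. \<zeta> $ k0 + cnj (\<zeta> $ k0) = of_real (\<phi> (L \<zeta>))}"
    using graph unfolding graph_in_chart_def L_def u_def by blast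
  have inj: "inj_on F U" and FU: "open (F ` U)"
    using chart by (auto simp: holomorphic_chart_def holomorphic_map_on_def)
  obtain A B C where abc: "\<And>z. \<phi>21 z =
        (\<Sum>j\<in>I2. \<Sum>k\<in>I2. \<Sum>l\<in>I3. A j k l * z $ j * z $ k * cnj (z $ l)) +
        (\<Sum>j\<in>I2. \<Sum>k\<in>I3. \<Sum>l\<in>I3. B j k l * z $ j * z $ k * cnj (z $ l)) +
        (\<Sum>j\<in>I3. \<Sum>k\<in>I3. \<Sum>l\<in>I3. C j k l * z $ j * z $ k * cnj (z $ l))"
    using nf unfolding cubic_normal_form_def is_phi21_def I3_def by blast
  obtain \<epsilon> where eps: "\<And>z u. \<phi>111 z u = (\<Sum>j\<in>I3. \<epsilon> j * (cmod (z $ j))\<^sup>2 * u)"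
    using nf unfolding cubic_normal_form_def is_phi111_def I3_def by blast
  obtain \<sigma> where bigo: "(\<lambda>(z, u). \<phi> (z, u) - ((\<Sum>j\<in>I2. \<sigma> j * (cmod (z $ j))\<^sup>2) + 2 * Re (\<phi>21 z) + \<phi>111 z u))
          \<in> O[at 0 within {(z, u). z $ k0 = 0}](\<lambda>x. norm x ^ 4)"
    using nf unfolding cubic_normal_form_def by blast
  define Q where "Q z = (\<Sum>j\<in>I2. \<sigma> j * (cmod (z $ j))\<^sup>2)" for z :: "complex ^ 'n"
  define P where "P z = (\<Sum>j\<in>I2. \<Sum>k\<in>I2. \<Sum>l\<in>I3. A j k l * (z $ j * z $ k * cnj (z $ l))) +
        (\<Sum>j\<in>I2. \<Sum>k\<in>I3. \<Sum>l\<in>I3. B j k l * (z $ j * z $ k * cnj (z $ l))) +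
        (\<Sum>j\<in>I3. \<Sum>k\<in>I3. \<Sum>l\<in>I3. C j k l * (z $ j * z $ k * cnj (z $ l)))" for z :: "complex ^ 'n"
  have \<phi>21: "\<phi>21 z = P z" for z
    unfolding abc P_def by (simp only: mult.assoc)
  define R where "R z = (\<Sum>j\<in>I3. \<epsilon> j * ((cmod (z $ j))\<^sup>2 * u z))" for z
  define c where "c z = 2 * Re (P z) + R z" for z
  have zp: "zpart k0 z $ j = z $ j" if "j \<in> I2 \<or> j \<in> I3" for z :: "complex ^ 'n" and j
    using that k0 by (auto simp: zpart_def)
  have Qz: "Q (zpart k0 z) = Q z" and Pz: "P (zpart k0 z) = P z" and Rz: "\<phi>111 (zpart k0 z) (u z) = R z" for z
    unfolding Q_def P_def R_def eps by (simp_all add: zp mult.assoc)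
  have hom: "Q (t *\<^sub>R z) = t\<^sup>2 * Q z" "P (t *\<^sub>R z) = of_real (t^3) * P z" "R (t *\<^sub>R z) = t^3 * R z" for t z
  proof -
    show "Q (t *\<^sub>R z) = t\<^sup>2 * Q z"
      by (simp add: Q_def power_mult_distrib sum_distrib_left mult_ac)
    have "(cmod ((t *\<^sub>R z) $ j))\<^sup>2 = t * (t * (cmod (z $ j))\<^sup>2)" for j
      by (simp add: power_mult_distrib power2_eq_square)
    moreover have "u (t *\<^sub>R z) = t * u z"
      by (simp add: u)
    ultimately show "R (t *\<^sub>R z) = t^3 * R z"
      by (simp add: R_def sum_distrib_left power3_eq_cube mult_ac)
    have comp: "(t *\<^sub>R z) $ i = of_real t * z $ i" for i
      using scaleR_conv_of_real[of t "z $ i"] by simp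
    have "w * ((t *\<^sub>R z) $ j * (t *\<^sub>R z) $ k * cnj ((t *\<^sub>R z) $ l)) = of_real (t^3) * (w * (z $ j * z $ k * cnj (z $ l)))"
      for w j k l
      unfolding comp by (simp add: power3_eq_cube mult_ac)
    then show "P (t *\<^sub>R z) = of_real (t^3) * P z"
      unfolding P_def by (simp only: distrib_left sum_distrib_left)
  qed
  have hom_c: "c (t *\<^sub>R z) = t^3 * c z" for t z
    by (simp add: c_def hom distrib_left)
  define \<rho> where "\<rho> \<zeta> = \<phi> (L \<zeta>) + (- 2 * Re (\<zeta> $ k0))" for \<zeta>
  have re_lin: "bounded_linear (\<lambda>\<zeta> :: complex ^ 'n. - 2 * Re (\<zeta> $ k0))"
    by (intro bounded_linear_const_mult bounded_linear_compose[OF bounded_linear_Re bounded_linear_vec_nth])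
  have sm: "smooth_function (F ` U) \<rho>"
  proof
    have "Ck_on k (F ` U) \<rho>" for k
      unfolding \<rho>_def
      by (intro Ck_on_add FU Ck_on_compose[OF FU N(1) smooth_onD[OF N(3)] Ck_on_linear[OF FU L_lin] N(4)]
          Ck_on_linear[OF FU re_lin])
    then show "smooth_on (F ` U) \<rho>" by (simp add: smooth_on_def)
  qed (rule FU)
  have zero: "x \<in> M \<longleftrightarrow> \<rho> (F x) = 0" if x: "x \<in> U" for x
  proof -
    have "x \<in> M \<longleftrightarrow> F x \<in> F ` (M \<inter> U)"
      using inj x by (auto dest: inj_onD)
    also have "\<dots> \<longleftrightarrow> F x $ k0 + cnj (F x $ k0) = of_real (\<phi> (L (F x)))"
      unfolding graph_eq using x by auto
    also have "\<dots> \<longleftrightarrow> \<rho> (F x) = 0"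
      by (auto simp: \<rho>_def complex_eq_iff)
    finally show ?thesis .
  qed
  have L0: "L 0 = 0" using linear_0[OF bounded_linear.linear[OF L_lin]] .
  have \<phi>0: "\<phi> 0 = 0"
    using zero[OF pU] p by (simp add: \<rho>_def Fp L0)
  have zeroFU: "0 \<in> F ` U" using pU Fp by (metis image_eqI)
  \<comment> \<open>On the argument \<open>L (t *\<^sub>R x)\<close> the error term of the normal form is the remainder of the jet.\<close>
  have expand: "\<rho> (t *\<^sub>R x) - (t * (- 2 * Re (x $ k0)) + t\<^sup>2 * Q x + t^3 * c x) =
     (\<lambda>(z, u). \<phi> (z, u) - ((\<Sum>j\<in>I2. \<sigma> j * (cmod (z $ j))\<^sup>2) + 2 * Re (\<phi>21 z) + \<phi>111 z u)) (L (t *\<^sub>R x))" for t x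
    unfolding L_def prod.case Q_def[symmetric] \<phi>21 Qz Pz Rz hom
    by (simp add: \<rho>_def L_def c_def algebra_simps)
  have jet: "\<exists>K. \<forall>\<^sub>F t in at_right 0.
      \<bar>\<rho> (t *\<^sub>R x) - (t * (- 2 * Re (x $ k0)) + t\<^sup>2 * Q x + t^3 * c x)\<bar> \<le> K * t^4" for x
  \<comment> \<open>The error bound is stated on a punctured neighbourhood; rays on which \<open>L\<close> vanishes lie in
    the real \<open>w\<close> direction and need the value \<open>\<phi> 0 = 0\<close>.\<close>
  proof (cases "L x = 0")
    case True
    then have "L (t *\<^sub>R x) = 0" for t
      by (simp add: linear_scale[OF bounded_linear.linear[OF L_lin]])
    then have "\<rho> (t *\<^sub>R x) - (t * (- 2 * Re (x $ k0)) + t\<^sup>2 * Q x + t^3 * c x) = 0" for t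
      unfolding expand using \<phi>0 by (simp add: \<phi>21 P_def eps zero_prod_def)
    then show ?thesis
      by (intro exI[of _ 0]) simp
  next
    case False
    obtain K where "\<forall>\<^sub>F y in at 0 within {(z, u). z $ k0 = 0}.
        norm ((\<lambda>(z, u). \<phi> (z, u) - ((\<Sum>j\<in>I2. \<sigma> j * (cmod (z $ j))\<^sup>2) + 2 * Re (\<phi>21 z) + \<phi>111 z u)) y)
          \<le> K * norm (norm y ^ 4)"
      using landau_o.bigE[OF bigo] by blast
    then obtain d where d: "0 < d" "\<And>y. y \<in> {(z, u). z $ k0 = 0} \<Longrightarrow> y \<noteq> 0 \<Longrightarrow> dist y 0 < d \<Longrightarrow>
        norm ((\<lambda>(z, u). \<phi> (z, u) - ((\<Sum>j\<in>I2. \<sigma> j * (cmod (z $ j))\<^sup>2) + 2 * Re (\<phi>21 z) + \<phi>111 z u)) y)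
          \<le> K * norm (norm y ^ 4)"
      unfolding eventually_at by blast
    have "\<bar>\<rho> (t *\<^sub>R x) - (t * (- 2 * Re (x $ k0)) + t\<^sup>2 * Q x + t^3 * c x)\<bar> \<le> K * norm (L x) ^ 4 * t^4"
      if t: "0 < t" "t < d / norm (L x)" for t
    proof -
      have Lt: "L (t *\<^sub>R x) = t *\<^sub>R L x"
        by (simp add: linear_scale[OF bounded_linear.linear[OF L_lin]])
      have "L (t *\<^sub>R x) \<in> {(z, u). z $ k0 = 0}" by (simp add: L_def zpart_def)
      moreover have "L (t *\<^sub>R x) \<noteq> 0" using False t by (simp add: Lt)
      moreover have "dist (L (t *\<^sub>R x)) 0 < d"
        using t False by (simp add: Lt pos_less_divide_eq)
      ultimately have "\<bar>\<rho> (t *\<^sub>R x) - (t * (- 2 * Re (x $ k0)) + t\<^sup>2 * Q x + t^3 * c x)\<bar> \<le> K * norm (norm (L (t *\<^sub>R x)) ^ 4)"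
        unfolding expand using d(2)[of "L (t *\<^sub>R x)"] by simp
      then show ?thesis
        using t(1) by (simp add: Lt power_mult_distrib mult_ac)
    qed
    moreover have "0 < d / norm (L x)" using d(1) False by simp
    ultimately show ?thesis
      unfolding eventually_at_right_field by blast
  qed
  interpret rho: smooth_function "F ` U" \<rho> by (rule sm)
  interpret jet: cubic_jet \<rho> "F ` U" "\<lambda>x. - 2 * Re (x $ k0)" Q c
  proof
    show "diff3 Q 0 a b c = 0" for a b c
      unfolding Q_def diff3_sum diff3_cmult diff3_norm_square by simp
  qed (use FU zeroFU smooth_onD[OF rho.smooth] bounded_linear.linear[OF re_lin] jet in auto)
  have lev0: "lev \<rho> 0 a b = 0" if "\<And>j. j \<in> I2 \<Longrightarrow> a $ j = 0" for a b
    unfolding lev_def jet.second_derivative Q_def diff2_sum diff2_cmult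
    using that by (simp add: diff2_norm_square)
  have crit: "levi3 c X a = 0" if a: "\<And>j. j \<notin> I3 \<Longrightarrow> a $ j = 0" and X: "Re (X $ k0) = 0" for a X
  proof -
    have ak: "a $ k0 = 0" "\<And>j. j \<in> I2 \<Longrightarrow> a $ j = 0" using a k0 by (auto simp: I3_def)
    have "dd (\<lambda>y. lev \<rho> y a a) (F p) X = 0"
    proof (rule chart_levi_critical[OF pc p pU chart sm zero])
      show "dd \<rho> (F p) (axis k0 1) \<noteq> 0"
        by (simp add: Fp jet.first_derivative)
    qed (use ak X lev0 in \<open>simp_all add: Fp jet.first_derivative\<close>)
    then show ?thesis
      using zeroFU by (simp add: Fp dd_eqI[OF rho.dd_lev_constant] jet.third_derivative levi3_def)
  qed
  have levi3_c: "levi3 c X a = 8 * Re (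
        (\<Sum>j\<in>I2. \<Sum>k\<in>I2. \<Sum>l\<in>I3. A j k l * ((X $ j * a $ k + a $ j * X $ k) * cnj (a $ l))) +
        (\<Sum>j\<in>I2. \<Sum>k\<in>I3. \<Sum>l\<in>I3. B j k l * ((X $ j * a $ k + a $ j * X $ k) * cnj (a $ l))) +
        (\<Sum>j\<in>I3. \<Sum>k\<in>I3. \<Sum>l\<in>I3. C j k l * ((X $ j * a $ k + a $ j * X $ k) * cnj (a $ l)))) +
      4 * (\<Sum>j\<in>I3. \<epsilon> j * (cmod (a $ j))\<^sup>2) * u X" if ak: "a $ k0 = 0" for X a
  proof -
    have R: "levi3 R X a = 4 * (\<Sum>j\<in>I3. \<epsilon> j * (cmod (a $ j))\<^sup>2) * u X"
    proof -
      have ua: "u a = 0" "u (\<i> *s a) = 0" using ak by (simp_all add: u)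
      show ?thesis
        unfolding R_def levi3_sum levi3_cmult levi3_norm_square_linear[OF u_lin ua]
        by (simp add: sum_distrib_left sum_distrib_right mult_ac)
    qed
    have P: "levi3 P X a = 4 * (
        (\<Sum>j\<in>I2. \<Sum>k\<in>I2. \<Sum>l\<in>I3. A j k l * ((X $ j * a $ k + a $ j * X $ k) * cnj (a $ l))) +
        (\<Sum>j\<in>I2. \<Sum>k\<in>I3. \<Sum>l\<in>I3. B j k l * ((X $ j * a $ k + a $ j * X $ k) * cnj (a $ l))) +
        (\<Sum>j\<in>I3. \<Sum>k\<in>I3. \<Sum>l\<in>I3. C j k l * ((X $ j * a $ k + a $ j * X $ k) * cnj (a $ l))))"
      unfolding P_def levi3_add levi3_sum levi3_cmult levi3_monomial
      by (simp only: distrib_left sum_distrib_left mult.left_commute[of 4])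
    show ?thesis
      unfolding c_def levi3_add levi3_cmult levi3_Re R P by simp
  qed
  have re_zero: "w = 0" if "\<And>\<kappa>. Re (\<kappa> * w) = 0" for w
    using that[of 1] that[of \<i>] by (simp add: complex_eq_iff)
  have re8: "Re w' = 0" if "v = 8 * Re w" "v = 0" "w = w'" for v and w w' :: complex
    using that by simp
  define z3 where "z3 z = (\<chi> j. if j \<in> I3 then z $ j else 0)" for z :: "complex ^ 'n"
  have z3: "z3 z $ j = (if j \<in> I3 then z $ j else 0)" for z j
    by (simp add: z3_def)
  have I23: "j \<notin> I3" if "j \<in> I2" for j
    using that by (simp add: I3_def)
  have b_zero: "(\<Sum>j\<in>I2. \<Sum>k\<in>I3. \<Sum>l\<in>I3. B j k l * z $ j * z $ k * cnj (z $ l)) = 0" for z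
  proof -
    have "Re (\<kappa> * (\<Sum>j\<in>I2. \<Sum>k\<in>I3. \<Sum>l\<in>I3. B j k l * z $ j * z $ k * cnj (z $ l))) = 0" for \<kappa>
    proof -
      \<comment> \<open>The factor \<open>\<kappa>\<close> rotates the direction, which turns the vanishing of a real part into the
        vanishing of a complex number.\<close>
      define X where "X = (\<chi> j. if j \<in> I2 then \<kappa> * z $ j else 0)"
      have X: "X $ j = \<kappa> * z $ j" if "j \<in> I2" for j
        using that by (simp add: X_def)
      have X3: "X $ j = 0" if "j \<in> I3" for j
        using that I23 by (auto simp: X_def)
      have Xk: "X $ k0 = 0" using k0 by (simp add: X_def)
      then have uX: "u X = 0" by (simp add: u)
      have "levi3 c X (z3 z) = 8 * Re (\<Sum>j\<in>I2. \<Sum>k\<in>I3. \<Sum>l\<in>I3. B j k l * (\<kappa> * z $ j * z $ k * cnj (z $ l)))"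
        using k0 by (subst levi3_c) (simp_all add: z3 X X3 I23 uX)
      moreover have "levi3 c X (z3 z) = 0"
        by (intro crit) (simp_all add: z3 Xk)
      moreover have "(\<Sum>j\<in>I2. \<Sum>k\<in>I3. \<Sum>l\<in>I3. B j k l * (\<kappa> * z $ j * z $ k * cnj (z $ l))) =
         \<kappa> * (\<Sum>j\<in>I2. \<Sum>k\<in>I3. \<Sum>l\<in>I3. B j k l * z $ j * z $ k * cnj (z $ l))"
        by (simp add: sum_distrib_left mult_ac)
      ultimately show ?thesis
        by (rule re8)
    qed
    then show ?thesis
      by (rule re_zero)
  qed
  have c_zero: "(\<Sum>j\<in>I3. \<Sum>k\<in>I3. \<Sum>l\<in>I3. C j k l * z $ j * z $ k * cnj (z $ l)) = 0" for z
  proof -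
    have "Re (\<kappa> * (2 * (\<Sum>j\<in>I3. \<Sum>k\<in>I3. \<Sum>l\<in>I3. C j k l * z $ j * z $ k * cnj (z $ l)))) = 0" for \<kappa>
    proof -
      define X where "X = \<kappa> *s z3 z"
      have X: "X $ j = \<kappa> * z3 z $ j" for j
        by (simp add: X_def)
      have uX: "u X = 0" using k0 by (simp add: u X z3)
      have "levi3 c X (z3 z) = 8 * Re (\<Sum>j\<in>I3. \<Sum>k\<in>I3. \<Sum>l\<in>I3. C j k l * (2 * \<kappa> * z $ j * z $ k * cnj (z $ l)))"
        using k0 by (subst levi3_c) (simp_all add: z3 X I23 uX algebra_simps)
      moreover have "levi3 c X (z3 z) = 0"
        using k0 by (intro crit) (simp_all add: z3 X)
      moreover have "(\<Sum>j\<in>I3. \<Sum>k\<in>I3. \<Sum>l\<in>I3. C j k l * (2 * \<kappa> * z $ j * z $ k * cnj (z $ l))) =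
         \<kappa> * (2 * (\<Sum>j\<in>I3. \<Sum>k\<in>I3. \<Sum>l\<in>I3. C j k l * z $ j * z $ k * cnj (z $ l)))"
        by (simp add: sum_distrib_left mult_ac)
      ultimately show ?thesis
        by (rule re8)
    qed
    from re_zero[OF this] show ?thesis by simp
  qed
  have eps_zero: "(\<Sum>j\<in>I3. \<epsilon> j * (cmod (z $ j))\<^sup>2) = 0" for z :: "complex ^ 'n"
  proof -
    \<comment> \<open>The direction of \<open>u\<close>, tangent to \<open>M\<close> because its \<open>w\<close> component is imaginary.\<close>
    define X where "X = (axis k0 \<i> :: complex ^ 'n)"
    have X: "X $ j = 0" if "j \<in> I2 \<or> j \<in> I3" for j
      using that k0 by (auto simp: X_def axis_def)
    have uX: "u X = - 2" by (simp add: u X_def)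
    have "levi3 c X (z3 z) = - 8 * (\<Sum>j\<in>I3. \<epsilon> j * (cmod (z $ j))\<^sup>2)"
      using k0 by (subst levi3_c) (simp_all add: z3 X uX)
    moreover have "levi3 c X (z3 z) = 0"
      using k0 by (intro crit) (simp_all add: z3 X_def)
    ultimately show ?thesis by simp
  qed
  have "\<phi>111 z u = 0" for z u
    unfolding eps sum_distrib_right[symmetric] eps_zero by simp
  moreover have "\<phi>21 z = (\<Sum>j\<in>I2. \<Sum>k\<in>I2. \<Sum>l\<in>I3. A j k l * z $ j * z $ k * cnj (z $ l))" for z
    unfolding abc b_zero c_zero by simp
  ultimately show ?thesis
    unfolding I3_def[symmetric] by blast
qed

theorem lemma3p14:
  fixes M :: "(complex ^ 'n::finite) set" and p :: "complex ^ 'n" and q :: nat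
  assumes "real_hypersurface M" and "pseudoconvex M" and "p \<in> M" and "levi_rank M p = q"
  shows "(\<forall>v3 \<in> CT M p. \<forall>v2 \<in> K10 M p. \<forall>v1 \<in> K01 M p.
             cubic_tensor M p v3 v2 v1 = CQ_zero M p)
       \<and> (\<forall>v3 \<in> CK M p. \<forall>v2 \<in> K10 M p. \<forall>v1 \<in> K01 M p.
             cubic_tensor M p v3 v2 v1 = CQ_zero M p)
       \<and> (\<forall>U F k0 I2 \<phi> \<phi>21 \<phi>111.
             cubic_normal_form M p q U F k0 I2 \<phi> \<phi>21 \<phi>111 \<longrightarrow>
             (\<exists>c. \<forall>z. \<phi>21 z =
                (\<Sum>j\<in>I2. \<Sum>k\<in>I2. \<Sum>l\<in>- insert k0 I2. c j k l * z $ j * z $ k * cnj (z $ l)))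
             \<and> (\<forall>z u. \<phi>111 z u = 0))"
proof -
  obtain U r where U: "p \<in> U" "defining_function M U r"
    using assms(1,3) unfolding real_hypersurface_def by blast
  interpret hypersurface_patch U r M
    using U(2) by unfold_locales (auto simp: defining_function_def)
  have tensor: "cubic_tensor M p v3 v2 v1 = CQ_zero M p"
    if "v3 \<in> CT M p" "v2 \<in> K10 M p" "v1 \<in> K01 M p" for v3 v2 v1
    by (rule cubic_tensor_vanishes[OF assms(2,3) U(1) that])
  show ?thesis
  proof (intro conjI ballI)
    show "cubic_tensor M p v3 v2 v1 = CQ_zero M p"
      if "v3 \<in> CK M p" "v2 \<in> K10 M p" "v1 \<in> K01 M p" for v3 v2 v1
      using CK_subset_CT[OF assms(3) U(1)] that by (intro tensor) auto
    show "\<forall>U F k0 I2 \<phi> \<phi>21 \<phi>111.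
             cubic_normal_form M p q U F k0 I2 \<phi> \<phi>21 \<phi>111 \<longrightarrow>
             (\<exists>c. \<forall>z. \<phi>21 z =
                (\<Sum>j\<in>I2. \<Sum>k\<in>I2. \<Sum>l\<in>- insert k0 I2. c j k l * z $ j * z $ k * cnj (z $ l)))
             \<and> (\<forall>z u. \<phi>111 z u = 0)"
      using cubic_normal_form_vanishing[OF assms(2,3)] by (intro allI impI)
  qed (rule tensor)
qed

end
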